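(* There is an absolute constant $A>0$ (independent of $p$ and $f$) such that the following holds. Let $1<p<\infty$, let $p'=p/(p-1)$, let $f\in L^p([0,1]^2)$ and assume that $I_p(f)$ and $J_p(f)$ are finite. Then there exists a continuous function $\bar f\in V_p[V_p]$ such that $f=\bar f$ a.e., and $$W_p(\bar f)\le A\left[\omega(f;1,1)_p+\frac{1}{pp'}K_p(f)+\left(\frac{1}{pp'}\right)^2I_p(f)\right].$$
   Context: Functions are real-valued. $L^p([0,1]^2)$ is the class of measurable functions $f$ on $\mathbb{R}^2$ that are 1-periodic in each variable with $\|f\|_p=(\int_{[0,1]^2}|f|^p)^{1/p}<\infty$. For $h\in\mathbb{R}^2$, $\Delta(h)f(x)=f(x+h)-f(x)$, and $\omega(f;\delta)_p=\sup_{|h|\le\delta}\|\Delta(h)f\|_p$, $0<\delta\le1$. For $s,t\in\mathbb{R}$, $\Delta(s,t)f(x,y)=f(x+s,y+t)-f(x+s,y)-f(x,y+t)+f(x,y)$, and $\omega(f;u,v)_p=\sup_{0\le s\le u,\,0\le t\le v}\|\Delta(s,t)f\|_p$. Set $$J_p(f)=\int_0^1t^{-1/p}\omega(f;t)_p\frac{dt}{t},\qquad K_p(f)=\int_0^1t^{-1/p}[\omega(f;t,1)_p+\omega(f;1,t)_p]\frac{dt}{t},$$ $$I_p(f)=\int_0^1\int_0^1(uv)^{-1/p}\omega(f;u,v)_p\frac{du}{u}\frac{dv}{v}.$$ For a 1-periodic function $h$ on $\mathbb{R}$, $v_p(h)=\sup_\Pi\big(\sum_{k=0}^{n-1}|h(x_{k+1})-h(x_k)|^p\big)^{1/p}$,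 the supremum over all partitions $\Pi=\{x_0<x_1<\dots<x_n=x_0+1\}$; $h\in V_p$ means $v_p(h)<\infty$. For a function $f(x,y)$ on $\mathbb{R}^2$, 1-periodic in both variables, put $\varphi_p[f](x)=v_p(f(x,\cdot))$ and $\psi_p[f](y)=v_p(f(\cdot,y))$. The class $V_p[V_p]$ consists of all such $f$ for which (with $\varphi_p[f]$ and $\psi_p[f]$ finite everywhere) $W_p(f)=v_p(\varphi_p[f])+v_p(\psi_p[f])<\infty$. *)

theory Defs
  imports "HOL-Analysis.Analysis"
begin

text \<open>
  Norms, moduli of continuity and variations are suprema or integrals of nonnegative
  quantities that may be infinite a priori; they take values in \<^typ>\<open>ennreal\<close>.
\<close>

text \<open>Real powers of extended nonnegative reals; used for exponents \<open>r > 0\<close> only.\<close>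

definition epowr :: "ennreal \<Rightarrow> real \<Rightarrow> ennreal" where
  "epowr a r = (if a = \<infinity> then \<infinity> else ennreal (enn2real a powr r))"

definition periodic1 :: "(real \<Rightarrow> real) \<Rightarrow> bool" where
  "periodic1 h \<longleftrightarrow> (\<forall>x. h (x + 1) = h x)"

definition periodic2 :: "(real \<times> real \<Rightarrow> real) \<Rightarrow> bool" where
  "periodic2 f \<longleftrightarrow> (\<forall>y. periodic1 (\<lambda>x. f (x, y))) \<and> (\<forall>x. periodic1 (\<lambda>y. f (x, y)))"

definition Lp_norm :: "real \<Rightarrow> (real \<times> real \<Rightarrow> real) \<Rightarrow> ennreal" where
  "Lp_norm p f =
     epowr (\<integral>\<^sup>+z\<in>{0..1} \<times> {0..1}. ennreal (\<bar>f z\<bar> powr p) \<partial>lebesgue) (1 / p)"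

definition Lp_space :: "real \<Rightarrow> (real \<times> real \<Rightarrow> real) set" where
  "Lp_space p = {f. f \<in> borel_measurable lebesgue \<and> periodic2 f \<and> Lp_norm p f < \<infinity>}"

definition diff1 :: "real \<times> real \<Rightarrow> (real \<times> real \<Rightarrow> real) \<Rightarrow> real \<times> real \<Rightarrow> real" where
  "diff1 h f z = f (z + h) - f z"

definition diff2 :: "real \<Rightarrow> real \<Rightarrow> (real \<times> real \<Rightarrow> real) \<Rightarrow> real \<times> real \<Rightarrow> real" where
  "diff2 s t f = (\<lambda>(x, y). f (x + s, y + t) - f (x + s, y) - f (x, y + t) + f (x, y))"

text \<open>The norm on \<^typ>\<open>real \<times> real\<close> is the Euclidean one.\<close>

definition modulus :: "real \<Rightarrow> (real \<times> real \<Rightarrow> real) \<Rightarrow> real \<Rightarrow> ennreal" where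
  "modulus p f \<delta> = (SUP h\<in>{h. norm h \<le> \<delta>}. Lp_norm p (diff1 h f))"

definition mixed_modulus :: "real \<Rightarrow> (real \<times> real \<Rightarrow> real) \<Rightarrow> real \<Rightarrow> real \<Rightarrow> ennreal" where
  "mixed_modulus p f u v = (SUP (s, t)\<in>{0..u} \<times> {0..v}. Lp_norm p (diff2 s t f))"

definition J_int :: "real \<Rightarrow> (real \<times> real \<Rightarrow> real) \<Rightarrow> ennreal" where
  "J_int p f = (\<integral>\<^sup>+t\<in>{0<..1}. ennreal (t powr (- 1 / p) / t) * modulus p f t \<partial>lborel)"

definition K_int :: "real \<Rightarrow> (real \<times> real \<Rightarrow> real) \<Rightarrow> ennreal" where
  "K_int p f = (\<integral>\<^sup>+t\<in>{0<..1}. ennreal (t powr (- 1 / p) / t) *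
                  (mixed_modulus p f t 1 + mixed_modulus p f 1 t) \<partial>lborel)"

definition I_int :: "real \<Rightarrow> (real \<times> real \<Rightarrow> real) \<Rightarrow> ennreal" where
  "I_int p f = (\<integral>\<^sup>+v\<in>{0<..1}. (\<integral>\<^sup>+u\<in>{0<..1}.
                  ennreal ((u * v) powr (- 1 / p) / u / v) * mixed_modulus p f u v
                \<partial>lborel) \<partial>lborel)"

text \<open>
  A partition \<open>x\<^sub>0 < \<dots> < x\<^sub>n = x\<^sub>0 + 1\<close> is given by \<open>n\<close> and a sequence of which only
  the entries with index at most \<open>n\<close> matter; \<open>n \<ge> 1\<close> is forced by \<open>x n = x 0 + 1\<close>.
\<close>

definition period_partition :: "nat \<Rightarrow> (nat \<Rightarrow> real) \<Rightarrow> bool" where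
  "period_partition n x \<longleftrightarrow> (\<forall>k<n. x k < x (Suc k)) \<and> x n = x 0 + 1"

definition p_var :: "real \<Rightarrow> (real \<Rightarrow> real) \<Rightarrow> ennreal" where
  "p_var p h = (SUP (n, x)\<in>{(n, x). period_partition n x}.
                  ennreal ((\<Sum>k<n. \<bar>h (x (Suc k)) - h (x k)\<bar> powr p) powr (1 / p)))"

definition phi_var :: "real \<Rightarrow> (real \<times> real \<Rightarrow> real) \<Rightarrow> real \<Rightarrow> ennreal" where
  "phi_var p f x = p_var p (\<lambda>y. f (x, y))"

definition psi_var :: "real \<Rightarrow> (real \<times> real \<Rightarrow> real) \<Rightarrow> real \<Rightarrow> ennreal" where
  "psi_var p f y = p_var p (\<lambda>x. f (x, y))"

text \<open>
  \<^const>\<open>enn2real\<close> sends \<open>\<infinity>\<close> to \<open>0\<close>, so \<open>W_var\<close> is meaningful only when \<open>phi_var p f\<close>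
  and \<open>psi_var p f\<close> are finite everywhere, as membership in \<open>VV_class\<close> requires.
\<close>

definition W_var :: "real \<Rightarrow> (real \<times> real \<Rightarrow> real) \<Rightarrow> ennreal" where
  "W_var p f = p_var p (\<lambda>x. enn2real (phi_var p f x)) + p_var p (\<lambda>y. enn2real (psi_var p f y))"

definition VV_class :: "real \<Rightarrow> (real \<times> real \<Rightarrow> real) set" where
  "VV_class p = {f. periodic2 f \<and> (\<forall>x. phi_var p f x < \<infinity>) \<and> (\<forall>y. psi_var p f y < \<infinity>) \<and>
                    W_var p f < \<infinity>}"

end

theory Submission
  imports Defs
begin

text \<open>
  One quantity controls both halves of \<^const>\<open>W_var\<close>: the \<open>\<ell>\<^sup>p\<close>-sum of the mixed increments of \<open>f\<close>
  over the cells of a net, where a net partitions the \<open>x\<close>-period into strips and then partitions the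
  \<open>y\<close>-period independently over each strip.  Since \<open>v\<^sub>p\<close> satisfies the triangle inequality, the
  increment of \<open>\<phi>\<^sub>p[f]\<close> across a strip is at most \<open>v\<^sub>p\<close> of the difference of the two bounding rows, and a
  nearly optimal partition for each such difference is exactly a net (\<open>p_var_phi_le\<close>).

  For continuous \<open>f\<close> this net variation is estimated by a multiscale decomposition.  Let \<open>S\<^sub>h\<close> be the
  average over \<open>[x, x + h]\<close>, and let \<open>h\<^sub>m = 2 powr (- r * m)\<close> with \<open>r = p\<close> for \<open>p \<ge> 2\<close> and \<open>r = p'\<close> for
  \<open>p < 2\<close>.  Averaging over a full period leaves a constant, so the mixed increments of \<open>f\<close> are the sums
  of those of the blocks obtained by applying \<open>S\<close> at scale \<open>h\<^sub>m\<^sub>+\<^sub>1\<close> minus \<open>S\<close> at scale \<open>h\<^sub>m\<close> in each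
  variable.  For one block, an increment over an interval is bounded through the derivative if the
  interval is short and through the values if it is long; in both cases the bound is an integral over
  that interval, so the bounds over all cells of a net add up to an integral over the unit square,
  which only contains \<open>L\<^sup>p\<close>-norms of mixed differences of \<open>f\<close> (\<open>block_net_le\<close>).  Hence a block costs an
  absolute constant times \<open>(h k) powr (- 1 / p) * \<omega>(f; h, k)\<^sub>p\<close> (\<open>net_variation_le_scaled_sum\<close>).

  The factor \<open>1 / (p * p')\<close> comes from the sparse choice of scales: the intervals \<open>[h\<^sub>m\<^sub>+\<^sub>1, h\<^sub>m]\<close> have
  logarithmic length comparable to \<open>p * p'\<close>, yet along each of them \<open>h powr (- 1 / p) * \<omega>(h)\<close> stays
  bounded from below by its value at one end, up to an absolute constant
  (\<open>sum_scaled_le_integral\<close>).  The scale \<open>1\<close> in both, in one or in no variable gives the three terms of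
  the bound (\<open>sum_scaled2_le_integrals\<close>).

  A general \<open>f\<close> is replaced by its averages over small squares, which are continuous and have no larger
  moduli.  They converge uniformly: multiplying by cosine cut-offs turns point values and rows into
  mixed increments of a product, whose moduli involve \<open>\<omega>(f; \<cdot>)\<^sub>p\<close> as well, and this is where the
  finiteness of \<open>J\<^sub>p(f)\<close> enters (\<open>net_variation_localize\<close>, \<open>approx_uniform_limit\<close>).  The limit is the
  continuous representative, and it inherits the net variation bound.
\<close>

section \<open>Convexity inequalities for powers\<close>

lemma powr_above_tangent:
  fixes p t m :: real
  assumes "p \<ge> 1" "t \<ge> 0" "m \<ge> 0"
  shows "m powr p + p * m powr (p - 1) * (t - m) \<le> t powr p"
proof (cases "m = 0 \<or> t = 0")
  case True
  then show ?thesis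
  proof
    assume "t = 0"
    moreover have "m powr (p - 1) * m = m powr p"
      using assms powr_mult_base[of m "p - 1"] by (simp add: mult.commute)
    ultimately have "m powr p + p * m powr (p - 1) * (t - m) = m powr p - p * m powr p"
      by (simp add: mult.assoc)
    also have "\<dots> \<le> 0" using assms by (simp add: mult_right_mono[of 1 p "m powr p", simplified])
    finally show ?thesis using \<open>t = 0\<close> by simp
  qed auto
next
  case False
  then have pos: "m > 0" "t > 0" using assms by auto
  have "t powr p - m powr p \<ge> p * m powr (p - 1) * (t - m)"
  proof (rule convex_on_imp_above_tangent[where A="{0<..}"])
    show "convex_on {0<..} (\<lambda>t. t powr p)"
      using powr_convex[OF assms(1)] by (rule convex_on_subset) auto
    show "((\<lambda>t. t powr p) has_real_derivative p * m powr (p - 1)) (at m within {0<..})"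
      using pos by (auto intro!: derivative_eq_intros)
  qed (use pos in \<open>auto simp: interior_open\<close>)
  then show ?thesis by simp
qed

lemma powr_weighted_mean:
  fixes p :: real and t l :: "'i \<Rightarrow> real"
  assumes "p \<ge> 1" "\<And>j. j \<in> J \<Longrightarrow> l j \<ge> 0" "\<And>j. j \<in> J \<Longrightarrow> t j \<ge> 0" "sum l J = 1"
  shows "(\<Sum>j\<in>J. l j * t j) powr p \<le> (\<Sum>j\<in>J. l j * t j powr p)"
proof -
  define m where "m = (\<Sum>j\<in>J. l j * t j)"
  have "m \<ge> 0" unfolding m_def using assms by (auto intro!: sum_nonneg)
  have "(\<Sum>j\<in>J. l j * (m powr p + p * m powr (p - 1) * (t j - m)))
      = (\<Sum>j\<in>J. (m powr p - p * m powr (p - 1) * m) * l j + (p * m powr (p - 1)) * (l j * t j))"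
    by (intro sum.cong) (auto simp: algebra_simps)
  also have "\<dots> = (m powr p - p * m powr (p - 1) * m) * sum l J + (p * m powr (p - 1)) * m"
    by (simp only: sum.distrib m_def sum_distrib_left)
  finally have "m powr p = (\<Sum>j\<in>J. l j * (m powr p + p * m powr (p - 1) * (t j - m)))"
    using assms(4) by simp
  also have "\<dots> \<le> (\<Sum>j\<in>J. l j * t j powr p)"
    using assms \<open>m \<ge> 0\<close> by (intro sum_mono mult_left_mono powr_above_tangent) auto
  finally show ?thesis unfolding m_def .
qed

lemma powr_sum_le:
  fixes p :: real and a :: "'i \<Rightarrow> real"
  assumes "p \<ge> 1" "finite J"
  shows "\<bar>\<Sum>j\<in>J. a j\<bar> powr p \<le> real (card J) powr (p - 1) * (\<Sum>j\<in>J. \<bar>a j\<bar> powr p)"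
proof (cases "J = {}")
  case False
  define n where "n = real (card J)"
  have n: "n > 0" using False assms unfolding n_def by (simp add: card_gt_0_iff)
  have "\<bar>\<Sum>j\<in>J. a j\<bar> powr p \<le> (n * (\<Sum>j\<in>J. (1/n) * \<bar>a j\<bar>)) powr p"
    using n assms by (intro powr_mono2) (auto simp flip: sum_divide_distrib)
  also have "\<dots> = n powr p * (\<Sum>j\<in>J. (1/n) * \<bar>a j\<bar>) powr p"
    using n by (subst powr_mult) (auto intro!: sum_nonneg)
  also have "\<dots> \<le> n powr p * (\<Sum>j\<in>J. (1/n) * \<bar>a j\<bar> powr p)"
    using n assms by (intro mult_left_mono powr_weighted_mean) (auto simp: n_def)
  also have "\<dots> = n powr (p - 1) * (\<Sum>j\<in>J. \<bar>a j\<bar> powr p)"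
    using n by (simp add: powr_diff flip: sum_distrib_left sum_divide_distrib)
  finally show ?thesis unfolding n_def .
qed simp

lemma powr_add_le:
  fixes a b p :: real
  assumes "p \<ge> 1"
  shows "\<bar>a + b\<bar> powr p \<le> 2 powr (p - 1) * (\<bar>a\<bar> powr p + \<bar>b\<bar> powr p)"
  using powr_sum_le[OF assms, of "{0,1::nat}" "\<lambda>i. if i = 0 then a else b"] by simp

text \<open>
  Minkowski's inequality in \<open>\<ell>\<^sup>p\<close>, stated for upper bounds of the norms of the summands.  Dividing each
  summand by its bound makes the sum a weighted mean, to which convexity applies; summands with bound
  \<open>0\<close> vanish and are removed first.
\<close>

lemma minkowski_dominated:
  fixes a :: "'i \<Rightarrow> 'j \<Rightarrow> real" and B :: "'j \<Rightarrow> real"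
  assumes p: "p \<ge> 1" and fin: "finite I" "finite J"
    and B: "\<And>j. j \<in> J \<Longrightarrow> B j \<ge> 0"
    and dom: "\<And>j. j \<in> J \<Longrightarrow> (\<Sum>i\<in>I. \<bar>a i j\<bar> powr p) \<le> B j powr p"
  shows "(\<Sum>i\<in>I. \<bar>\<Sum>j\<in>J. a i j\<bar> powr p) \<le> (\<Sum>j\<in>J. B j) powr p"
proof -
  \<comment> \<open>Summands with bound \<open>0\<close> vanish and cannot be divided by their bound.\<close>
  define K where "K = {j \<in> J. B j > 0}"
  have K: "finite K" "K \<subseteq> J" using fin unfolding K_def by auto
  have zero: "a i j = 0" if "i \<in> I" "j \<in> J - K" for i j
  proof -
    have "B j = 0" using that B[of j] unfolding K_def by force
    then have "(\<Sum>i\<in>I. \<bar>a i j\<bar> powr p) \<le> 0" using dom[of j] that by simp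
    then have "(\<Sum>i\<in>I. \<bar>a i j\<bar> powr p) = 0" by (simp add: antisym sum_nonneg)
    then show ?thesis using that fin by (simp add: sum_nonneg_eq_0_iff)
  qed
  have sa: "(\<Sum>j\<in>J. a i j) = (\<Sum>j\<in>K. a i j)" if "i \<in> I" for i
    using K fin zero[OF that] by (intro sum.mono_neutral_right) auto
  have sB: "(\<Sum>j\<in>J. B j) = (\<Sum>j\<in>K. B j)"
    using K fin B by (intro sum.mono_neutral_right) (force simp: K_def)+
  show ?thesis
  proof (cases "K = {}")
    case True
    then show ?thesis using sa sB by simp
  next
    case False
    define S where "S = (\<Sum>j\<in>K. B j)"
    have S: "S > 0" unfolding S_def using False K by (intro sum_pos) (auto simp: K_def)
    have *: "\<bar>\<Sum>j\<in>K. a i j\<bar> powr p \<le> S powr p * (\<Sum>j\<in>K. (B j / S) * (\<bar>a i j\<bar> / B j) powr p)" for i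
    proof -
      have "\<bar>\<Sum>j\<in>K. a i j\<bar> \<le> (\<Sum>j\<in>K. \<bar>a i j\<bar>)" by (rule sum_abs)
      also have "\<dots> = S * (\<Sum>j\<in>K. (B j / S) * (\<bar>a i j\<bar> / B j))"
        using S by (auto simp: sum_distrib_left K_def intro!: sum.cong)
      finally have "\<bar>\<Sum>j\<in>K. a i j\<bar> powr p \<le> (S * (\<Sum>j\<in>K. (B j / S) * (\<bar>a i j\<bar> / B j))) powr p"
        using p by (intro powr_mono2) auto
      also have "\<dots> = S powr p * (\<Sum>j\<in>K. (B j / S) * (\<bar>a i j\<bar> / B j)) powr p"
        using S by (subst powr_mult) (auto intro!: sum_nonneg simp: K_def)
      also have "\<dots> \<le> S powr p * (\<Sum>j\<in>K. (B j / S) * (\<bar>a i j\<bar> / B j) powr p)"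
        using S p by (intro mult_left_mono powr_weighted_mean)
          (auto simp: K_def S_def simp flip: sum_divide_distrib)
      finally show ?thesis .
    qed
    have "(\<Sum>i\<in>I. \<bar>\<Sum>j\<in>J. a i j\<bar> powr p) = (\<Sum>i\<in>I. \<bar>\<Sum>j\<in>K. a i j\<bar> powr p)"
      using sa by simp
    also have "\<dots> \<le> (\<Sum>i\<in>I. S powr p * (\<Sum>j\<in>K. (B j / S) * (\<bar>a i j\<bar> / B j) powr p))"
      by (intro sum_mono *)
    also have "\<dots> = S powr p * (\<Sum>j\<in>K. (B j / S) * ((\<Sum>i\<in>I. \<bar>a i j\<bar> powr p) / B j powr p))"
    proof -
      have "(\<Sum>i\<in>I. (\<Sum>j\<in>K. (B j / S) * (\<bar>a i j\<bar> / B j) powr p)) =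
          (\<Sum>j\<in>K. \<Sum>i\<in>I. (B j / S) * (\<bar>a i j\<bar> / B j) powr p)" by (rule sum.swap)
      also have "\<dots> = (\<Sum>j\<in>K. (B j / S) * ((\<Sum>i\<in>I. \<bar>a i j\<bar> powr p) / B j powr p))"
        by (intro sum.cong) (auto simp: K_def powr_divide sum_distrib_left sum_divide_distrib)
      finally show ?thesis by (simp flip: sum_distrib_left)
    qed
    also have "\<dots> \<le> S powr p * (\<Sum>j\<in>K. (B j / S) * 1)"
      using S dom K by (intro mult_left_mono sum_mono) (auto simp: K_def)
    also have "\<dots> = S powr p" using S by (simp add: S_def flip: sum_divide_distrib)
    finally show ?thesis unfolding S_def sB .
  qed
qed

text \<open>
  The integral of the tangent to \<open>t powr p\<close> at the modulus of the mean.  For a non-integrable \<open>\<phi>\<close> the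
  Bochner integral is \<open>0\<close>, and so is the left-hand side.
\<close>

lemma jensen_powr:
  fixes \<phi> :: "'a \<Rightarrow> real"
  assumes p: "p \<ge> 1" and M: "emeasure M (space M) = 1" and meas: "\<phi> \<in> borel_measurable M"
  shows "ennreal (\<bar>\<integral>x. \<phi> x \<partial>M\<bar> powr p) \<le> (\<integral>\<^sup>+x. ennreal (\<bar>\<phi> x\<bar> powr p) \<partial>M)"
proof (cases "integrable M \<phi> \<and> (\<integral>\<^sup>+x. ennreal (\<bar>\<phi> x\<bar> powr p) \<partial>M) < \<infinity>")
  case False
  then have "\<not> integrable M \<phi> \<or> (\<integral>\<^sup>+x. ennreal (\<bar>\<phi> x\<bar> powr p) \<partial>M) = top"
    using less_top[of "\<integral>\<^sup>+x. ennreal (\<bar>\<phi> x\<bar> powr p) \<partial>M"] by auto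
  then show ?thesis by (auto simp: not_integrable_integral_eq)
next
  case True
  interpret finite_measure M using M by (intro finite_measureI) simp
  have m1: "measure M (space M) = 1" using M by (simp add: measure_def)
  have int: "integrable M \<phi>" "integrable M (\<lambda>x. \<bar>\<phi> x\<bar> powr p)"
    using True meas by (auto intro!: integrableI_bounded)
  define m where "m = \<bar>\<integral>x. \<phi> x \<partial>M\<bar>"
  have m: "m \<ge> 0" "m \<le> (\<integral>x. \<bar>\<phi> x\<bar> \<partial>M)" unfolding m_def by auto
  have "m powr p \<le> m powr p + p * m powr (p - 1) * ((\<integral>x. \<bar>\<phi> x\<bar> \<partial>M) - m)"
    using m p by simp
  also have "\<dots> = (\<integral>x. m powr p + p * m powr (p - 1) * (\<bar>\<phi> x\<bar> - m) \<partial>M)"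
    using int m1 by simp
  also have "\<dots> \<le> (\<integral>x. \<bar>\<phi> x\<bar> powr p \<partial>M)"
    using int m p by (intro integral_mono powr_above_tangent) auto
  finally have "ennreal (m powr p) \<le> ennreal (\<integral>x. \<bar>\<phi> x\<bar> powr p \<partial>M)" by (rule ennreal_leI)
  also have "\<dots> = (\<integral>\<^sup>+x. ennreal (\<bar>\<phi> x\<bar> powr p) \<partial>M)"
    using int by (intro nn_integral_eq_integral[symmetric]) auto
  finally show ?thesis unfolding m_def .
qed

section \<open>Increments of Steklov averages\<close>

lemma continuous_on_abs_powr:
  fixes E :: "'a::topological_space \<Rightarrow> real"
  assumes "continuous_on S E" "p > 0"
  shows "continuous_on S (\<lambda>x. \<bar>E x\<bar> powr p)"
  using assms by (intro continuous_on_powr' continuous_intros) auto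

lemma jensen_interval:
  fixes E :: "real \<Rightarrow> real"
  assumes p: "p \<ge> 1" and "a < b" and E: "continuous_on {a..b} E"
  shows "(integral {a..b} (\<lambda>x. \<bar>E x\<bar>)) powr p
     \<le> (b - a) powr (p - 1) * integral {a..b} (\<lambda>x. \<bar>E x\<bar> powr p)"
proof -
  have int: "(\<lambda>x. \<bar>E x\<bar>) integrable_on {a..b}" "(\<lambda>x. \<bar>E x\<bar> powr p) integrable_on {a..b}"
    using E p by (auto intro!: integrable_continuous_interval continuous_on_abs_powr continuous_intros)
  define m where "m = integral {a..b} (\<lambda>x. \<bar>E x\<bar>) / (b - a)"
  have m: "m \<ge> 0" unfolding m_def using \<open>a < b\<close> int by (auto intro!: divide_nonneg_pos integral_nonneg)
  define c where "c = p * m powr (p - 1)"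
  have "integral {a..b} (\<lambda>x. \<bar>E x\<bar>) powr p = ((b - a) * m) powr p"
    using \<open>a < b\<close> by (simp add: m_def)
  also have "\<dots> = (b - a) powr p * m powr p" using \<open>a < b\<close> m by (simp add: powr_mult)
  also have "\<dots> = (b - a) powr (p - 1) * ((b - a) * m powr p)"
    using \<open>a < b\<close> powr_add[of "b - a" "p - 1" 1] by simp
  also have "(b - a) * m powr p = integral {a..b} (\<lambda>x. (m powr p - c * m) + c * \<bar>E x\<bar>)"
    using \<open>a < b\<close> int by (subst integral_add) (auto simp: m_def field_simps intro!: integrable_on_mult_right)
  also have "\<dots> \<le> integral {a..b} (\<lambda>x. \<bar>E x\<bar> powr p)"
    using int m p powr_above_tangent[OF p abs_ge_zero m]
    by (intro integral_le integrable_add integrable_on_mult_right) (auto simp: algebra_simps c_def)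
  finally show ?thesis using \<open>a < b\<close> by (simp add: mult_left_mono)
qed

text \<open>
  If \<open>b - a \<le> \<delta>\<close>, the derivative term alone suffices, by Jensen's inequality.  Otherwise each end
  point lies in a subinterval of length \<open>\<delta>\<close>; there \<open>\<bar>F\<bar>\<close> has a minimum, bounded by the mean of
  \<open>\<bar>F\<bar> powr p\<close>, and the distance from it is a short increment.  The right-hand side is additive in the
  interval, so that it can be summed over arbitrary partitions.
\<close>

lemma increment_powr_le:
  fixes F E :: "real \<Rightarrow> real"
  assumes p: "p \<ge> 1" and "a < b" "\<delta> > 0"
    and deriv: "\<And>x. (F has_real_derivative E x) (at x)" and E: "continuous_on UNIV E"
  shows "\<bar>F b - F a\<bar> powr p
     \<le> 4 powr p * integral {a..b} (\<lambda>x. \<bar>F x\<bar> powr p / \<delta> + \<delta> powr (p - 1) * \<bar>E x\<bar> powr p)"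
proof -
  have contF: "continuous_on S F" for S
    using deriv by (meson DERIV_isCont continuous_at_imp_continuous_on)
  have contE: "continuous_on S E" for S using E continuous_on_subset by blast
  define Q where "Q = (\<lambda>x. \<bar>F x\<bar> powr p / \<delta> + \<delta> powr (p - 1) * \<bar>E x\<bar> powr p)"
  have contQ: "continuous_on S Q" for S
    unfolding Q_def using p by (intro continuous_on_abs_powr continuous_intros contF contE) (auto simp: \<open>\<delta> > 0\<close>[THEN less_imp_neq, symmetric])
  have Q0: "Q x \<ge> 0" for x unfolding Q_def using \<open>\<delta> > 0\<close> by simp
  have intQ: "Q integrable_on {c..d}" for c d using contQ by (rule integrable_continuous_interval)
  have mono: "integral {c..d} Q \<le> integral {a..b} Q" if "a \<le> c" "d \<le> b" for c d
    using that Q0 intQ by (intro integral_subset_le) auto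
  have FTC: "\<bar>F d - F c\<bar> \<le> integral {c..d} (\<lambda>x. \<bar>E x\<bar>)" if "c \<le> d" for c d
  proof -
    have "(E has_integral (F d - F c)) {c..d}"
      using that deriv by (intro fundamental_theorem_of_calculus)
        (auto simp: has_real_derivative_iff_has_vector_derivative[symmetric] intro: has_field_derivative_at_within)
    then have "F d - F c = integral {c..d} E" by (simp add: integral_unique)
    then show ?thesis using integral_norm_bound_integral[of E "{c..d}" "\<lambda>x. \<bar>E x\<bar>"] contE
      by (auto intro!: integrable_continuous_interval continuous_on_abs_powr continuous_intros)
  qed
  have short: "\<bar>F d - F c\<bar> powr p \<le> \<delta> powr (p - 1) * integral {c..d} (\<lambda>x. \<bar>E x\<bar> powr p)"
    if "c \<le> d" "d - c \<le> \<delta>" for c d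
  proof (cases "c = d")
    case False
    then have "c < d" using that by simp
    have "\<bar>F d - F c\<bar> powr p \<le> integral {c..d} (\<lambda>x. \<bar>E x\<bar>) powr p"
      using FTC[OF that(1)] p by (intro powr_mono2) auto
    also have "\<dots> \<le> (d - c) powr (p - 1) * integral {c..d} (\<lambda>x. \<bar>E x\<bar> powr p)"
      by (rule jensen_interval[OF p \<open>c < d\<close> contE])
    also have "\<dots> \<le> \<delta> powr (p - 1) * integral {c..d} (\<lambda>x. \<bar>E x\<bar> powr p)"
      using that p \<open>c < d\<close> contE
      by (intro mult_right_mono powr_mono2 integral_nonneg integrable_continuous_interval continuous_on_abs_powr continuous_intros) auto
    finally show ?thesis .
  qed simp
  have shortQ: "\<bar>F d - F c\<bar> powr p \<le> integral {c..d} Q" if "c \<le> d" "d - c \<le> \<delta>" for c d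
  proof -
    have "\<bar>F d - F c\<bar> powr p \<le> integral {c..d} (\<lambda>x. \<delta> powr (p - 1) * \<bar>E x\<bar> powr p)"
      using short[OF that] by simp
    also have "\<dots> \<le> integral {c..d} Q"
      using p contE \<open>\<delta> > 0\<close>
      by (intro integral_le[OF _ intQ] integrable_continuous_interval continuous_on_abs_powr continuous_intros) (auto simp: Q_def)
    finally show ?thesis .
  qed
  have val: "\<bar>F x\<bar> powr p \<le> 2 powr p * integral {a..b} Q"
    if "b - a > \<delta>" "a \<le> c" "c + \<delta> \<le> b" "x = c \<or> x = c + \<delta>" for c x
  proof -
    obtain u where u: "u \<in> {c..c+\<delta>}" "\<And>y. y \<in> {c..c+\<delta>} \<Longrightarrow> \<bar>F u\<bar> \<le> \<bar>F y\<bar>"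
      using continuous_attains_inf[of "{c..c+\<delta>}" "\<lambda>y. \<bar>F y\<bar>"]
        continuous_on_rabs[OF contF[of "{c..c+\<delta>}"]] \<open>\<delta> > 0\<close> by auto
    have "\<bar>F u\<bar> powr p = integral {c..c+\<delta>} (\<lambda>_. \<bar>F u\<bar> powr p / \<delta>)" using \<open>\<delta> > 0\<close> by simp
    also have "\<dots> \<le> integral {c..c+\<delta>} (\<lambda>x. \<bar>F x\<bar> powr p / \<delta>)"
      using u p \<open>\<delta> > 0\<close> contF by (intro integral_le integrable_continuous_interval continuous_on_abs_powr continuous_intros)
        (auto intro!: divide_right_mono powr_mono2)
    finally have 1: "\<bar>F u\<bar> powr p \<le> integral {c..c+\<delta>} (\<lambda>x. \<bar>F x\<bar> powr p / \<delta>)" .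
    have 2: "\<bar>F x - F u\<bar> powr p \<le> integral {c..c+\<delta>} (\<lambda>x. \<delta> powr (p - 1) * \<bar>E x\<bar> powr p)"
    proof -
      have sub: "integral {c'..d'} (\<lambda>x. \<delta> powr (p - 1) * \<bar>E x\<bar> powr p) \<le> integral {c..c+\<delta>} (\<lambda>x. \<delta> powr (p - 1) * \<bar>E x\<bar> powr p)"
        if "c \<le> c'" "d' \<le> c + \<delta>" for c' d'
        using that p contE
        by (intro integral_subset_le integrable_continuous_interval continuous_on_abs_powr continuous_intros) auto
      show ?thesis
        using that(4)
      proof
        assume "x = c"
        then show ?thesis using short[of x u] sub[of x u] u(1) by (auto simp: abs_minus_commute)
      next
        assume "x = c + \<delta>"
        then show ?thesis using short[of u x] sub[of u x] u(1) by auto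
      qed
    qed
    have "\<bar>F x\<bar> powr p \<le> 2 powr (p - 1) * (\<bar>F u\<bar> powr p + \<bar>F x - F u\<bar> powr p)"
      using powr_add_le[OF p, of "F u" "F x - F u"] by simp
    also have "\<dots> \<le> 2 powr p * (integral {c..c+\<delta>} (\<lambda>x. \<bar>F x\<bar> powr p / \<delta>) + integral {c..c+\<delta>} (\<lambda>x. \<delta> powr (p - 1) * \<bar>E x\<bar> powr p))"
      using 1 2 by (intro mult_mono add_mono powr_mono) auto
    also have "\<dots> = 2 powr p * integral {c..c+\<delta>} Q"
      unfolding Q_def using p contE contF \<open>\<delta> > 0\<close>
      by (subst integral_add) (auto intro!: integrable_continuous_interval continuous_on_abs_powr continuous_intros)
    also have "\<dots> \<le> 2 powr p * integral {a..b} Q"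
      using mono[of c "c + \<delta>"] that by (intro mult_left_mono) auto
    finally show ?thesis .
  qed
  have "\<bar>F b - F a\<bar> powr p \<le> 4 powr p * integral {a..b} Q"
  proof (cases "b - a \<le> \<delta>")
    case True
    have "1 \<le> (4::real) powr p" using p by (simp add: ge_one_powr_ge_zero)
    have "\<bar>F b - F a\<bar> powr p \<le> 1 * integral {a..b} Q"
      using shortQ[of a b] True \<open>a < b\<close> by simp
    also have "\<dots> \<le> 4 powr p * integral {a..b} Q"
      using intQ Q0 by (intro mult_right_mono integral_nonneg \<open>1 \<le> 4 powr p\<close>) auto
    finally show ?thesis .
  next
    case False
    have "\<bar>F b - F a\<bar> powr p \<le> 2 powr (p - 1) * (\<bar>F b\<bar> powr p + \<bar>F a\<bar> powr p)"
      using powr_add_le[OF p, of "F b" "- F a"] by simp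
    also have "\<dots> \<le> 2 powr (p - 1) * (2 powr p * integral {a..b} Q + 2 powr p * integral {a..b} Q)"
      using val[of "b - \<delta>" b] val[of a a] False \<open>\<delta> > 0\<close>
      by (intro mult_left_mono add_mono) auto
    also have "\<dots> = (2 powr p * 2 powr p) * integral {a..b} Q"
      by (simp add: powr_diff)
    also have "(2::real) powr p * 2 powr p = 4 powr p"
      by (simp flip: powr_mult)
    finally show ?thesis .
  qed
  then show ?thesis unfolding Q_def .
qed

text \<open>
  The average over \<open>[x, x + h]\<close>, rescaled to a fixed domain of integration so that continuity in
  parameters is immediate.
\<close>

definition steklov :: "real \<Rightarrow> (real \<Rightarrow> real) \<Rightarrow> real \<Rightarrow> real" where
  "steklov h \<psi> x = integral {0..1} (\<lambda>s. \<psi> (x + h * s))"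

text \<open>
  Up to the factor \<open>1 / h\<close>, the average is an increment of an antiderivative of \<open>\<psi>\<close>.  Such an
  antiderivative is taken on a bounded neighbourhood of \<open>[x, x + h]\<close>.
\<close>

lemma steklov_has_derivative:
  fixes \<psi> :: "real \<Rightarrow> real"
  assumes h: "h > 0" and cont: "continuous_on UNIV \<psi>"
  shows "(steklov h \<psi> has_real_derivative (\<psi> (x + h) - \<psi> x) / h) (at x)"
proof -
  obtain g where g: "\<And>u. u \<in> {x-1..x+h+1} \<Longrightarrow> (g has_vector_derivative \<psi> u) (at u within {x-1..x+h+1})"
    using antiderivative_continuous[of "x-1" "x+h+1" \<psi>] continuous_on_subset[OF cont] by blast
  have g': "(g has_real_derivative \<psi> u) (at u)" if "u \<in> {x-1<..<x+h+1}" for u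
    using g[of u] that
    by (simp add: has_real_derivative_iff_has_vector_derivative at_within_Icc_at)
  have eq: "steklov h \<psi> y = (g (y + h) - g y) / h" if y: "y \<in> {x-1<..<x+1}" for y
  proof -
    have "((\<lambda>s. \<psi> (y + h * s)) has_integral (g (y + h * 1) / h - g (y + h * 0) / h)) {0..1}"
    proof (rule fundamental_theorem_of_calculus)
      fix s :: real assume s: "s \<in> {0..1}"
      have "0 \<le> h * s" "h * s \<le> h" using s h by auto
      then have "y + h * s \<in> {x-1<..<x+h+1}"
        using y by auto
      from g'[OF this] have "((\<lambda>s. g (y + h * s) / h) has_real_derivative \<psi> (y + h * s)) (at s)"
        using h by (auto intro!: derivative_eq_intros DERIV_chain2[where f=g])
      then show "((\<lambda>s. g (y + h * s) / h) has_vector_derivative \<psi> (y + h * s)) (at s within {0..1})"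
        by (simp add: has_real_derivative_iff_has_vector_derivative has_vector_derivative_at_within)
    qed simp
    then show ?thesis unfolding steklov_def by (simp add: integral_unique diff_divide_distrib)
  qed
  have "((\<lambda>y. (g (y + h) - g y) / h) has_real_derivative (\<psi> (x + h) - \<psi> x) / h) (at x)"
    using h g'[of x] g'[of "x + h"]
    by (auto intro!: derivative_eq_intros DERIV_chain2[where f=g])
  then show ?thesis
    by (rule has_field_derivative_transform_within_open[where S="{x-1<..<x+1}"]) (auto simp: eq)
qed

lemma nn_integral_Icc_continuous:
  fixes Q :: "real \<Rightarrow> real"
  assumes "continuous_on {a..b} Q" "\<And>x. x \<in> {a..b} \<Longrightarrow> Q x \<ge> 0"
  shows "(\<integral>\<^sup>+x\<in>{a..b}. ennreal (Q x) \<partial>lborel) = ennreal (integral {a..b} Q)"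
  using assms
  by (intro nn_integral_has_integral_lebesgue' integrable_integral integrable_continuous_interval) auto

text \<open>
  The measure \<open>\<mu>\<close> in the inequality \<open>\<bar>increment of S\<^sub>h\<^sub>' \<psi> - S\<^sub>h \<psi> over [a, b]\<bar> powr p
  \<le> \<integral>\<^sub>a\<^sup>b \<integral> \<bar>\<psi>(x + \<tau>) - \<psi> x\<bar> powr p d\<mu>(\<tau>) dx\<close> below.  It has four parts, indexed by \<open>j\<close>.  The parts
  \<open>j = 0, 1\<close> are uniform on \<open>[0, h']\<close> and \<open>[0, h]\<close> and come from the values of \<open>S\<^sub>h\<^sub>' \<psi> - \<psi>\<close> and
  \<open>S\<^sub>h \<psi> - \<psi>\<close>; the parts \<open>j = 2, 3\<close> are point masses at \<open>h'\<close> and \<open>h\<close> and come from the derivatives.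
  Packing them into one measure lets the inequality be iterated in the two variables.
\<close>

definition steklov_measure :: "real \<Rightarrow> real \<Rightarrow> real \<Rightarrow> real \<Rightarrow> real measure" where
  "steklov_measure p \<delta> h' h =
     distr (density (count_space {..<4::nat} \<Otimes>\<^sub>M restrict_space lborel {0..1::real})
              (\<lambda>(j, s). ennreal (8 powr p * (if j < 2 then 1 / \<delta> else \<delta> powr (p - 1) / (if j = 2 then h' else h) powr p))))
       borel (\<lambda>(j, s). (if even j then h' else h) * (if j < 2 then s else 1))"

lemma sets_steklov_measure [measurable_cong, simp]: "sets (steklov_measure p \<delta> h' h) = sets borel"
  by (simp add: steklov_measure_def)

lemma nn_integral_steklov_measure:
  assumes [measurable]: "q \<in> borel_measurable borel"
  shows "(\<integral>\<^sup>+\<tau>. q \<tau> \<partial>steklov_measure p \<delta> h' h) =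
      ennreal (8 powr p / \<delta>) * (\<integral>\<^sup>+s\<in>{0..1}. q (h' * s) \<partial>lborel)
    + ennreal (8 powr p / \<delta>) * (\<integral>\<^sup>+s\<in>{0..1}. q (h * s) \<partial>lborel)
    + ennreal (8 powr p * \<delta> powr (p - 1) / h' powr p) * q h'
    + ennreal (8 powr p * \<delta> powr (p - 1) / h powr p) * q h"
proof -
  interpret R: sigma_finite_measure "restrict_space lborel {0..1::real}"
    by (intro sigma_finite_measure_restrict_space sigma_finite_lborel) auto
  let ?N = "count_space {..<4::nat} \<Otimes>\<^sub>M restrict_space lborel {0..1::real}"
  let ?c = "\<lambda>j. ennreal (8 powr p * (if j < (2::nat) then 1 / \<delta> else \<delta> powr (p - 1) / (if j = 2 then h' else h) powr p))"
  let ?g = "\<lambda>j s. (if even (j::nat) then h' else h) * (if j < 2 then s else 1)"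
  have [measurable]: "(\<lambda>(j, s). ?c j) \<in> borel_measurable ?N"
    by measurable
  have [measurable]: "(\<lambda>(j, s). ?g j s) \<in> borel_measurable ?N"
    by (rule measurable_pair_measure_countable1) (auto simp: measurable_restrict_space1)
  have "(\<integral>\<^sup>+\<tau>. q \<tau> \<partial>steklov_measure p \<delta> h' h) = (\<integral>\<^sup>+z. (case z of (j, s) \<Rightarrow> ?c j) * q (case z of (j, s) \<Rightarrow> ?g j s) \<partial>?N)"
    unfolding steklov_measure_def by (subst nn_integral_distr) (auto simp: nn_integral_density)
  also have "\<dots> = (\<integral>\<^sup>+j. (\<integral>\<^sup>+s. ?c j * q (?g j s) \<partial>restrict_space lborel {0..1}) \<partial>count_space {..<4})"
    by (subst R.nn_integral_fst[symmetric]) (auto simp: split_beta' cong: if_cong)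
  also have "\<dots> = (\<Sum>j<4. ?c j * (\<integral>\<^sup>+s. q (?g j s) \<partial>restrict_space lborel {0..1}))"
    by (subst nn_integral_count_space_finite) (auto intro!: sum.cong nn_integral_cmult)
  also have "\<dots> = (\<Sum>j<4. ?c j * (\<integral>\<^sup>+s\<in>{0..1}. q (?g j s) \<partial>lborel))"
    by (subst nn_integral_restrict_space) auto
  also have "\<dots> = ennreal (8 powr p / \<delta>) * (\<integral>\<^sup>+s\<in>{0..1}. q (h' * s) \<partial>lborel)
    + ennreal (8 powr p / \<delta>) * (\<integral>\<^sup>+s\<in>{0..1}. q (h * s) \<partial>lborel)
    + ennreal (8 powr p * \<delta> powr (p - 1) / h' powr p) * q h'
    + ennreal (8 powr p * \<delta> powr (p - 1) / h powr p) * q h"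
  proof -
    have "{..<4} = {0, 1, 2, 3::nat}" by auto
    then show ?thesis by (simp add: add.assoc nn_integral_cmult_indicator)
  qed
  finally show ?thesis .
qed

lemma finite_measure_steklov_measure:
  "finite_measure (steklov_measure p \<delta> h' h)"
proof (rule finite_measureI)
  have "emeasure (steklov_measure p \<delta> h' h) (space (steklov_measure p \<delta> h' h))
      = (\<integral>\<^sup>+\<tau>. 1 \<partial>steklov_measure p \<delta> h' h)" by simp
  also have "\<dots> < \<infinity>"
    by (subst nn_integral_steklov_measure) (auto simp: ennreal_mult_less_top simp flip: ennreal_plus)
  finally show "emeasure (steklov_measure p \<delta> h' h) (space (steklov_measure p \<delta> h' h)) \<noteq> \<infinity>" by simp
qed

lemma steklov_minus_self_powr_le:
  assumes p: "p > 1" and cont: "continuous_on UNIV \<psi>"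
  shows "ennreal (\<bar>steklov h \<psi> x - \<psi> x\<bar> powr p) \<le> (\<integral>\<^sup>+s\<in>{0..1}. ennreal (\<bar>\<psi> (x + h * s) - \<psi> x\<bar> powr p) \<partial>lborel)"
proof -
  have c: "continuous_on S (\<lambda>s. \<psi> (x + h * s))" for S
    by (intro continuous_on_compose2[OF cont] continuous_intros) auto
  have "steklov h \<psi> x - \<psi> x = integral {0..1} (\<lambda>s. \<psi> (x + h * s) - \<psi> x)"
    unfolding steklov_def by (subst integral_diff) (auto intro!: integrable_continuous_interval c)
  moreover have "(\<lambda>s. \<psi> (x + h * s) - \<psi> x) integrable_on {0..1}"
    "(\<lambda>s. \<bar>\<psi> (x + h * s) - \<psi> x\<bar>) integrable_on {0..1}"
    by (intro integrable_continuous_interval continuous_intros c)+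
  ultimately have "\<bar>steklov h \<psi> x - \<psi> x\<bar> \<le> integral {0..1} (\<lambda>s. \<bar>\<psi> (x + h * s) - \<psi> x\<bar>)"
    using integral_norm_bound_integral[of "\<lambda>s. \<psi> (x + h * s) - \<psi> x" "{0..1}" "\<lambda>s. \<bar>\<psi> (x + h * s) - \<psi> x\<bar>"]
    by simp
  then have "\<bar>steklov h \<psi> x - \<psi> x\<bar> powr p \<le> (integral {0..1} (\<lambda>s. \<bar>\<psi> (x + h * s) - \<psi> x\<bar>)) powr p"
    using p by (intro powr_mono2) auto
  also have "\<dots> \<le> integral {0..1} (\<lambda>s. \<bar>\<psi> (x + h * s) - \<psi> x\<bar> powr p)"
  proof -
    have "continuous_on {0..1} (\<lambda>s. \<psi> (x + h * s) - \<psi> x)" by (intro continuous_intros c)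
    then show ?thesis using jensen_interval[of p 0 1 "\<lambda>s. \<psi> (x + h * s) - \<psi> x"] p by simp
  qed
  finally show ?thesis
    using p by (subst nn_integral_Icc_continuous) (auto intro!: ennreal_leI continuous_on_abs_powr continuous_intros c)
qed

text \<open>
  \<open>increment_powr_le\<close> for \<open>F = S\<^sub>h\<^sub>' \<psi> - S\<^sub>h \<psi>\<close>, where both \<open>F\<close> and \<open>F'\<close> are written through differences
  of \<open>\<psi>\<close>.
\<close>

lemma steklov_increment_le:
  fixes \<psi> :: "real \<Rightarrow> real"
  assumes p: "p > 1" and h: "0 < h'" "0 < h" "0 < \<delta>" and cont: "continuous_on UNIV \<psi>" and "a < b"
  shows "ennreal (\<bar>(steklov h' \<psi> b - steklov h \<psi> b) - (steklov h' \<psi> a - steklov h \<psi> a)\<bar> powr p)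
     \<le> (\<integral>\<^sup>+x\<in>{a..b}. (\<integral>\<^sup>+\<tau>. ennreal (\<bar>\<psi> (x + \<tau>) - \<psi> x\<bar> powr p) \<partial>steklov_measure p \<delta> h' h) \<partial>lborel)"
proof -
  define F where "F = (\<lambda>x. steklov h' \<psi> x - steklov h \<psi> x)"
  define E where "E = (\<lambda>x. (\<psi> (x + h') - \<psi> x) / h' - (\<psi> (x + h) - \<psi> x) / h)"
  have c: "continuous_on S (\<lambda>s. \<psi> (s + u))" for S u
    by (intro continuous_on_compose2[OF cont] continuous_intros) auto
  have c0: "continuous_on S \<psi>" for S
    using cont continuous_on_subset by blast
  have [measurable]: "\<psi> \<in> borel_measurable borel" using cont by (rule borel_measurable_continuous_onI)
  have deriv: "(F has_real_derivative E x) (at x)" for x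
    unfolding F_def E_def using h cont
    by (intro derivative_intros steklov_has_derivative)
  have contF: "continuous_on S F" for S
    using deriv by (meson DERIV_isCont continuous_at_imp_continuous_on)
  have contE: "continuous_on S E" for S
    unfolding E_def using h by (intro continuous_intros c c0) auto
  define Q where "Q = (\<lambda>x. \<bar>F x\<bar> powr p / \<delta> + \<delta> powr (p - 1) * \<bar>E x\<bar> powr p)"
  have contQ: "continuous_on S Q" for S
    unfolding Q_def using p h by (intro continuous_intros continuous_on_abs_powr contF contE) auto
  have Q0: "Q x \<ge> 0" for x unfolding Q_def using h by simp
  have "\<bar>F b - F a\<bar> powr p \<le> 4 powr p * integral {a..b} Q"
    unfolding Q_def using p h contE \<open>a < b\<close> by (intro increment_powr_le deriv) auto
  then have "ennreal (\<bar>F b - F a\<bar> powr p) \<le> ennreal (4 powr p) * (\<integral>\<^sup>+x\<in>{a..b}. ennreal (Q x) \<partial>lborel)"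
    using Q0 by (subst nn_integral_Icc_continuous[OF contQ]) (auto simp: ennreal_leI simp flip: ennreal_mult')
  also have "\<dots> = (\<integral>\<^sup>+x\<in>{a..b}. ennreal (4 powr p * Q x) \<partial>lborel)"
  proof -
    have [measurable]: "Q \<in> borel_measurable borel" by (rule borel_measurable_continuous_onI[OF contQ])
    show ?thesis by (subst nn_integral_cmult[symmetric]) (auto simp: ennreal_mult'' Q0 mult.assoc)
  qed
  also have "\<dots> \<le> (\<integral>\<^sup>+x\<in>{a..b}. (\<integral>\<^sup>+\<tau>. ennreal (\<bar>\<psi> (x + \<tau>) - \<psi> x\<bar> powr p) \<partial>steklov_measure p \<delta> h' h) \<partial>lborel)"
  proof (intro nn_integral_mono mult_right_mono)
    fix x :: real
    have two: "(2::real) powr (p - 1) \<le> 2 powr p" by simp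
    have "\<bar>F x\<bar> powr p \<le> 2 powr (p - 1) * (\<bar>steklov h' \<psi> x - \<psi> x\<bar> powr p + \<bar>steklov h \<psi> x - \<psi> x\<bar> powr p)"
      using powr_add_le[of p "steklov h' \<psi> x - \<psi> x" "\<psi> x - steklov h \<psi> x"] p
      by (simp add: F_def abs_minus_commute[of "\<psi> x"])
    also have "\<dots> \<le> 2 powr p * (\<bar>steklov h' \<psi> x - \<psi> x\<bar> powr p + \<bar>steklov h \<psi> x - \<psi> x\<bar> powr p)"
      by (intro mult_right_mono two) auto
    finally have 1: "\<bar>F x\<bar> powr p \<le> 2 powr p * (\<bar>steklov h' \<psi> x - \<psi> x\<bar> powr p + \<bar>steklov h \<psi> x - \<psi> x\<bar> powr p)" .
    have "\<bar>E x\<bar> powr p \<le> 2 powr (p - 1) * (\<bar>(\<psi> (x + h') - \<psi> x) / h'\<bar> powr p + \<bar>- ((\<psi> (x + h) - \<psi> x) / h)\<bar> powr p)"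
      using powr_add_le[of p "(\<psi> (x + h') - \<psi> x) / h'" "- ((\<psi> (x + h) - \<psi> x) / h)"] p
      by (simp add: E_def)
    also have "\<dots> \<le> 2 powr p * (\<bar>(\<psi> (x + h') - \<psi> x) / h'\<bar> powr p + \<bar>- ((\<psi> (x + h) - \<psi> x) / h)\<bar> powr p)"
      by (intro mult_right_mono two) auto
    also have "\<dots> = 2 powr p * (\<bar>\<psi> (x + h') - \<psi> x\<bar> powr p / h' powr p + \<bar>\<psi> (x + h) - \<psi> x\<bar> powr p / h powr p)"
      using h by (simp add: abs_divide powr_divide)
    finally have 2: "\<bar>E x\<bar> powr p \<le> 2 powr p * (\<bar>\<psi> (x + h') - \<psi> x\<bar> powr p / h' powr p + \<bar>\<psi> (x + h) - \<psi> x\<bar> powr p / h powr p)" .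
    have 8: "(8::real) powr p = 4 powr p * 2 powr p" by (simp flip: powr_mult)
    have "4 powr p * Q x \<le> 4 powr p * ((2 powr p * (\<bar>steklov h' \<psi> x - \<psi> x\<bar> powr p + \<bar>steklov h \<psi> x - \<psi> x\<bar> powr p)) / \<delta>
        + \<delta> powr (p - 1) * (2 powr p * (\<bar>\<psi> (x + h') - \<psi> x\<bar> powr p / h' powr p + \<bar>\<psi> (x + h) - \<psi> x\<bar> powr p / h powr p)))"
      unfolding Q_def using h by (intro mult_left_mono add_mono divide_right_mono 1 2) auto
    also have "\<dots> = 8 powr p / \<delta> * \<bar>steklov h' \<psi> x - \<psi> x\<bar> powr p + 8 powr p / \<delta> * \<bar>steklov h \<psi> x - \<psi> x\<bar> powr p
       + 8 powr p * \<delta> powr (p - 1) / h' powr p * \<bar>\<psi> (x + h') - \<psi> x\<bar> powr p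
       + 8 powr p * \<delta> powr (p - 1) / h powr p * \<bar>\<psi> (x + h) - \<psi> x\<bar> powr p"
      unfolding 8 by (simp add: algebra_simps add_divide_distrib)
    finally have "ennreal (4 powr p * Q x) \<le>
        ennreal (8 powr p / \<delta>) * ennreal (\<bar>steklov h' \<psi> x - \<psi> x\<bar> powr p) + ennreal (8 powr p / \<delta>) * ennreal (\<bar>steklov h \<psi> x - \<psi> x\<bar> powr p)
       + ennreal (8 powr p * \<delta> powr (p - 1) / h' powr p) * ennreal (\<bar>\<psi> (x + h') - \<psi> x\<bar> powr p)
       + ennreal (8 powr p * \<delta> powr (p - 1) / h powr p) * ennreal (\<bar>\<psi> (x + h) - \<psi> x\<bar> powr p)"
      using h by (simp add: ennreal_leI flip: ennreal_mult'' ennreal_plus)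
    also have "\<dots> \<le> (\<integral>\<^sup>+\<tau>. ennreal (\<bar>\<psi> (x + \<tau>) - \<psi> x\<bar> powr p) \<partial>steklov_measure p \<delta> h' h)"
      by (subst nn_integral_steklov_measure)
        (auto intro!: add_mono mult_left_mono steklov_minus_self_powr_le p cont)
    finally show "ennreal (4 powr p * Q x) \<le> (\<integral>\<^sup>+\<tau>. ennreal (\<bar>\<psi> (x + \<tau>) - \<psi> x\<bar> powr p) \<partial>steklov_measure p \<delta> h' h)" .
  qed auto
  finally show ?thesis unfolding F_def .
qed

text \<open>
  The parameter \<open>\<delta>\<close> can be chosen so that only an absolute constant is lost, although \<open>h / h'\<close> is not
  bounded uniformly in \<open>p\<close>.  For \<open>p \<ge> 2\<close> one takes \<open>\<delta> = h'\<close>, bounds \<open>w\<close> by \<open>w h\<close> everywhere and uses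
  \<open>(h / h') powr (1 / p) = 2\<close>.  For \<open>p < 2\<close> one takes \<open>\<delta> = h\<close>, passes from \<open>w h\<close> to \<open>w h'\<close> by the doubling
  property and uses \<open>(h / h') powr ((p - 1) / p) = 2\<close>.  So the bound refers to the larger scale in the first
  case and to the smaller one in the second.
\<close>

lemma nn_integral_steklov_measure_le:
  fixes w :: "real \<Rightarrow> real"
  assumes p: "p > 1" and h: "h > 0" and r: "r = (if p \<ge> 2 then p else p / (p - 1))"
    and h': "h' = h / 2 powr r" and \<delta>: "\<delta> = (if p \<ge> 2 then h' else h)" and hs: "hs = (if p \<ge> 2 then h else h')"
    and q [measurable]: "q \<in> borel_measurable borel"
    and w0: "\<And>t. 0 \<le> t \<Longrightarrow> t \<le> h \<Longrightarrow> w t \<ge> 0"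
    and mono: "\<And>s t. 0 \<le> s \<Longrightarrow> s \<le> t \<Longrightarrow> t \<le> h \<Longrightarrow> w s \<le> w t"
    and doubling: "w h \<le> 2 * h / h' * w h'"
    and le: "\<And>t. 0 \<le> t \<Longrightarrow> t \<le> h \<Longrightarrow> q t \<le> ennreal (w t powr p)"
  shows "(\<integral>\<^sup>+\<tau>. q \<tau> \<partial>steklov_measure p \<delta> h' h) \<le> ennreal ((128 * (hs powr (- 1 / p) * w hs)) powr p)"
proof -
  have r0: "r > 0" using p r by auto
  have h'0: "0 < h'" "h' \<le> h" "0 < hs" "0 < \<delta>"
  proof -
    have "1 \<le> (2::real) powr r" using r0 by (simp add: ge_one_powr_ge_zero)
    then show "0 < h'" "h' \<le> h" using h by (auto simp: h' divide_le_eq)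
    then show "0 < hs" "0 < \<delta>" using h hs \<delta> by auto
  qed
  define T where "T = 8 powr p * 4 powr p / hs * w hs powr p"
  have wpos: "0 \<le> w h" "0 \<le> w h'" "w h' \<le> w h" "0 \<le> w hs"
    using w0[of h] w0[of h'] mono[of h' h] h'0 h hs by auto
  have T0: "T \<ge> 0" unfolding T_def using h'0 by simp
  have bounds: "8 powr p / \<delta> * w h powr p \<le> T \<and> 8 powr p * \<delta> powr (p - 1) / h' powr p * w h' powr p \<le> T
      \<and> 8 powr p * \<delta> powr (p - 1) / h powr p * w h powr p \<le> T"
  proof (cases "p \<ge> 2")
    case True
    then have eqs: "\<delta> = h'" "hs = h" "h = 2 powr p * h'" using \<delta> hs h' r by auto
    have a: "8 powr p / h' * w h powr p \<le> T"
    proof -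
      have "8 powr p / h' * w h powr p = 8 powr p * 2 powr p / h * w h powr p"
        using h'0 by (simp add: eqs(3))
      also have "\<dots> \<le> T" unfolding T_def eqs(2) using h p
        by (intro mult_right_mono divide_right_mono mult_left_mono powr_mono2) auto
      finally show ?thesis .
    qed
    have b: "8 powr p * h' powr (p - 1) / h' powr p = 8 powr p / h'"
      using h'0 by (simp add: powr_diff)
    have "8 powr p / h' * w h' powr p \<le> 8 powr p / h' * w h powr p"
      using h'0 wpos p by (intro mult_left_mono powr_mono2) auto
    moreover have "8 powr p * h' powr (p - 1) / h powr p * w h powr p \<le> 8 powr p * h' powr (p - 1) / h' powr p * w h powr p"
      using h'0 p h by (intro mult_right_mono divide_left_mono powr_mono2) auto
    ultimately show ?thesis unfolding eqs(1) using a unfolding b by linarith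
  next
    case False
    then have eqs: "\<delta> = h" "hs = h'" "h = 2 powr (p / (p - 1)) * h'" using \<delta> hs h' r by auto
    have ratio: "(h / h') powr (p - 1) = 2 powr p"
      using h'0 p by (simp add: eqs(3) powr_powr)
    have hp: "h powr (p - 1) / h powr p = 1 / h" using h by (simp add: powr_diff)
    have "w h powr p \<le> (2 * (h / h') * w h') powr p"
      using doubling wpos p by (intro powr_mono2) auto
    also have "\<dots> = 2 powr p * (h / h') powr p * w h' powr p"
      using h h'0 wpos by (simp only: powr_mult)
    also have "(h / h') powr p = (h / h') powr (p - 1) * (h / h')"
      using h h'0 powr_add[of "h / h'" "p - 1" 1] by simp
    finally have "w h powr p \<le> 2 powr p * (2 powr p * (h / h')) * w h' powr p" unfolding ratio .
    also have "\<dots> = 4 powr p * (h / h') * w h' powr p"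
      by (simp flip: powr_mult)
    finally have "8 powr p / h * w h powr p \<le> 8 powr p / h * (4 powr p * (h / h') * w h' powr p)"
      using h by (intro mult_left_mono) auto
    also have "\<dots> = T" using h h'0 unfolding T_def eqs(2) by simp
    finally have a: "8 powr p / h * w h powr p \<le> T" .
    have "h powr (p - 1) / h' powr p = (h / h') powr (p - 1) / h'"
      using h h'0 by (simp add: powr_divide powr_diff)
    then have "8 powr p * h powr (p - 1) / h' powr p * w h' powr p = 8 powr p * 2 powr p / h' * w h' powr p"
      unfolding ratio by (metis (no_types, opaque_lifting) times_divide_eq_right mult.assoc)
    also have "\<dots> \<le> T" unfolding T_def eqs(2) using h'0 p
      by (intro mult_right_mono divide_right_mono mult_left_mono powr_mono2) auto
    finally have b: "8 powr p * h powr (p - 1) / h' powr p * w h' powr p \<le> T" .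
    have "8 powr p * h powr (p - 1) / h powr p * w h powr p = 8 powr p / h * w h powr p"
      using hp by (metis (no_types, opaque_lifting) times_divide_eq_right mult.assoc mult.right_neutral)
    then show ?thesis using a b eqs(1) by simp
  qed
  have avg: "(\<integral>\<^sup>+s\<in>{0..1}. q (k * s) \<partial>lborel) \<le> ennreal (w h powr p)" if "0 \<le> k" "k \<le> h" for k
  proof -
    have "(\<integral>\<^sup>+s\<in>{0..1}. q (k * s) \<partial>lborel) \<le> (\<integral>\<^sup>+s\<in>{0..1::real}. ennreal (w h powr p) \<partial>lborel)"
    proof (rule nn_integral_mono)
      fix s :: real
      have "q (k * s) \<le> ennreal (w h powr p)" if "s \<in> {0..1}"
      proof -
        have "k * s \<le> k * 1" using that \<open>0 \<le> k\<close> by (intro mult_left_mono) auto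
        then have ks: "0 \<le> k * s" "k * s \<le> h" using that \<open>0 \<le> k\<close> \<open>k \<le> h\<close> by auto
        have "q (k * s) \<le> ennreal (w (k * s) powr p)" using le ks by blast
        also have "\<dots> \<le> ennreal (w h powr p)"
          using mono[OF ks(1,2)] w0[OF ks] p by (intro ennreal_leI powr_mono2) auto
        finally show ?thesis .
      qed
      then show "q (k * s) * indicator {0..1} s \<le> ennreal (w h powr p) * indicator {0..1} s"
        by (auto simp: indicator_def)
    qed
    also have "\<dots> = ennreal (w h powr p)" by (simp add: nn_integral_cmult_indicator)
    finally show ?thesis .
  qed
  have "(\<integral>\<^sup>+\<tau>. q \<tau> \<partial>steklov_measure p \<delta> h' h) \<le>
      ennreal (8 powr p / \<delta>) * ennreal (w h powr p) + ennreal (8 powr p / \<delta>) * ennreal (w h powr p)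
    + ennreal (8 powr p * \<delta> powr (p - 1) / h' powr p) * ennreal (w h' powr p)
    + ennreal (8 powr p * \<delta> powr (p - 1) / h powr p) * ennreal (w h powr p)"
    unfolding nn_integral_steklov_measure[OF q] using h'0 h
    by (intro add_mono mult_left_mono avg le) auto
  also have "\<dots> = ennreal (8 powr p / \<delta> * w h powr p + 8 powr p / \<delta> * w h powr p
    + 8 powr p * \<delta> powr (p - 1) / h' powr p * w h' powr p
    + 8 powr p * \<delta> powr (p - 1) / h powr p * w h powr p)"
    using h'0 by (simp flip: ennreal_mult'' ennreal_plus)
  also have "\<dots> \<le> ennreal (4 * T)"
    using bounds by (intro ennreal_leI) linarith
  also have "\<dots> \<le> ennreal ((128 * (hs powr (- 1 / p) * w hs)) powr p)"
  proof (rule ennreal_leI)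
    have "(4::real) \<le> 4 powr p" using p powr_mono[of 1 p 4] by simp
    then have "4 * T \<le> 4 powr p * T" using T0 by (rule mult_right_mono)
    also have "\<dots> = (4 powr p * 8 powr p * 4 powr p) * (hs powr (-1) * w hs powr p)"
      using h'0 by (simp add: T_def powr_minus_divide)
    also have "(4::real) powr p * 8 powr p * 4 powr p = 128 powr p" by (simp flip: powr_mult)
    also have "hs powr (-1) = (hs powr (- 1 / p)) powr p" using p by (simp add: powr_powr)
    also have "128 powr p * ((hs powr (- 1 / p)) powr p * w hs powr p) = (128 * (hs powr (- 1 / p) * w hs)) powr p"
      using wpos by (simp add: powr_mult)
    finally show "4 * T \<le> (128 * (hs powr (- 1 / p) * w hs)) powr p" .
  qed
  finally show ?thesis .
qed

section \<open>Periodic integrals over nets\<close>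

lemma nn_integral_Icc_split:
  fixes \<phi> :: "real \<Rightarrow> ennreal"
  assumes [measurable]: "\<phi> \<in> borel_measurable borel" and "a \<le> b" "b \<le> c"
  shows "(\<integral>\<^sup>+x\<in>{a..c}. \<phi> x \<partial>lborel) = (\<integral>\<^sup>+x\<in>{a..b}. \<phi> x \<partial>lborel) + (\<integral>\<^sup>+x\<in>{b..c}. \<phi> x \<partial>lborel)"
proof -
  have "(\<integral>\<^sup>+x\<in>{a..c}. \<phi> x \<partial>lborel) = (\<integral>\<^sup>+x. \<phi> x * indicator {a..b} x + \<phi> x * indicator {b..c} x \<partial>lborel)"
  proof (rule nn_integral_cong_AE)
    show "AE x in lborel. \<phi> x * indicator {a..c} x = \<phi> x * indicator {a..b} x + \<phi> x * indicator {b..c} x"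
      using AE_lborel_singleton[of b] by eventually_elim (use assms in \<open>auto simp: indicator_def\<close>)
  qed
  then show ?thesis by (simp add: nn_integral_add)
qed

lemma nn_integral_Icc_sum:
  fixes \<phi> :: "real \<Rightarrow> ennreal"
  assumes [measurable]: "\<phi> \<in> borel_measurable borel"
  shows "(\<And>k. k < n \<Longrightarrow> x k \<le> x (Suc k)) \<Longrightarrow>
    x 0 \<le> x n \<and> (\<Sum>k<n. \<integral>\<^sup>+t\<in>{x k..x (Suc k)}. \<phi> t \<partial>lborel) = (\<integral>\<^sup>+t\<in>{x 0..x n}. \<phi> t \<partial>lborel)"
proof (induction n)
  case 0
  have "(\<integral>\<^sup>+t\<in>{x 0..x 0}. \<phi> t \<partial>lborel) = (\<integral>\<^sup>+t. 0 \<partial>(lborel :: real measure))"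
  proof (rule nn_integral_cong_AE)
    show "AE t in lborel. \<phi> t * indicator {x 0..x 0} t = 0"
      using AE_lborel_singleton[of "x 0"] by eventually_elim auto
  qed
  then show ?case by simp
next
  case (Suc n)
  then have "x 0 \<le> x n" "x n \<le> x (Suc n)" "x 0 \<le> x (Suc n)" by (auto intro: order.trans[of _ "x n"])
  then show ?case using Suc nn_integral_Icc_split[of \<phi> "x 0" "x n" "x (Suc n)"] by auto
qed

lemma nn_integral_Icc_shift:
  fixes \<phi> :: "real \<Rightarrow> ennreal"
  assumes [measurable]: "\<phi> \<in> borel_measurable borel"
  shows "(\<integral>\<^sup>+x\<in>{a..b}. \<phi> (x + c) \<partial>lborel) = (\<integral>\<^sup>+x\<in>{a + c..b + c}. \<phi> x \<partial>lborel)"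
proof -
  have "(\<integral>\<^sup>+x\<in>{a + c..b + c}. \<phi> x \<partial>lborel) = (\<integral>\<^sup>+x. \<phi> (c + 1 * x) * indicator {a + c..b + c} (c + 1 * x) \<partial>lborel)"
    by (subst nn_integral_real_affine[of _ 1 c]) auto
  also have "\<dots> = (\<integral>\<^sup>+x\<in>{a..b}. \<phi> (x + c) \<partial>lborel)"
    by (intro nn_integral_cong) (auto simp: indicator_def add.commute)
  finally show ?thesis by simp
qed

lemma periodic_add_of_int:
  assumes "\<And>x. f (x + 1) = f (x::real)"
  shows "f (x + of_int n) = f x"
proof (induction n rule: int_induct[of _ 0])
  case (step1 i)
  then show ?case using assms[of "x + of_int i"] by (simp add: add.assoc)
next
  case (step2 i)
  then show ?case using assms[of "x + of_int (i - 1)"] by (simp add: algebra_simps)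
qed simp

lemma nn_integral_period:
  fixes \<phi> :: "real \<Rightarrow> ennreal"
  assumes [measurable]: "\<phi> \<in> borel_measurable borel" and per: "\<And>x. \<phi> (x + 1) = \<phi> x"
  shows "(\<integral>\<^sup>+x\<in>{a..a + 1}. \<phi> x \<partial>lborel) = (\<integral>\<^sup>+x\<in>{0..1}. \<phi> x \<partial>lborel)"
proof -
  define n where "n = real_of_int \<lfloor>a\<rfloor>"
  have n: "n \<le> a" "a \<le> n + 1" unfolding n_def by linarith+
  have "(\<integral>\<^sup>+x\<in>{a..a + 1}. \<phi> x \<partial>lborel) = (\<integral>\<^sup>+x\<in>{a..n + 1}. \<phi> x \<partial>lborel) + (\<integral>\<^sup>+x\<in>{n + 1..a + 1}. \<phi> x \<partial>lborel)"
    using n by (intro nn_integral_Icc_split) auto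
  also have "(\<integral>\<^sup>+x\<in>{n + 1..a + 1}. \<phi> x \<partial>lborel) = (\<integral>\<^sup>+x\<in>{n..a}. \<phi> x \<partial>lborel)"
    using nn_integral_Icc_shift[where \<phi>=\<phi> and a=n and b=a and c=1] per by simp
  also have "(\<integral>\<^sup>+x\<in>{a..n + 1}. \<phi> x \<partial>lborel) + \<dots> = (\<integral>\<^sup>+x\<in>{n..n + 1}. \<phi> x \<partial>lborel)"
    using n nn_integral_Icc_split[of \<phi> n a "n + 1"] by (simp add: add.commute)
  also have "\<dots> = (\<integral>\<^sup>+x\<in>{0..1}. \<phi> x \<partial>lborel)"
    using nn_integral_Icc_shift[where \<phi>=\<phi> and a=0 and b=1 and c=n] periodic_add_of_int[of \<phi>, OF per] by (simp add: n_def add.commute)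
  finally show ?thesis .
qed

definition unit_integral :: "(real \<times> real \<Rightarrow> ennreal) \<Rightarrow> ennreal" where
  "unit_integral \<Phi> = (\<integral>\<^sup>+y\<in>{0..1}. (\<integral>\<^sup>+x\<in>{0..1}. \<Phi> (x, y) \<partial>lborel) \<partial>lborel)"

text \<open>
  Within a strip the partition of the \<open>y\<close>-period depends on the strip, but the inner sum over it always
  gives the integral over one full period, whatever the partition.
\<close>

lemma unit_integral_net:
  fixes \<Phi> :: "real \<times> real \<Rightarrow> ennreal"
  assumes [measurable]: "\<Phi> \<in> borel_measurable borel"
    and per: "\<And>x y. \<Phi> (x + 1, y) = \<Phi> (x, y)" "\<And>x y. \<Phi> (x, y + 1) = \<Phi> (x, y)"
    and x: "period_partition n x" and y: "\<And>k. k < n \<Longrightarrow> period_partition (m k) (y k)"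
  shows "(\<Sum>k<n. \<Sum>j<m k. \<integral>\<^sup>+v\<in>{y k j..y k (Suc j)}. (\<integral>\<^sup>+u\<in>{x k..x (Suc k)}. \<Phi> (u, v) \<partial>lborel) \<partial>lborel)
     = unit_integral \<Phi>"
proof -
  have [measurable]: "\<Phi> \<in> borel_measurable (borel \<Otimes>\<^sub>M borel)" by (simp add: borel_prod)
  let ?G = "\<lambda>k v. \<integral>\<^sup>+u\<in>{x k..x (Suc k)}. \<Phi> (u, v) \<partial>lborel"
  have "(\<Sum>j<m k. \<integral>\<^sup>+v\<in>{y k j..y k (Suc j)}. ?G k v \<partial>lborel) = (\<integral>\<^sup>+v\<in>{0..1}. ?G k v \<partial>lborel)"
    if "k < n" for k
  proof -
    have "(\<Sum>j<m k. \<integral>\<^sup>+v\<in>{y k j..y k (Suc j)}. ?G k v \<partial>lborel) = (\<integral>\<^sup>+v\<in>{y k 0..y k (m k)}. ?G k v \<partial>lborel)"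
      using nn_integral_Icc_sum[of "?G k" "m k" "y k"] y[OF that] by (auto simp: period_partition_def less_imp_le)
    also have "\<dots> = (\<integral>\<^sup>+v\<in>{0..1}. ?G k v \<partial>lborel)"
      using y[OF that] per by (simp add: period_partition_def nn_integral_period)
    finally show ?thesis .
  qed
  then have "(\<Sum>k<n. \<Sum>j<m k. \<integral>\<^sup>+v\<in>{y k j..y k (Suc j)}. ?G k v \<partial>lborel) = (\<Sum>k<n. \<integral>\<^sup>+v\<in>{0..1}. ?G k v \<partial>lborel)"
    by simp
  also have "\<dots> = (\<integral>\<^sup>+v\<in>{0..1}. (\<Sum>k<n. ?G k v) \<partial>lborel)"
    by (subst nn_integral_sum[symmetric]) (auto simp: sum_distrib_right)
  also have "(\<lambda>v. (\<Sum>k<n. ?G k v)) = (\<lambda>v. \<integral>\<^sup>+u\<in>{0..1}. \<Phi> (u, v) \<partial>lborel)"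
  proof
    fix v
    have "(\<Sum>k<n. ?G k v) = (\<integral>\<^sup>+u\<in>{x 0..x n}. \<Phi> (u, v) \<partial>lborel)"
      using nn_integral_Icc_sum[of "\<lambda>u. \<Phi> (u, v)" n x] x by (auto simp: period_partition_def less_imp_le)
    also have "\<dots> = (\<integral>\<^sup>+u\<in>{0..1}. \<Phi> (u, v) \<partial>lborel)"
      using x per by (simp add: period_partition_def nn_integral_period)
    finally show "(\<Sum>k<n. ?G k v) = (\<integral>\<^sup>+u\<in>{0..1}. \<Phi> (u, v) \<partial>lborel)" .
  qed
  finally show ?thesis unfolding unit_integral_def .
qed

section \<open>Blocks of the multiscale decomposition\<close>

definition steklov_increment :: "real \<Rightarrow> real \<Rightarrow> real \<Rightarrow> (real \<Rightarrow> real) \<Rightarrow> real" where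
  "steklov_increment h a b \<psi> = steklov h \<psi> b - steklov h \<psi> a"

lemma continuous_on_translate_scale:
  assumes "continuous_on UNIV (\<psi> :: real \<Rightarrow> real)"
  shows "continuous_on S (\<lambda>s. \<psi> (x + h * s))"
  by (intro continuous_on_compose2[OF assms] continuous_intros) auto

lemma steklov_diff:
  assumes "continuous_on UNIV \<phi>" "continuous_on UNIV \<psi>"
  shows "steklov h (\<lambda>x. \<phi> x - \<psi> x) y = steklov h \<phi> y - steklov h \<psi> y"
  unfolding steklov_def
  by (intro integral_diff integrable_continuous_interval continuous_on_translate_scale assms)

lemma steklov_sum:
  assumes "finite I" "\<And>i. i \<in> I \<Longrightarrow> continuous_on UNIV (\<psi> i)"
  shows "steklov h (\<lambda>x. \<Sum>i\<in>I. \<psi> i x) y = (\<Sum>i\<in>I. steklov h (\<psi> i) y)"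
  unfolding steklov_def
  by (intro integral_sum integrable_continuous_interval continuous_on_translate_scale assms)

lemma continuous_on_section:
  assumes "continuous_on UNIV (f :: real \<times> real \<Rightarrow> real)"
  shows "continuous_on S (\<lambda>x. f (x, y))" "continuous_on S (\<lambda>y. f (x, y))"
  by (intro continuous_on_compose2[OF assms] continuous_intros; simp)+

lemma continuous_on_steklov_section:
  assumes "continuous_on UNIV (f :: real \<times> real \<Rightarrow> real)"
  shows "continuous_on UNIV (\<lambda>y. steklov h (\<lambda>x. f (x, y)) a)"
proof -
  have "continuous_on (UNIV \<times> cbox 0 1) (\<lambda>(y, s). f (a + h * s, y))"
    unfolding split_beta' by (intro continuous_on_compose2[OF assms] continuous_intros) auto
  from integral_continuous_on_param[OF this] show ?thesis by (simp add: steklov_def)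
qed

lemma continuous_on_steklov_increment_section:
  assumes "continuous_on UNIV (f :: real \<times> real \<Rightarrow> real)"
  shows "continuous_on UNIV (\<lambda>y. steklov_increment h a b (\<lambda>x. f (x, y)))"
  unfolding steklov_increment_def
  by (intro continuous_intros continuous_on_steklov_section assms)

text \<open>
  The one-dimensional inequality is applied in \<open>y\<close> to the function \<open>D\<close>, whose \<open>y\<close>-differences are
  \<open>x\<close>-increments of blocks of \<open>y\<close>-differences of \<open>f\<close>; then it is applied in \<open>x\<close>.
\<close>

lemma cell_increment_le:
  fixes f :: "real \<times> real \<Rightarrow> real"
  assumes p: "p > 1" and pos: "0 < h'" "0 < h" "0 < \<delta>" "0 < k'" "0 < k" "0 < \<epsilon>"
    and cont: "continuous_on UNIV f" and "a < b" "c < d"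
  defines "D \<equiv> \<lambda>y. steklov_increment h' a b (\<lambda>x. f (x, y)) - steklov_increment h a b (\<lambda>x. f (x, y))"
  shows "ennreal (\<bar>steklov_increment k' c d D - steklov_increment k c d D\<bar> powr p)
    \<le> (\<integral>\<^sup>+v\<in>{c..d}. (\<integral>\<^sup>+u\<in>{a..b}. (\<integral>\<^sup>+\<tau>. (\<integral>\<^sup>+\<sigma>. ennreal (\<bar>diff2 \<sigma> \<tau> f (u, v)\<bar> powr p)
        \<partial>steklov_measure p \<delta> h' h) \<partial>steklov_measure p \<epsilon> k' k) \<partial>lborel) \<partial>lborel)"
proof -
  let ?M = "steklov_measure p \<delta> h' h" and ?N = "steklov_measure p \<epsilon> k' k"
  interpret M: finite_measure ?M by (rule finite_measure_steklov_measure)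
  interpret N: finite_measure ?N by (rule finite_measure_steklov_measure)
  interpret P: pair_sigma_finite lborel ?N
    by (intro pair_sigma_finite.intro sigma_finite_lborel N.sigma_finite_measure_axioms)
  have [measurable]: "f \<in> borel_measurable (borel \<Otimes>\<^sub>M borel)"
    using cont by (simp add: borel_prod borel_measurable_continuous_onI)
  have contD: "continuous_on UNIV D"
    unfolding D_def by (intro continuous_intros continuous_on_steklov_increment_section cont)
  have step: "ennreal (\<bar>D (v + \<tau>) - D v\<bar> powr p)
      \<le> (\<integral>\<^sup>+u\<in>{a..b}. (\<integral>\<^sup>+\<sigma>. ennreal (\<bar>diff2 \<sigma> \<tau> f (u, v)\<bar> powr p) \<partial>?M) \<partial>lborel)" for v \<tau>
  proof -
    let ?\<psi> = "\<lambda>x. f (x, v + \<tau>) - f (x, v)"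
    have c: "continuous_on UNIV ?\<psi>" by (intro continuous_intros continuous_on_section cont)
    have "D (v + \<tau>) - D v = (steklov h' ?\<psi> b - steklov h ?\<psi> b) - (steklov h' ?\<psi> a - steklov h ?\<psi> a)"
      unfolding D_def steklov_increment_def
      by (simp add: steklov_diff continuous_on_section cont)
    then have "ennreal (\<bar>D (v + \<tau>) - D v\<bar> powr p) \<le> (\<integral>\<^sup>+x\<in>{a..b}. (\<integral>\<^sup>+\<tau>. ennreal (\<bar>?\<psi> (x + \<tau>) - ?\<psi> x\<bar> powr p) \<partial>?M) \<partial>lborel)"
      using steklov_increment_le[OF p pos(1-3) c \<open>a < b\<close>] by simp
    also have "\<dots> = (\<integral>\<^sup>+u\<in>{a..b}. (\<integral>\<^sup>+\<sigma>. ennreal (\<bar>diff2 \<sigma> \<tau> f (u, v)\<bar> powr p) \<partial>?M) \<partial>lborel)"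
      by (simp add: diff2_def algebra_simps)
    finally show ?thesis .
  qed
  have "ennreal (\<bar>steklov_increment k' c d D - steklov_increment k c d D\<bar> powr p)
    = ennreal (\<bar>(steklov k' D d - steklov k D d) - (steklov k' D c - steklov k D c)\<bar> powr p)"
    by (simp add: steklov_increment_def algebra_simps)
  also have "\<dots> \<le> (\<integral>\<^sup>+v\<in>{c..d}. (\<integral>\<^sup>+\<tau>. ennreal (\<bar>D (v + \<tau>) - D v\<bar> powr p) \<partial>?N) \<partial>lborel)"
    by (rule steklov_increment_le[OF p pos(4-6) contD \<open>c < d\<close>])
  also have "\<dots> \<le> (\<integral>\<^sup>+v\<in>{c..d}. (\<integral>\<^sup>+\<tau>. (\<integral>\<^sup>+u\<in>{a..b}. (\<integral>\<^sup>+\<sigma>. ennreal (\<bar>diff2 \<sigma> \<tau> f (u, v)\<bar> powr p) \<partial>?M) \<partial>lborel) \<partial>?N) \<partial>lborel)"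
    by (intro nn_integral_mono mult_right_mono step) auto
  also have "\<dots> = (\<integral>\<^sup>+v\<in>{c..d}. (\<integral>\<^sup>+u\<in>{a..b}. (\<integral>\<^sup>+\<tau>. (\<integral>\<^sup>+\<sigma>. ennreal (\<bar>diff2 \<sigma> \<tau> f (u, v)\<bar> powr p) \<partial>?M) \<partial>?N) \<partial>lborel) \<partial>lborel)"
  proof (intro nn_integral_cong arg_cong2[where f="(*)"] refl)
    fix v
    have "(\<integral>\<^sup>+\<tau>. (\<integral>\<^sup>+u\<in>{a..b}. (\<integral>\<^sup>+\<sigma>. ennreal (\<bar>diff2 \<sigma> \<tau> f (u, v)\<bar> powr p) \<partial>?M) \<partial>lborel) \<partial>?N)
      = (\<integral>\<^sup>+u. (\<integral>\<^sup>+\<tau>. (\<integral>\<^sup>+\<sigma>. ennreal (\<bar>diff2 \<sigma> \<tau> f (u, v)\<bar> powr p) \<partial>?M) * indicator {a..b} u \<partial>?N) \<partial>lborel)"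
      unfolding diff2_def by (intro P.Fubini') (simp, measurable)
    also have "\<dots> = (\<integral>\<^sup>+u\<in>{a..b}. (\<integral>\<^sup>+\<tau>. (\<integral>\<^sup>+\<sigma>. ennreal (\<bar>diff2 \<sigma> \<tau> f (u, v)\<bar> powr p) \<partial>?M) \<partial>?N) \<partial>lborel)"
      unfolding diff2_def by (intro nn_integral_cong nn_integral_multc) (simp, measurable)
    finally show "(\<integral>\<^sup>+\<tau>. (\<integral>\<^sup>+u\<in>{a..b}. (\<integral>\<^sup>+\<sigma>. ennreal (\<bar>diff2 \<sigma> \<tau> f (u, v)\<bar> powr p) \<partial>?M) \<partial>lborel) \<partial>?N)
      = (\<integral>\<^sup>+u\<in>{a..b}. (\<integral>\<^sup>+\<tau>. (\<integral>\<^sup>+\<sigma>. ennreal (\<bar>diff2 \<sigma> \<tau> f (u, v)\<bar> powr p) \<partial>?M) \<partial>?N) \<partial>lborel)" .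
  qed
  finally show ?thesis .
qed

lemma unit_integral_swap_measure:
  fixes q :: "real \<times> real \<Rightarrow> real \<Rightarrow> ennreal"
  assumes "sigma_finite_measure N" and [measurable_cong]: "sets N = sets borel"
   and q: "(\<lambda>(z, \<tau>). q z \<tau>) \<in> borel_measurable (borel \<Otimes>\<^sub>M borel)"
  shows "unit_integral (\<lambda>z. \<integral>\<^sup>+\<tau>. q z \<tau> \<partial>N) = (\<integral>\<^sup>+\<tau>. unit_integral (\<lambda>z. q z \<tau>) \<partial>N)"
proof -
  interpret N: sigma_finite_measure N by fact
  interpret P: pair_sigma_finite lborel N
    by (intro pair_sigma_finite.intro sigma_finite_lborel assms)
  have [measurable]: "(\<lambda>((x, y), \<tau>). q (x, y) \<tau>) \<in> borel_measurable ((borel \<Otimes>\<^sub>M borel) \<Otimes>\<^sub>M borel)"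
    using q by (simp add: borel_prod split_beta')
  have qm: "(\<lambda>z. q (fst z, y) (snd z)) \<in> borel_measurable (lborel \<Otimes>\<^sub>M N)" for y
  proof -
    have "(\<lambda>z. ((fst z, y), snd z)) \<in> lborel \<Otimes>\<^sub>M N \<rightarrow>\<^sub>M borel \<Otimes>\<^sub>M borel"
      by (subst borel_prod[symmetric]) measurable
    from measurable_compose[OF this q] show ?thesis by simp
  qed
  have [measurable]: "(\<lambda>z. q (snd z, y) (fst z)) \<in> borel_measurable (borel \<Otimes>\<^sub>M borel)" for y
  proof -
    have "(\<lambda>z::real \<times> real. ((snd z, y), fst z)) \<in> borel \<Otimes>\<^sub>M borel \<rightarrow>\<^sub>M borel \<Otimes>\<^sub>M borel"
      by (subst borel_prod[symmetric]) measurable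
    from measurable_compose[OF this q] show ?thesis by simp
  qed
  have [measurable]: "(\<lambda>z. q (snd z, fst (fst z)) (snd (fst z))) \<in> borel_measurable ((borel \<Otimes>\<^sub>M borel) \<Otimes>\<^sub>M borel)"
  proof -
    have "(\<lambda>z::(real \<times> real) \<times> real. ((snd z, fst (fst z)), snd (fst z))) \<in> (borel \<Otimes>\<^sub>M borel) \<Otimes>\<^sub>M borel \<rightarrow>\<^sub>M borel \<Otimes>\<^sub>M borel"
      by (subst borel_prod[symmetric]) measurable
    from measurable_compose[OF this q] show ?thesis by simp
  qed
  have [measurable]: "q z \<in> borel_measurable borel" for z
    using measurable_compose[OF _ q, of "\<lambda>\<tau>. (z, \<tau>)"] by simp
  have "unit_integral (\<lambda>z. \<integral>\<^sup>+\<tau>. q z \<tau> \<partial>N)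
     = (\<integral>\<^sup>+y\<in>{0..1}. (\<integral>\<^sup>+\<tau>. (\<integral>\<^sup>+x\<in>{0..1}. q (x, y) \<tau> \<partial>lborel) \<partial>N) \<partial>lborel)"
    unfolding unit_integral_def
  proof (intro nn_integral_cong arg_cong2[where f="(*)"] refl)
    fix y :: real
    have "(\<integral>\<^sup>+x\<in>{0..1}. (\<integral>\<^sup>+\<tau>. q (x, y) \<tau> \<partial>N) \<partial>lborel) = (\<integral>\<^sup>+x. (\<integral>\<^sup>+\<tau>. q (x, y) \<tau> * indicator {0..1} x \<partial>N) \<partial>lborel)"
      by (intro nn_integral_cong nn_integral_multc[symmetric]) measurable
    also have "\<dots> = (\<integral>\<^sup>+\<tau>. (\<integral>\<^sup>+x\<in>{0..1}. q (x, y) \<tau> \<partial>lborel) \<partial>N)"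
      by (intro P.Fubini'[symmetric])
        (use qm[of y] in \<open>auto simp: split_beta' intro!: borel_measurable_times_ennreal borel_measurable_indicator'\<close>)
    finally show "(\<integral>\<^sup>+x\<in>{0..1}. (\<integral>\<^sup>+\<tau>. q (x, y) \<tau> \<partial>N) \<partial>lborel) = (\<integral>\<^sup>+\<tau>. (\<integral>\<^sup>+x\<in>{0..1}. q (x, y) \<tau> \<partial>lborel) \<partial>N)" .
  qed
  also have "\<dots> = (\<integral>\<^sup>+y. (\<integral>\<^sup>+\<tau>. (\<integral>\<^sup>+x\<in>{0..1}. q (x, y) \<tau> \<partial>lborel) * indicator {0..1} y \<partial>N) \<partial>lborel)"
    by (intro nn_integral_cong nn_integral_multc[symmetric]) measurable
  also have "\<dots> = (\<integral>\<^sup>+\<tau>. unit_integral (\<lambda>z. q z \<tau>) \<partial>N)"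
    unfolding unit_integral_def by (intro P.Fubini'[symmetric]) measurable
  finally show ?thesis .
qed

text \<open>
  The scales \<open>2 powr (- r * m)\<close> decrease so fast that consecutive ones differ by a factor for which
  \<open>h powr (- 1 / p)\<close> (if \<open>p \<ge> 2\<close>) or \<open>h powr ((p - 1) / p)\<close> (if \<open>p < 2\<close>) changes by the factor \<open>2\<close>.
\<close>

definition scale_rate :: "real \<Rightarrow> real" where
  "scale_rate p = (if p \<ge> 2 then p else p / (p - 1))"

definition block_scale :: "real \<Rightarrow> nat \<Rightarrow> real" where
  "block_scale p m = 1 / 2 powr (scale_rate p * m)"

lemma scale_rate_ge_1: "p > 1 \<Longrightarrow> scale_rate p \<ge> 1"
  by (auto simp: scale_rate_def field_simps)

lemma block_scale_pos: "block_scale p m > 0"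
  by (simp add: block_scale_def)

lemma block_scale_0: "block_scale p 0 = 1"
  by (simp add: block_scale_def)

lemma block_scale_Suc: "block_scale p (Suc m) = block_scale p m / 2 powr scale_rate p"
  by (simp add: block_scale_def powr_add[symmetric] algebra_simps)

lemma block_scale_le: "p > 1 \<Longrightarrow> block_scale p m \<le> (1 / 2) ^ m"
proof -
  assume "p > 1"
  then have "(2::real) powr real m \<le> 2 powr (scale_rate p * m)"
    using mult_right_mono[OF scale_rate_ge_1, of p "real m"] by (intro powr_mono) auto
  then show ?thesis by (simp add: block_scale_def powr_realpow power_one_over divide_left_mono)
qed

lemma block_scale_le_1: "p > 1 \<Longrightarrow> block_scale p m \<le> 1"
  using block_scale_le[of p m] power_le_one[of "1/2::real" m] by simp

lemma block_scale_antimono: "p > 1 \<Longrightarrow> m \<le> n \<Longrightarrow> block_scale p n \<le> block_scale p m"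
proof -
  assume "p > 1" "m \<le> n"
  then have "(2::real) powr (scale_rate p * m) \<le> 2 powr (scale_rate p * n)"
    using scale_rate_ge_1[of p] by (intro powr_mono mult_left_mono) auto
  then show ?thesis by (simp add: block_scale_def divide_left_mono)
qed

lemma block_scale_tendsto_0: "p > 1 \<Longrightarrow> block_scale p \<longlonglongrightarrow> 0"
  by (rule tendsto_sandwich[of "\<lambda>_. 0" _ _ "\<lambda>m. (1/2) ^ m"])
    (auto intro!: always_eventually block_scale_le LIMSEQ_power_zero simp: block_scale_pos less_imp_le)

text \<open>
  The properties of \<open>\<omega>(f; u, v)\<^sub>p\<close> that the estimates use, on the unit square: nonnegative, increasing,
  and \<open>w(s') \<le> 2 (s' / s) w(s)\<close> for \<open>s \<le> s'\<close> in each variable.  The class is also closed under minima with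
  constants, which the uniform convergence argument needs.
\<close>

definition quasi_modulus :: "(real \<Rightarrow> real \<Rightarrow> real) \<Rightarrow> bool" where
  "quasi_modulus w \<longleftrightarrow>
     (\<forall>s\<in>{0..1}. \<forall>t\<in>{0..1}. 0 \<le> w s t) \<and>
     (\<forall>s\<in>{0..1}. \<forall>t\<in>{0..1}. \<forall>s'\<in>{s..1}. \<forall>t'\<in>{t..1}. w s t \<le> w s' t') \<and>
     (\<forall>s\<in>{0<..1}. \<forall>t\<in>{0..1}. \<forall>s'\<in>{s..1}. w s' t \<le> 2 * s' / s * w s t) \<and>
     (\<forall>s\<in>{0..1}. \<forall>t\<in>{0<..1}. \<forall>t'\<in>{t..1}. w s t' \<le> 2 * t' / t * w s t)"

abbreviation scaled_term :: "real \<Rightarrow> (real \<Rightarrow> real \<Rightarrow> real) \<Rightarrow> nat \<Rightarrow> nat \<Rightarrow> real" where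
  "scaled_term p w m n \<equiv> block_scale p m powr (- 1 / p) * block_scale p n powr (- 1 / p) * w (block_scale p m) (block_scale p n)"

definition scaled_sum :: "real \<Rightarrow> (real \<Rightarrow> real \<Rightarrow> real) \<Rightarrow> nat \<Rightarrow> real" where
  "scaled_sum p w N = (\<Sum>m<N. \<Sum>n<N. scaled_term p w m n)"

definition block_increment :: "real \<Rightarrow> nat \<Rightarrow> real \<Rightarrow> real \<Rightarrow> (real \<Rightarrow> real) \<Rightarrow> real" where
  "block_increment p m a b \<psi> = steklov_increment (block_scale p (Suc m)) a b \<psi> - steklov_increment (block_scale p m) a b \<psi>"

abbreviation cell_block :: "real \<Rightarrow> nat \<Rightarrow> nat \<Rightarrow> (real \<times> real \<Rightarrow> real) \<Rightarrow> real \<Rightarrow> real \<Rightarrow> real \<Rightarrow> real \<Rightarrow> real" where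
  "cell_block p m i f a b c d \<equiv> block_increment p i c d (\<lambda>v. block_increment p m a b (\<lambda>u. f (u, v)))"

abbreviation block_measure :: "real \<Rightarrow> nat \<Rightarrow> real measure" where
  "block_measure p m \<equiv> steklov_measure p (if p \<ge> 2 then block_scale p (Suc m) else block_scale p m) (block_scale p (Suc m)) (block_scale p m)"

text \<open>
  By \<open>nn_integral_steklov_measure_le\<close>, the block between the scales \<open>m\<close> and \<open>m + 1\<close> is bounded through the
  scale \<open>m\<close> if \<open>p \<ge> 2\<close> and through the scale \<open>m + 1\<close> if \<open>p < 2\<close>.
\<close>

definition scale_offset :: "real \<Rightarrow> nat" where "scale_offset p = (if p \<ge> 2 then 0 else 1)"

lemma nn_integral_block_measure_le:
  assumes p: "p > 1" and q: "q \<in> borel_measurable borel"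
    and w0: "\<And>t. 0 \<le> t \<Longrightarrow> t \<le> 1 \<Longrightarrow> w t \<ge> 0"
    and mono: "\<And>s t. 0 \<le> s \<Longrightarrow> s \<le> t \<Longrightarrow> t \<le> 1 \<Longrightarrow> w s \<le> w t"
    and doubling: "\<And>s t. 0 < s \<Longrightarrow> s \<le> t \<Longrightarrow> t \<le> 1 \<Longrightarrow> w t \<le> 2 * t / s * w s"
    and le: "\<And>t. 0 \<le> t \<Longrightarrow> t \<le> 1 \<Longrightarrow> q t \<le> ennreal (w t powr p)"
  shows "(\<integral>\<^sup>+\<tau>. q \<tau> \<partial>block_measure p m)
     \<le> ennreal ((128 * (block_scale p (m + scale_offset p) powr (- 1 / p) * w (block_scale p (m + scale_offset p)))) powr p)"
proof (rule nn_integral_steklov_measure_le[where r = "scale_rate p"])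
  have "block_scale p m \<le> 1" using block_scale_le_1[OF p] .
  then show "0 \<le> w t" "q t \<le> ennreal (w t powr p)" if "0 \<le> t" "t \<le> block_scale p m" for t
    using w0 le that by auto
  show "w s \<le> w t" if "0 \<le> s" "s \<le> t" "t \<le> block_scale p m" for s t
    using mono that \<open>block_scale p m \<le> 1\<close> by auto
  show "w (block_scale p m) \<le> 2 * block_scale p m / block_scale p (Suc m) * w (block_scale p (Suc m))"
    using doubling[OF block_scale_pos block_scale_antimono[OF p] block_scale_le_1[OF p], of m "Suc m"] by simp
qed (use p q block_scale_pos block_scale_Suc in \<open>auto simp: scale_rate_def scale_offset_def\<close>)

text \<open>
  Both applications of \<open>nn_integral_block_measure_le\<close> contribute a factor \<open>128\<close>, and
  \<open>128 * 128 = 16384\<close>.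
\<close>

lemma block_net_le:
  fixes f :: "real \<times> real \<Rightarrow> real"
  assumes p: "p > 1" and cont: "continuous_on UNIV f" and per: "periodic2 f" and w: "quasi_modulus w"
    and le: "\<And>s t. s \<in> {0..1} \<Longrightarrow> t \<in> {0..1} \<Longrightarrow>
        unit_integral (\<lambda>z. ennreal (\<bar>diff2 s t f z\<bar> powr p)) \<le> ennreal (w s t powr p)"
    and x: "period_partition n x" and y: "\<And>k. k < n \<Longrightarrow> period_partition (l k) (y k)"
  shows "(\<Sum>k<n. \<Sum>j<l k. \<bar>cell_block p m i f (x k) (x (Suc k)) (y k j) (y k (Suc j))\<bar> powr p)
     \<le> (16384 * (scaled_term p w (m + scale_offset p) (i + scale_offset p))) powr p"
proof -
  define M where "M = block_measure p m"
  define N where "N = block_measure p i"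
  interpret M: finite_measure M unfolding M_def by (rule finite_measure_steklov_measure)
  interpret N: finite_measure N unfolding N_def by (rule finite_measure_steklov_measure)
  have [measurable_cong]: "sets M = sets borel" "sets N = sets borel" by (simp_all add: M_def N_def)
  have [measurable]: "f \<in> borel_measurable (borel \<Otimes>\<^sub>M borel)" "f \<in> borel_measurable borel"
    using cont by (simp_all add: borel_prod borel_measurable_continuous_onI)
  define \<Phi> where "\<Phi> = (\<lambda>z. \<integral>\<^sup>+\<tau>. (\<integral>\<^sup>+\<sigma>. ennreal (\<bar>diff2 \<sigma> \<tau> f z\<bar> powr p) \<partial>M) \<partial>N)"
  have d2: "diff2 \<sigma> \<tau> f z = f (fst z + \<sigma>, snd z + \<tau>) - f (fst z + \<sigma>, snd z) - f (fst z, snd z + \<tau>) + f z" for \<sigma> \<tau> z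
    by (simp add: diff2_def split_beta')
  have "(\<lambda>(z, \<tau>). \<integral>\<^sup>+\<sigma>. ennreal (\<bar>diff2 \<sigma> \<tau> f z\<bar> powr p) \<partial>M) \<in> borel_measurable ((borel \<Otimes>\<^sub>M borel) \<Otimes>\<^sub>M borel)"
    unfolding d2 split_beta' by measurable
  then have inner: "(\<lambda>(z, \<tau>). \<integral>\<^sup>+\<sigma>. ennreal (\<bar>diff2 \<sigma> \<tau> f z\<bar> powr p) \<partial>M) \<in> borel_measurable (borel \<Otimes>\<^sub>M borel)"
    by (simp only: borel_prod)
  have "(\<lambda>(z, \<sigma>). ennreal (\<bar>diff2 \<sigma> \<tau> f z\<bar> powr p)) \<in> borel_measurable ((borel \<Otimes>\<^sub>M borel) \<Otimes>\<^sub>M borel)" for \<tau>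
    unfolding d2 split_beta' by measurable
  then have innermost: "(\<lambda>(z, \<sigma>). ennreal (\<bar>diff2 \<sigma> \<tau> f z\<bar> powr p)) \<in> borel_measurable (borel \<Otimes>\<^sub>M borel)" for \<tau>
    by (simp only: borel_prod)
  have perz: "diff2 \<sigma> \<tau> f (u + 1, v) = diff2 \<sigma> \<tau> f (u, v)" "diff2 \<sigma> \<tau> f (u, v + 1) = diff2 \<sigma> \<tau> f (u, v)" for \<sigma> \<tau> u v
  proof -
    have a: "f (u + 1, v) = f (u, v)" "f (u, v + 1) = f (u, v)" for u v
      using per by (auto simp: periodic2_def periodic1_def)
    have b: "f (u + 1 + \<sigma>, v) = f (u + \<sigma>, v)" "f (u, v + 1 + \<tau>) = f (u, v + \<tau>)" for u v
      using a[of "u + \<sigma>" v] a[of u "v + \<tau>"] by (simp_all add: algebra_simps)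
    show "diff2 \<sigma> \<tau> f (u + 1, v) = diff2 \<sigma> \<tau> f (u, v)" "diff2 \<sigma> \<tau> f (u, v + 1) = diff2 \<sigma> \<tau> f (u, v)"
      by (simp_all add: diff2_def a b)
  qed
  have "\<Phi> \<in> borel_measurable (borel \<Otimes>\<^sub>M borel)"
    unfolding \<Phi>_def d2 by measurable
  then have "\<Phi> \<in> borel_measurable borel" by (simp add: borel_prod)
  have "(\<Sum>k<n. \<Sum>j<l k. ennreal (\<bar>cell_block p m i f (x k) (x (Suc k)) (y k j) (y k (Suc j))\<bar> powr p))
     \<le> (\<Sum>k<n. \<Sum>j<l k. \<integral>\<^sup>+v\<in>{y k j..y k (Suc j)}. (\<integral>\<^sup>+u\<in>{x k..x (Suc k)}. \<Phi> (u, v) \<partial>lborel) \<partial>lborel)"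
  proof (intro sum_mono)
    fix k j assume kj: "k \<in> {..<n}" "j \<in> {..<l k}"
    have less: "x k < x (Suc k)" "y k j < y k (Suc j)"
      using x y[of k] kj by (auto simp: period_partition_def)
    show "ennreal (\<bar>cell_block p m i f (x k) (x (Suc k)) (y k j) (y k (Suc j))\<bar> powr p)
        \<le> (\<integral>\<^sup>+v\<in>{y k j..y k (Suc j)}. (\<integral>\<^sup>+u\<in>{x k..x (Suc k)}. \<Phi> (u, v) \<partial>lborel) \<partial>lborel)"
      unfolding block_increment_def \<Phi>_def M_def N_def
      by (rule cell_increment_le[OF p _ _ _ _ _ _ cont less]) (simp_all add: block_scale_pos)
  qed
  also have "\<dots> = unit_integral \<Phi>"
    by (rule unit_integral_net[OF \<open>\<Phi> \<in> borel_measurable borel\<close> _ _ x y]) (simp_all add: \<Phi>_def perz)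
  also have "\<dots> = (\<integral>\<^sup>+\<tau>. unit_integral (\<lambda>z. \<integral>\<^sup>+\<sigma>. ennreal (\<bar>diff2 \<sigma> \<tau> f z\<bar> powr p) \<partial>M) \<partial>N)"
    unfolding \<Phi>_def
    by (rule unit_integral_swap_measure[OF N.sigma_finite_measure_axioms \<open>sets N = sets borel\<close> inner])
  also have "\<dots> \<le> ennreal ((128 * (block_scale p (i + scale_offset p) powr (- 1 / p) *
      (128 * (block_scale p (m + scale_offset p) powr (- 1 / p) * w (block_scale p (m + scale_offset p)) (block_scale p (i + scale_offset p)))))) powr p)"
  proof (unfold N_def, rule nn_integral_block_measure_le[OF p])
    have s: "block_scale p (m + scale_offset p) \<in> {0<..1}" using block_scale_pos block_scale_le_1[OF p] by auto
    show "(\<lambda>\<tau>. unit_integral (\<lambda>z. \<integral>\<^sup>+\<sigma>. ennreal (\<bar>diff2 \<sigma> \<tau> f z\<bar> powr p) \<partial>M)) \<in> borel_measurable borel"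
      unfolding unit_integral_def diff2_def by measurable
    fix t :: real
    assume t: "0 \<le> t" "t \<le> 1"
    show "0 \<le> 128 * (block_scale p (m + scale_offset p) powr (- 1 / p) * w (block_scale p (m + scale_offset p)) t)"
      using w t s unfolding quasi_modulus_def by auto
    have "unit_integral (\<lambda>z. \<integral>\<^sup>+\<sigma>. ennreal (\<bar>diff2 \<sigma> t f z\<bar> powr p) \<partial>M)
       = (\<integral>\<^sup>+\<sigma>. unit_integral (\<lambda>z. ennreal (\<bar>diff2 \<sigma> t f z\<bar> powr p)) \<partial>M)"
      by (rule unit_integral_swap_measure[OF M.sigma_finite_measure_axioms \<open>sets M = sets borel\<close> innermost])
    also have "\<dots> \<le> ennreal ((128 * (block_scale p (m + scale_offset p) powr (- 1 / p) * w (block_scale p (m + scale_offset p)) t)) powr p)"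
    proof (unfold M_def, rule nn_integral_block_measure_le[OF p])
      show "(\<lambda>\<sigma>. unit_integral (\<lambda>z. ennreal (\<bar>diff2 \<sigma> t f z\<bar> powr p))) \<in> borel_measurable borel"
        unfolding unit_integral_def diff2_def by measurable
    qed (use w t le in \<open>auto simp: quasi_modulus_def\<close>)
    finally show "unit_integral (\<lambda>z. \<integral>\<^sup>+\<sigma>. ennreal (\<bar>diff2 \<sigma> t f z\<bar> powr p) \<partial>M)
      \<le> ennreal ((128 * (block_scale p (m + scale_offset p) powr (- 1 / p) * w (block_scale p (m + scale_offset p)) t)) powr p)" .
  next
    fix s t :: real
    assume st: "0 \<le> s" "s \<le> t" "t \<le> 1"
    show "128 * (block_scale p (m + scale_offset p) powr (- 1 / p) * w (block_scale p (m + scale_offset p)) s)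
       \<le> 128 * (block_scale p (m + scale_offset p) powr (- 1 / p) * w (block_scale p (m + scale_offset p)) t)"
      using w st block_scale_pos[of p "m + scale_offset p"] block_scale_le_1[OF p, of "m + scale_offset p"]
      by (intro mult_left_mono) (auto simp: quasi_modulus_def)
  next
    fix s t :: real
    assume st: "0 < s" "s \<le> t" "t \<le> 1"
    let ?c = "128 * block_scale p (m + scale_offset p) powr (- 1 / p)" and ?h = "block_scale p (m + scale_offset p)"
    have "w ?h t \<le> 2 * t / s * w ?h s"
      using w st block_scale_pos[of p "m + scale_offset p"] block_scale_le_1[OF p, of "m + scale_offset p"]
      by (auto simp: quasi_modulus_def)
    then have "?c * w ?h t \<le> ?c * (2 * t / s * w ?h s)"
      by (intro mult_left_mono) auto
    then show "128 * (?h powr (- 1 / p) * w ?h t) \<le> 2 * t / s * (128 * (?h powr (- 1 / p) * w ?h s))"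
      by (simp add: mult_ac)
  qed
  also have "\<dots> = ennreal ((16384 * (scaled_term p w (m + scale_offset p) (i + scale_offset p))) powr p)"
    by (simp add: mult_ac)
  finally show ?thesis
    by (simp add: sum_ennreal sum_nonneg)
qed

text \<open>
  The sum telescopes down to the average over a full period, which is constant because its derivative
  is \<open>\<psi>(x + 1) - \<psi>(x) = 0\<close>.
\<close>

lemma sum_block_increment:
  assumes per: "periodic1 \<psi>" and cont: "continuous_on UNIV \<psi>"
  shows "(\<Sum>m<N. block_increment p m a b \<psi>) = steklov_increment (block_scale p N) a b \<psi>"
proof -
  have "\<forall>x. (steklov 1 \<psi> has_real_derivative 0) (at x)"
    using steklov_has_derivative[of 1 \<psi>] cont per by (simp add: periodic1_def)
  then have "steklov 1 \<psi> b = steklov 1 \<psi> a" by (rule DERIV_isconst_all)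
  then have "steklov_increment (block_scale p 0) a b \<psi> = 0"
    by (simp add: steklov_increment_def block_scale_0)
  then show ?thesis
    unfolding block_increment_def by (subst sum_lessThan_telescope) simp
qed

lemma steklov_close:
  assumes cont: "continuous_on UNIV \<psi>" and h: "h \<ge> 0"
    and close: "\<And>s. 0 \<le> s \<Longrightarrow> s \<le> h \<Longrightarrow> \<bar>\<psi> (x + s) - c\<bar> \<le> e"
  shows "\<bar>steklov h \<psi> x - c\<bar> \<le> e"
proof -
  have "(\<lambda>s. \<psi> (x + h * s)) integrable_on {0..1}"
    by (rule integrable_continuous_interval[OF continuous_on_translate_scale[OF cont]])
  from integral_diff[OF this integrable_const_ivl, of c]
  have "steklov h \<psi> x - c = integral {0..1} (\<lambda>s. \<psi> (x + h * s) - c)"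
    by (simp add: steklov_def)
  also have "norm \<dots> \<le> integral {0..1} (\<lambda>s::real. e)"
  proof (rule integral_norm_bound_integral)
    show "(\<lambda>s. \<psi> (x + h * s) - c) integrable_on {0..1}"
      by (intro integrable_continuous_interval continuous_on_diff continuous_on_const
          continuous_on_translate_scale cont)
    fix s :: real assume "s \<in> {0..1}"
    then show "norm (\<psi> (x + h * s) - c) \<le> e"
      using h close[of "h * s"] by (simp add: mult_left_le)
  qed (rule integrable_const_ivl)
  finally show ?thesis by simp
qed

lemma steklov_steklov_tendsto:
  fixes f :: "real \<times> real \<Rightarrow> real"
  assumes p: "p > 1" and cont: "continuous_on UNIV f"
  shows "(\<lambda>N. steklov (block_scale p N) (\<lambda>v. steklov (block_scale p N) (\<lambda>u. f (u, v)) x) y) \<longlonglongrightarrow> f (x, y)"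
proof (rule LIMSEQ_I)
  fix e :: real assume e: "e > 0"
  obtain d where d: "d > 0" "\<And>z. dist z (x, y) < d \<Longrightarrow> dist (f z) (f (x, y)) < e / 2"
    using cont half_gt_zero[OF e] unfolding continuous_on_iff by blast
  have "eventually (\<lambda>N. block_scale p N < d / 2) sequentially"
    using order_tendstoD(2)[OF block_scale_tendsto_0[OF p], of "d / 2"] d(1) by simp
  then obtain M where M: "\<And>N. N \<ge> M \<Longrightarrow> block_scale p N < d / 2"
    by (auto simp: eventually_sequentially)
  have "\<bar>steklov (block_scale p N) (\<lambda>v. steklov (block_scale p N) (\<lambda>u. f (u, v)) x) y - f (x, y)\<bar> \<le> e / 2" if "N \<ge> M" for N
  proof (intro steklov_close continuous_on_steklov_section continuous_on_section cont)
    fix t s assume st: "0 \<le> t" "t \<le> block_scale p N" "0 \<le> s" "s \<le> block_scale p N"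
    have "dist (x + s, y + t) (x, y) \<le> \<bar>s\<bar> + \<bar>t\<bar>"
      by (simp add: dist_Pair_Pair dist_real_def sqrt_sum_squares_le_sum_abs)
    also have "\<dots> < d" using st M[OF that] by simp
    finally show "\<bar>f (x + s, y + t) - f (x, y)\<bar> \<le> e / 2"
      using d(2)[of "(x + s, y + t)"] by (simp add: dist_real_def)
  qed (simp_all add: block_scale_pos less_imp_le)
  then show "\<exists>M. \<forall>N\<ge>M. norm (steklov (block_scale p N) (\<lambda>v. steklov (block_scale p N) (\<lambda>u. f (u, v)) x) y - f (x, y)) < e"
    using e by (intro exI[of _ M]) (force simp: real_norm_def)
qed

definition cell_diff :: "(real \<times> real \<Rightarrow> real) \<Rightarrow> real \<Rightarrow> real \<Rightarrow> real \<Rightarrow> real \<Rightarrow> real" where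
  "cell_diff f a b c d = f (b, d) - f (a, d) - f (b, c) + f (a, c)"

lemma sum_blocks_tendsto:
  fixes f :: "real \<times> real \<Rightarrow> real"
  assumes p: "p > 1" and cont: "continuous_on UNIV f" and per: "periodic2 f"
  shows "(\<lambda>N. \<Sum>(m, i)\<in>{..<N} \<times> {..<N}. cell_block p m i f a b c d)
     \<longlonglongrightarrow> cell_diff f a b c d"
proof -
  have per1: "periodic1 (\<lambda>u. f (u, v))" "periodic1 (\<lambda>v. f (u, v))" for u v
    using per by (auto simp: periodic2_def)
  have pf: "f (u, v + 1) = f (u, v)" for u v using per1 by (auto simp: periodic1_def)
  have contB: "continuous_on UNIV (\<lambda>v. block_increment p m a b (\<lambda>u. f (u, v)))" for m
    unfolding block_increment_def by (intro continuous_intros continuous_on_steklov_increment_section cont)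
  have eq: "(\<Sum>(m, i)\<in>{..<N} \<times> {..<N}. cell_block p m i f a b c d)
     = (steklov (block_scale p N) (\<lambda>v. steklov (block_scale p N) (\<lambda>u. f (u, v)) b) d
      - steklov (block_scale p N) (\<lambda>v. steklov (block_scale p N) (\<lambda>u. f (u, v)) a) d)
      - (steklov (block_scale p N) (\<lambda>v. steklov (block_scale p N) (\<lambda>u. f (u, v)) b) c
      - steklov (block_scale p N) (\<lambda>v. steklov (block_scale p N) (\<lambda>u. f (u, v)) a) c)" for N
  proof -
    have "(\<Sum>(m, i)\<in>{..<N} \<times> {..<N}. cell_block p m i f a b c d)
      = (\<Sum>m<N. \<Sum>i<N. cell_block p m i f a b c d)"
      by (simp add: sum.cartesian_product)
    also have "\<dots> = (\<Sum>m<N. steklov_increment (block_scale p N) c d (\<lambda>v. block_increment p m a b (\<lambda>u. f (u, v))))"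
      by (intro sum.cong refl sum_block_increment contB) (auto simp: periodic1_def pf)
    also have "\<dots> = steklov_increment (block_scale p N) c d (\<lambda>v. \<Sum>m<N. block_increment p m a b (\<lambda>u. f (u, v)))"
      unfolding steklov_increment_def by (simp add: steklov_sum contB sum_subtractf)
    also have "\<dots> = steklov_increment (block_scale p N) c d (\<lambda>v. steklov_increment (block_scale p N) a b (\<lambda>u. f (u, v)))"
      by (simp add: sum_block_increment per1 continuous_on_section cont)
    also have "\<dots> = (steklov (block_scale p N) (\<lambda>v. steklov (block_scale p N) (\<lambda>u. f (u, v)) b) d
      - steklov (block_scale p N) (\<lambda>v. steklov (block_scale p N) (\<lambda>u. f (u, v)) a) d)
      - (steklov (block_scale p N) (\<lambda>v. steklov (block_scale p N) (\<lambda>u. f (u, v)) b) c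
      - steklov (block_scale p N) (\<lambda>v. steklov (block_scale p N) (\<lambda>u. f (u, v)) a) c)"
      unfolding steklov_increment_def by (simp add: steklov_diff continuous_on_steklov_section cont)
    finally show ?thesis .
  qed
  have "cell_diff f a b c d = (f (b, d) - f (a, d)) - (f (b, c) - f (a, c))"
    by (simp add: cell_diff_def)
  then show ?thesis unfolding eq
    by (simp only:) (intro tendsto_diff steklov_steklov_tendsto p cont)
qed

text \<open>
  The partition \<open>y k\<close> of the second variable may depend on the strip \<open>k\<close>; this freedom is what makes the
  quantity control the variation of the variations of the rows.
\<close>

definition net_variation_le :: "real \<Rightarrow> (real \<times> real \<Rightarrow> real) \<Rightarrow> real \<Rightarrow> bool" where
  "net_variation_le p f B \<longleftrightarrow> (\<forall>n x l y. period_partition n x \<longrightarrow> (\<forall>k<n. period_partition (l k) (y k)) \<longrightarrow>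
     (\<Sum>k<n. \<Sum>j<l k. \<bar>cell_diff f (x k) (x (Suc k)) (y k j) (y k (Suc j))\<bar> powr p) \<le> B powr p)"

lemma scaled_sum_shift_le:
  assumes p: "p > 1" and w: "quasi_modulus w"
  shows "(\<Sum>(m, i)\<in>{..<N} \<times> {..<N}. scaled_term p w (m + scale_offset p) (i + scale_offset p)) \<le> scaled_sum p w (Suc N)"
proof -
  let ?g = "\<lambda>(m, i). scaled_term p w m i"
  have inj: "inj_on (\<lambda>(m, i). (m + scale_offset p, i + scale_offset p)) A" for A
    by (auto simp: inj_on_def)
  have "(\<Sum>(m, i)\<in>{..<N} \<times> {..<N}. scaled_term p w (m + scale_offset p) (i + scale_offset p))
    = sum ?g ((\<lambda>(m, i). (m + scale_offset p, i + scale_offset p)) ` ({..<N} \<times> {..<N}))"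
    by (subst sum.reindex[OF inj]) (simp add: o_def split_beta')
  also have "\<dots> \<le> sum ?g ({..<Suc N} \<times> {..<Suc N})"
    using w block_scale_pos block_scale_le_1[OF p]
    by (intro sum_mono2) (auto simp: scale_offset_def quasi_modulus_def less_imp_le intro!: mult_nonneg_nonneg)
  also have "\<dots> = scaled_sum p w (Suc N)"
    unfolding scaled_sum_def by (rule sum.cartesian_product[symmetric])
  finally show ?thesis .
qed

text \<open>
  Minkowski's inequality over the blocks, for each finite stage of the decomposition, followed by the
  passage to the limit in each cell.
\<close>

lemma net_variation_le_scaled_sum:
  fixes f :: "real \<times> real \<Rightarrow> real"
  assumes p: "p > 1" and cont: "continuous_on UNIV f" and per: "periodic2 f" and w: "quasi_modulus w"
    and le: "\<And>s t. s \<in> {0..1} \<Longrightarrow> t \<in> {0..1} \<Longrightarrow>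
        unit_integral (\<lambda>z. ennreal (\<bar>diff2 s t f z\<bar> powr p)) \<le> ennreal (w s t powr p)"
    and B: "\<And>N. scaled_sum p w N \<le> B"
  shows "net_variation_le p f (16384 * B)"
  unfolding net_variation_le_def
proof (intro allI impI)
  fix n :: nat and x :: "nat \<Rightarrow> real" and l y
  assume x: "period_partition n x" and y: "\<forall>k<n. period_partition (l k) (y k)"
  let ?I = "Sigma {..<n} (\<lambda>k. {..<l k})"
  let ?D = "\<lambda>(k, j) (m, i). cell_block p m i f (x k) (x (Suc k)) (y k j) (y k (Suc j))"
  let ?B = "\<lambda>(m, i). 16384 * (scaled_term p w (m + scale_offset p) (i + scale_offset p))"
  let ?R = "\<lambda>(k, j). cell_diff f (x k) (x (Suc k)) (y k j) (y k (Suc j))"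
  have B0: "?B mi \<ge> 0" for mi
    using w block_scale_pos[of p] block_scale_le_1[OF p] by (cases mi) (auto simp: quasi_modulus_def less_imp_le)
  have part: "(\<Sum>kj\<in>?I. \<bar>\<Sum>mi\<in>{..<N} \<times> {..<N}. ?D kj mi\<bar> powr p) \<le> (16384 * B) powr p" for N
  proof -
    have "(\<Sum>kj\<in>?I. \<bar>\<Sum>mi\<in>{..<N} \<times> {..<N}. ?D kj mi\<bar> powr p) \<le> (\<Sum>mi\<in>{..<N} \<times> {..<N}. ?B mi) powr p"
    proof (rule minkowski_dominated)
      fix mi :: "nat \<times> nat"
      obtain m i where mi: "mi = (m, i)" by (cases mi)
      show "(\<Sum>kj\<in>?I. \<bar>?D kj mi\<bar> powr p) \<le> ?B mi powr p"
        using block_net_le[OF p cont per w le x, of l y i m] y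
        by (simp add: mi sum.Sigma split_beta')
    qed (use p B0 in auto)
    also have "\<dots> \<le> (16384 * B) powr p"
    proof (intro powr_mono2 sum_nonneg)
      have "(\<Sum>mi\<in>{..<N} \<times> {..<N}. ?B mi) = 16384 * (\<Sum>(m, i)\<in>{..<N} \<times> {..<N}.
          scaled_term p w (m + scale_offset p) (i + scale_offset p))"
        by (simp only: sum_distrib_left split_beta')
      then show "(\<Sum>mi\<in>{..<N} \<times> {..<N}. ?B mi) \<le> 16384 * B"
        using scaled_sum_shift_le[OF p w, of N] B[of "Suc N"] by linarith
    qed (use p B0 in auto)
    finally show ?thesis .
  qed
  have "(\<lambda>N. \<Sum>kj\<in>?I. \<bar>\<Sum>mi\<in>{..<N} \<times> {..<N}. ?D kj mi\<bar> powr p) \<longlonglongrightarrow> (\<Sum>kj\<in>?I. \<bar>?R kj\<bar> powr p)"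
  proof (intro tendsto_sum)
    fix kj :: "nat \<times> nat"
    obtain k j where kj: "kj = (k, j)" by (cases kj)
    have "(\<lambda>N. \<bar>\<Sum>mi\<in>{..<N} \<times> {..<N}. ?D kj mi\<bar>) \<longlonglongrightarrow> \<bar>?R kj\<bar>"
      unfolding kj using sum_blocks_tendsto[OF p cont per, of "y k j" "y k (Suc j)" "x k" "x (Suc k)"]
      by (intro tendsto_rabs) (simp add: split_beta')
    then show "(\<lambda>N. \<bar>\<Sum>mi\<in>{..<N} \<times> {..<N}. ?D kj mi\<bar> powr p) \<longlonglongrightarrow> \<bar>?R kj\<bar> powr p"
      using p by (intro tendsto_powr') auto
  qed
  then have "(\<Sum>kj\<in>?I. \<bar>?R kj\<bar> powr p) \<le> (16384 * B) powr p"
    by (rule LIMSEQ_le_const2) (use part in auto)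
  then show "(\<Sum>k<n. \<Sum>j<l k. \<bar>cell_diff f (x k) (x (Suc k)) (y k j) (y k (Suc j))\<bar> powr p) \<le> (16384 * B) powr p"
    by (simp add: sum.Sigma split_beta')
qed

section \<open>From sums over scales to integrals\<close>

lemma nn_integral_Ioc_eq_Icc:
  fixes \<phi> :: "real \<Rightarrow> ennreal"
  shows "(\<integral>\<^sup>+t\<in>{a<..b}. \<phi> t \<partial>lborel) = (\<integral>\<^sup>+t\<in>{a..b}. \<phi> t \<partial>lborel)"
proof (rule nn_integral_cong_AE)
  show "AE t in lborel. \<phi> t * indicator {a<..b} t = \<phi> t * indicator {a..b} t"
    using AE_lborel_singleton[of a] by eventually_elim (auto simp: indicator_def)
qed

lemma nn_integral_powr_Ioc:
  fixes a b r :: real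
  assumes "0 < a" "a \<le> b" "r \<noteq> 0" "c \<ge> 0"
  shows "(\<integral>\<^sup>+t\<in>{a<..b}. ennreal (c * t powr (r - 1)) \<partial>lborel) = ennreal (c * ((b powr r - a powr r) / r))"
proof -
  have "(\<integral>\<^sup>+t. ennreal (c * t powr (r - 1)) * indicator {a..b} t \<partial>lborel) = ennreal (c * (b powr r / r) - c * (a powr r / r))"
  proof (rule nn_integral_FTC_Icc)
    show "DERIV (\<lambda>t. c * (t powr r / r)) t :> c * t powr (r - 1)" if "t \<in> {a..b}" for t
      using that assms by (auto intro!: derivative_eq_intros)
  qed (use assms in auto)
  then show ?thesis unfolding nn_integral_Ioc_eq_Icc by (simp add: right_diff_distrib diff_divide_distrib)
qed

text \<open>
  Each term is absorbed by the integral over one of the disjoint intervals \<open>E m\<close>.  For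
  \<open>p \<ge> 2\<close> this is the interval above the scale, where \<open>w\<close> is at least its value at the scale and
  \<open>t powr (- 1 / p - 1)\<close> integrates to about \<open>p\<close> times \<open>h powr (- 1 / p)\<close>.  For \<open>p < 2\<close> it is the interval below
  the scale, where \<open>w(t) \<ge> w(h) t / (2 h)\<close> and \<open>t powr (- 1 / p)\<close> integrates to about \<open>p'\<close> times
  \<open>h powr ((p - 1) / p)\<close>.  On \<open>E m\<close> the integrand is bounded from below by a constant times the explicit
  kernel \<open>\<kappa> m\<close>, so that additivity is applied to Borel functions only.
  The constant \<open>(p - 1) / p\<^sup>2\<close> is \<open>1 / (p * p')\<close>.
\<close>

lemma sum_scaled_le_integral:
  fixes w :: "real \<Rightarrow> ennreal"
  assumes p: "p > 1"
    and mono: "\<And>s t. 0 < s \<Longrightarrow> s \<le> t \<Longrightarrow> t \<le> 1 \<Longrightarrow> w s \<le> w t"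
    and doubling: "\<And>s t. 0 < s \<Longrightarrow> s \<le> t \<Longrightarrow> t \<le> 1 \<Longrightarrow> w t \<le> ennreal (2 * t / s) * w s"
  shows "(\<Sum>m<N. ennreal (block_scale p (Suc m) powr (- 1 / p)) * w (block_scale p (Suc m)))
     \<le> ennreal (8 * ((p - 1) / p\<^sup>2)) * (\<integral>\<^sup>+t\<in>{0<..1}. ennreal (t powr (- 1 / p) / t) * w t \<partial>lborel)"
proof -
  define g where "g = 8 * ((p - 1) / p\<^sup>2)"
  have g: "g > 0" using p by (simp add: g_def)
  define E where "E = (\<lambda>m. {block_scale p (Suc m + scale_offset p)<..block_scale p (m + scale_offset p)})"
  define \<kappa> where "\<kappa> = (\<lambda>m t. if p \<ge> 2 then 1 * t powr (- 1 / p - 1) else 1 / (2 * block_scale p (Suc m)) * t powr ((p - 1) / p - 1))"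
  have E01: "E m \<subseteq> {0<..1}" for m
    using block_scale_pos[of p "Suc m + scale_offset p"] block_scale_le_1[OF p, of "m + scale_offset p"]
    unfolding E_def by (auto simp del: add_Suc)
  have disj: "m = m'" if "t \<in> E m" "t \<in> E m'" for t m m'
  proof -
    have False if "t \<in> E m" "t \<in> E m'" "m < m'" for m m'
    proof -
      have "t \<le> block_scale p (m' + scale_offset p)" using that by (simp add: E_def)
      also have "\<dots> \<le> block_scale p (Suc m + scale_offset p)" using that by (intro block_scale_antimono p) auto
      also have "\<dots> < t" using that by (simp add: E_def)
      finally show False by simp
    qed
    then show ?thesis using that by (metis linorder_neqE_nat)
  qed
  have ker: "ennreal (block_scale p (Suc m) powr (- 1 / p)) \<le> ennreal g * (\<integral>\<^sup>+t\<in>E m. ennreal (\<kappa> m t) \<partial>lborel)" for m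
  proof -
    let ?h = "block_scale p (Suc m)"
    have h: "?h > 0" by (rule block_scale_pos)
    show ?thesis
    proof (cases "p \<ge> 2")
      case True
      have eqE: "E m = {?h<..2 powr p * ?h}"
        using True by (simp add: E_def scale_offset_def block_scale_Suc scale_rate_def)
      have hp: "(2 powr p * ?h) powr (- 1 / p) = ?h powr (- 1 / p) / 2"
        using h p by (simp add: powr_mult powr_powr powr_minus_divide)
      have "?h \<le> 2 powr p * ?h" using h p by (simp add: ge_one_powr_ge_zero)
      then have "(\<integral>\<^sup>+t\<in>E m. ennreal (\<kappa> m t) \<partial>lborel) = ennreal (1 * (((2 powr p * ?h) powr (- 1 / p) - ?h powr (- 1 / p)) / (- 1 / p)))"
        using True h p unfolding eqE \<kappa>_def by (simp only: if_True) (intro nn_integral_powr_Ioc, auto)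
      also have "1 * (((2 powr p * ?h) powr (- 1 / p) - ?h powr (- 1 / p)) / (- 1 / p)) = p / 2 * ?h powr (- 1 / p)"
        unfolding hp using p by (simp add: field_simps)
      finally have A: "ennreal g * (\<integral>\<^sup>+t\<in>E m. ennreal (\<kappa> m t) \<partial>lborel) = ennreal ((g * (p / 2)) * ?h powr (- 1 / p))"
        using g p by (simp add: mult.assoc flip: ennreal_mult')
      have "1 \<le> g * (p / 2)"
        using p True by (simp add: g_def field_simps power2_eq_square)
      then have B: "1 * ?h powr (- 1 / p) \<le> (g * (p / 2)) * ?h powr (- 1 / p)" by (rule mult_right_mono) simp
      show ?thesis unfolding A using ennreal_leI[OF B] by (simp only: mult_1)
    next
      case False
      let ?q = "p / (p - 1)"
      have q: "?q > 0" "1 / ?q = (p - 1) / p" "(p - 1) / p \<noteq> 0" using p by auto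
      have eqE: "E m = {?h / 2 powr ?q<..?h}"
        using False by (simp add: E_def scale_offset_def block_scale_Suc scale_rate_def)
      have hp: "(?h / 2 powr ?q) powr ((p - 1) / p) = ?h powr ((p - 1) / p) / 2"
        using h p by (simp add: powr_divide powr_powr)
      have hh: "?h powr ((p - 1) / p) = ?h * ?h powr (- 1 / p)"
        using h p powr_add[of ?h 1 "- 1 / p"] by (simp add: diff_divide_distrib)
      have "?h / 2 powr ?q \<le> ?h" using h q by (simp add: divide_le_eq ge_one_powr_ge_zero)
      then have "(\<integral>\<^sup>+t\<in>E m. ennreal (\<kappa> m t) \<partial>lborel)
          = ennreal (1 / (2 * ?h) * ((?h powr ((p - 1) / p) - (?h / 2 powr ?q) powr ((p - 1) / p)) / ((p - 1) / p)))"
        using False h p q unfolding eqE \<kappa>_def by (simp only: if_False) (intro nn_integral_powr_Ioc, auto)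
      also have "1 / (2 * ?h) * ((?h powr ((p - 1) / p) - (?h / 2 powr ?q) powr ((p - 1) / p)) / ((p - 1) / p))
          = ?q / 4 * ?h powr (- 1 / p)"
        unfolding hp hh using p h by (simp add: field_simps)
      finally have A: "ennreal g * (\<integral>\<^sup>+t\<in>E m. ennreal (\<kappa> m t) \<partial>lborel) = ennreal ((g * (?q / 4)) * ?h powr (- 1 / p))"
        using g p by (simp add: mult.assoc flip: ennreal_mult')
      have "g * (?q / 4) = 2 / p" using p by (simp add: g_def power2_eq_square divide_simps)
      moreover have "1 \<le> 2 / p" using p False by simp
      ultimately have "1 \<le> g * (?q / 4)" by simp
      then have B: "1 * ?h powr (- 1 / p) \<le> (g * (?q / 4)) * ?h powr (- 1 / p)" by (rule mult_right_mono) simp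
      show ?thesis unfolding A using ennreal_leI[OF B] by (simp only: mult_1)
    qed
  qed
  have dom: "w (block_scale p (Suc m)) * ennreal (\<kappa> m t) \<le> ennreal (t powr (- 1 / p) / t) * w t" if t: "t \<in> E m" for m t
  proof (cases "p \<ge> 2")
    case True
    have "t powr (- 1 / p - 1) = t powr (- 1 / p) / t" using t E01[of m] by (auto simp: powr_diff)
    moreover have "w (block_scale p (Suc m)) \<le> w t"
      using t True E01[of m] block_scale_pos[of p "Suc m"] by (intro mono) (auto simp: E_def scale_offset_def)
    ultimately show ?thesis using True by (simp add: \<kappa>_def mult.commute[of _ "w t"] mult_right_mono)
  next
    case False
    let ?h = "block_scale p (Suc m)"
    have t0: "0 < t" "t \<le> 1" "t \<le> ?h" using t E01[of m] False by (auto simp: E_def scale_offset_def)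
    have eq: "t powr ((p - 1) / p - 1) = t powr (- 1 / p)" using p by (simp add: field_simps)
    have "w ?h * ennreal (\<kappa> m t) \<le> (ennreal (2 * ?h / t) * w t) * ennreal (\<kappa> m t)"
      using t0 block_scale_le_1[OF p] by (intro mult_right_mono doubling) auto
    also have "\<dots> = (ennreal (2 * ?h / t) * ennreal (\<kappa> m t)) * w t"
      by (simp only: mult.assoc mult.commute[of "w t"])
    also have "ennreal (2 * ?h / t) * ennreal (\<kappa> m t) = ennreal (2 * ?h / t * \<kappa> m t)"
      using t0 block_scale_pos[of p "Suc m"] by (intro ennreal_mult'[symmetric]) simp
    also have "2 * ?h / t * \<kappa> m t = t powr (- 1 / p) / t"
      using False eq block_scale_pos[of p "Suc m"] by (simp add: \<kappa>_def)
    finally show ?thesis .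
  qed
  have [measurable]: "E m \<in> sets borel" "\<kappa> m \<in> borel_measurable borel" for m
    unfolding E_def \<kappa>_def by measurable
  have "(\<Sum>m<N. ennreal (block_scale p (Suc m) powr (- 1 / p)) * w (block_scale p (Suc m)))
     \<le> (\<Sum>m<N. (ennreal g * (\<integral>\<^sup>+t\<in>E m. ennreal (\<kappa> m t) \<partial>lborel)) * w (block_scale p (Suc m)))"
    by (intro sum_mono mult_right_mono ker) auto
  also have "\<dots> = ennreal g * (\<Sum>m<N. w (block_scale p (Suc m)) * (\<integral>\<^sup>+t\<in>E m. ennreal (\<kappa> m t) \<partial>lborel))"
    by (simp add: sum_distrib_left mult_ac)
  also have "(\<Sum>m<N. w (block_scale p (Suc m)) * (\<integral>\<^sup>+t\<in>E m. ennreal (\<kappa> m t) \<partial>lborel))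
     = (\<integral>\<^sup>+t. (\<Sum>m<N. w (block_scale p (Suc m)) * (ennreal (\<kappa> m t) * indicator (E m) t)) \<partial>lborel)"
    by (subst nn_integral_sum) (auto simp: nn_integral_cmult)
  also have "\<dots> \<le> (\<integral>\<^sup>+t\<in>{0<..1}. ennreal (t powr (- 1 / p) / t) * w t \<partial>lborel)"
  proof (rule nn_integral_mono)
    fix t :: real
    show "(\<Sum>m<N. w (block_scale p (Suc m)) * (ennreal (\<kappa> m t) * indicator (E m) t))
       \<le> ennreal (t powr (- 1 / p) / t) * w t * indicator {0<..1} t"
    proof (cases "\<exists>m<N. t \<in> E m")
      case True
      then obtain m where m: "m < N" "t \<in> E m" by blast
      have "(\<Sum>m<N. w (block_scale p (Suc m)) * (ennreal (\<kappa> m t) * indicator (E m) t))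
        = (\<Sum>m\<in>{m}. w (block_scale p (Suc m)) * (ennreal (\<kappa> m t) * indicator (E m) t))"
        using m disj by (intro sum.mono_neutral_right) (auto simp: indicator_def)
      then show ?thesis using m dom[OF m(2)] E01[of m] by auto
    next
      case False
      then show ?thesis by simp
    qed
  qed
  finally show ?thesis unfolding g_def by (simp add: mult_left_mono)
qed

text \<open>
  The one-dimensional estimate is used once on the boundary terms, where one index is \<open>0\<close>, and twice on
  the remaining ones.  In the second case the inner integral is bounded first for each fixed \<open>v\<close>, with
  the constant moved to the other side so that it need not be taken out of the outer integral.
\<close>

lemma sum_scaled2_le_integrals:
  fixes W :: "real \<Rightarrow> real \<Rightarrow> ennreal"
  assumes p: "p > 1"
    and mono1: "\<And>s t v. 0 < s \<Longrightarrow> s \<le> t \<Longrightarrow> t \<le> 1 \<Longrightarrow> 0 < v \<Longrightarrow> v \<le> 1 \<Longrightarrow> W s v \<le> W t v"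
    and mono2: "\<And>s t v. 0 < s \<Longrightarrow> s \<le> t \<Longrightarrow> t \<le> 1 \<Longrightarrow> 0 < v \<Longrightarrow> v \<le> 1 \<Longrightarrow> W v s \<le> W v t"
    and dbl1: "\<And>s t v. 0 < s \<Longrightarrow> s \<le> t \<Longrightarrow> t \<le> 1 \<Longrightarrow> 0 < v \<Longrightarrow> v \<le> 1 \<Longrightarrow> W t v \<le> ennreal (2 * t / s) * W s v"
    and dbl2: "\<And>s t v. 0 < s \<Longrightarrow> s \<le> t \<Longrightarrow> t \<le> 1 \<Longrightarrow> 0 < v \<Longrightarrow> v \<le> 1 \<Longrightarrow> W v t \<le> ennreal (2 * t / s) * W v s"
  defines "c \<equiv> \<lambda>m. ennreal (block_scale p m powr (- 1 / p))" and "g \<equiv> ennreal (8 * ((p - 1) / p\<^sup>2))"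
  shows "(\<Sum>m<Suc N. \<Sum>n<Suc N. c m * c n * W (block_scale p m) (block_scale p n))
     \<le> W 1 1 + g * (\<integral>\<^sup>+t\<in>{0<..1}. ennreal (t powr (- 1 / p) / t) * (W t 1 + W 1 t) \<partial>lborel)
        + g\<^sup>2 * (\<integral>\<^sup>+v\<in>{0<..1}. (\<integral>\<^sup>+u\<in>{0<..1}. ennreal ((u * v) powr (- 1 / p) / u / v) * W u v \<partial>lborel) \<partial>lborel)"
proof -
  let ?h = "block_scale p"
  have h: "0 < ?h m" "?h m \<le> 1" for m using block_scale_pos block_scale_le_1[OF p] by auto
  have c0: "c 0 = 1" by (simp add: c_def block_scale_0)
  have g: "ennreal (1 / (8 * ((p - 1) / p\<^sup>2))) * g = 1" "g * ennreal (1 / (8 * ((p - 1) / p\<^sup>2))) = 1"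
    unfolding g_def using p by (simp_all flip: ennreal_mult')
  have "(\<Sum>m<Suc N. \<Sum>n<Suc N. c m * c n * W (?h m) (?h n))
     = W 1 1 + (\<Sum>m<N. c (Suc m) * (W (?h (Suc m)) 1 + W 1 (?h (Suc m))))
       + (\<Sum>n<N. c (Suc n) * (\<Sum>m<N. c (Suc m) * W (?h (Suc m)) (?h (Suc n))))"
  proof -
    have "(\<Sum>m<Suc N. \<Sum>n<Suc N. c m * c n * W (?h m) (?h n))
      = W 1 1 + (\<Sum>n<N. c (Suc n) * W 1 (?h (Suc n))) + (\<Sum>m<N. c (Suc m) * W (?h (Suc m)) 1
          + (\<Sum>n<N. c (Suc m) * c (Suc n) * W (?h (Suc m)) (?h (Suc n))))"
      by (simp only: sum.lessThan_Suc_shift c0 block_scale_0 mult_1 mult_1_right)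
    also have "(\<Sum>m<N. c (Suc m) * W (?h (Suc m)) 1 + (\<Sum>n<N. c (Suc m) * c (Suc n) * W (?h (Suc m)) (?h (Suc n))))
      = (\<Sum>m<N. c (Suc m) * W (?h (Suc m)) 1) + (\<Sum>m<N. \<Sum>n<N. c (Suc m) * c (Suc n) * W (?h (Suc m)) (?h (Suc n)))"
      by (simp add: sum.distrib)
    also have "(\<Sum>m<N. \<Sum>n<N. c (Suc m) * c (Suc n) * W (?h (Suc m)) (?h (Suc n)))
      = (\<Sum>n<N. c (Suc n) * (\<Sum>m<N. c (Suc m) * W (?h (Suc m)) (?h (Suc n))))"
      by (subst sum.swap) (simp add: sum_distrib_left mult_ac)
    finally show ?thesis by (simp add: distrib_left sum.distrib add_ac)
  qed
  also have "\<dots> \<le> W 1 1 + g * (\<integral>\<^sup>+t\<in>{0<..1}. ennreal (t powr (- 1 / p) / t) * (W t 1 + W 1 t) \<partial>lborel)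
        + g\<^sup>2 * (\<integral>\<^sup>+v\<in>{0<..1}. (\<integral>\<^sup>+u\<in>{0<..1}. ennreal ((u * v) powr (- 1 / p) / u / v) * W u v \<partial>lborel) \<partial>lborel)"
  proof (intro add_mono order_refl)
    show "(\<Sum>m<N. c (Suc m) * (W (?h (Suc m)) 1 + W 1 (?h (Suc m))))
      \<le> g * (\<integral>\<^sup>+t\<in>{0<..1}. ennreal (t powr (- 1 / p) / t) * (W t 1 + W 1 t) \<partial>lborel)"
      unfolding c_def g_def
    proof (rule sum_scaled_le_integral[OF p])
      fix s t :: real assume st: "0 < s" "s \<le> t" "t \<le> 1"
      show "W s 1 + W 1 s \<le> W t 1 + W 1 t" using st by (intro add_mono mono1 mono2) auto
      show "W t 1 + W 1 t \<le> ennreal (2 * t / s) * (W s 1 + W 1 s)"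
        unfolding distrib_left using st by (intro add_mono dbl1 dbl2) auto
    qed
    let ?w = "\<lambda>v. ennreal (1 / (8 * ((p - 1) / p\<^sup>2))) * (\<Sum>m<N. c (Suc m) * W (?h (Suc m)) v)"
    have "(\<Sum>n<N. c (Suc n) * ?w (?h (Suc n))) \<le> g * (\<integral>\<^sup>+v\<in>{0<..1}. ennreal (v powr (- 1 / p) / v) * ?w v \<partial>lborel)"
      unfolding c_def g_def
    proof (rule sum_scaled_le_integral[OF p])
      fix s t :: real assume st: "0 < s" "s \<le> t" "t \<le> 1"
      show "ennreal (1 / (8 * ((p - 1) / p\<^sup>2))) * (\<Sum>m<N. ennreal (?h (Suc m) powr (- 1 / p)) * W (?h (Suc m)) s)
         \<le> ennreal (1 / (8 * ((p - 1) / p\<^sup>2))) * (\<Sum>m<N. ennreal (?h (Suc m) powr (- 1 / p)) * W (?h (Suc m)) t)"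
        using st h by (intro mult_left_mono sum_mono mono2) auto
      have "(\<Sum>m<N. ennreal (?h (Suc m) powr (- 1 / p)) * W (?h (Suc m)) t)
         \<le> (\<Sum>m<N. ennreal (?h (Suc m) powr (- 1 / p)) * (ennreal (2 * t / s) * W (?h (Suc m)) s))"
        using st h by (intro sum_mono mult_left_mono dbl2) auto
      then show "ennreal (1 / (8 * ((p - 1) / p\<^sup>2))) * (\<Sum>m<N. ennreal (?h (Suc m) powr (- 1 / p)) * W (?h (Suc m)) t)
         \<le> ennreal (2 * t / s) * (ennreal (1 / (8 * ((p - 1) / p\<^sup>2))) * (\<Sum>m<N. ennreal (?h (Suc m) powr (- 1 / p)) * W (?h (Suc m)) s))"
        by (subst mult.left_commute) (intro mult_left_mono, simp_all add: sum_distrib_left mult_ac)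
    qed
    also have "\<dots> \<le> g * (\<integral>\<^sup>+v\<in>{0<..1}. (\<integral>\<^sup>+u\<in>{0<..1}. ennreal ((u * v) powr (- 1 / p) / u / v) * W u v \<partial>lborel) \<partial>lborel)"
    proof (intro mult_left_mono nn_integral_mono)
      fix v :: real
      have "ennreal (v powr (- 1 / p) / v) * ?w v \<le> (\<integral>\<^sup>+u\<in>{0<..1}. ennreal ((u * v) powr (- 1 / p) / u / v) * W u v \<partial>lborel)"
        if v: "v \<in> {0<..1}"
      proof -
        let ?k = "ennreal (v powr (- 1 / p) / v)"
        have "(\<Sum>m<N. c (Suc m) * (?k * W (?h (Suc m)) v)) \<le> g * (\<integral>\<^sup>+u\<in>{0<..1}. ennreal (u powr (- 1 / p) / u) * (?k * W u v) \<partial>lborel)"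
          unfolding c_def g_def
        proof (rule sum_scaled_le_integral[OF p])
          fix s t :: real assume st: "0 < s" "s \<le> t" "t \<le> 1"
          show "?k * W s v \<le> ?k * W t v" using st v by (intro mult_left_mono mono1) auto
          show "?k * W t v \<le> ennreal (2 * t / s) * (?k * W s v)"
            using mult_left_mono[OF dbl1[OF st, of v], of ?k] v by (simp add: mult_ac)
        qed
        also have "(\<integral>\<^sup>+u\<in>{0<..1}. ennreal (u powr (- 1 / p) / u) * (?k * W u v) \<partial>lborel)
          = (\<integral>\<^sup>+u\<in>{0<..1}. ennreal ((u * v) powr (- 1 / p) / u / v) * W u v \<partial>lborel)"
        proof (intro nn_integral_cong)
          fix u :: real
          show "ennreal (u powr (- 1 / p) / u) * (?k * W u v) * indicator {0<..1} u
            = ennreal ((u * v) powr (- 1 / p) / u / v) * W u v * indicator {0<..1} u"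
            using v by (cases "u \<in> {0<..1}") (auto simp: powr_mult mult.assoc[symmetric] simp flip: ennreal_mult')
        qed
        finally have "ennreal (1 / (8 * ((p - 1) / p\<^sup>2))) * (\<Sum>m<N. c (Suc m) * (?k * W (?h (Suc m)) v))
           \<le> ennreal (1 / (8 * ((p - 1) / p\<^sup>2))) * (g * (\<integral>\<^sup>+u\<in>{0<..1}. ennreal ((u * v) powr (- 1 / p) / u / v) * W u v \<partial>lborel))"
          by (rule mult_left_mono) simp
        moreover have "(\<Sum>m<N. c (Suc m) * (?k * W (?h (Suc m)) v)) = ?k * (\<Sum>m<N. c (Suc m) * W (?h (Suc m)) v)"
          by (simp add: sum_distrib_left mult.left_commute)
        ultimately show ?thesis
          by (simp only: mult.assoc[symmetric] g mult_1) (simp only: mult.assoc mult.left_commute)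
      qed
      then show "ennreal (v powr (- 1 / p) / v) * ?w v * indicator {0<..1} v
         \<le> (\<integral>\<^sup>+u\<in>{0<..1}. ennreal ((u * v) powr (- 1 / p) / u / v) * W u v \<partial>lborel) * indicator {0<..1} v"
        by (auto simp: indicator_def)
    qed simp
    finally have "g * (\<Sum>n<N. c (Suc n) * ?w (?h (Suc n)))
       \<le> g * (g * (\<integral>\<^sup>+v\<in>{0<..1}. (\<integral>\<^sup>+u\<in>{0<..1}. ennreal ((u * v) powr (- 1 / p) / u / v) * W u v \<partial>lborel) \<partial>lborel))"
      by (rule mult_left_mono) simp
    also have "(\<Sum>n<N. c (Suc n) * ?w (?h (Suc n)))
       = ennreal (1 / (8 * ((p - 1) / p\<^sup>2))) * (\<Sum>n<N. c (Suc n) * (\<Sum>m<N. c (Suc m) * W (?h (Suc m)) (?h (Suc n))))"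
      by (simp only: sum_distrib_left[of _ _ "{..<N}"] mult.left_commute)
    finally show "(\<Sum>n<N. c (Suc n) * (\<Sum>m<N. c (Suc m) * W (?h (Suc m)) (?h (Suc n))))
       \<le> g\<^sup>2 * (\<integral>\<^sup>+v\<in>{0<..1}. (\<integral>\<^sup>+u\<in>{0<..1}. ennreal ((u * v) powr (- 1 / p) / u / v) * W u v \<partial>lborel) \<partial>lborel)"
      by (simp only: mult.assoc[symmetric] g mult_1 power2_eq_square[of g])
  qed
  finally show ?thesis .
qed

section \<open>Norms of differences of periodic functions\<close>

lemma epowr_le_iff:
  assumes "c \<ge> 0" "p > 0"
  shows "epowr a (1 / p) \<le> ennreal c \<longleftrightarrow> a \<le> ennreal (c powr p)"
proof (cases a)
  case (real r)
  have "r powr (1 / p) \<le> c \<longleftrightarrow> r \<le> c powr p"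
  proof
    assume "r powr (1 / p) \<le> c"
    then have "(r powr (1 / p)) powr p \<le> c powr p" using assms by (intro powr_mono2) auto
    then show "r \<le> c powr p" using real assms by (simp add: powr_powr)
  next
    assume "r \<le> c powr p"
    then have "r powr (1 / p) \<le> (c powr p) powr (1 / p)" using assms real by (intro powr_mono2) auto
    then show "r powr (1 / p) \<le> c" using assms by (simp add: powr_powr)
  qed
  then show ?thesis using real assms by (simp add: epowr_def)
qed (simp add: epowr_def top_unique)

text \<open>
  The \<open>p\<close>-th power of \<^const>\<open>Lp_norm\<close>, for Borel functions.  Convexity bounds the norm of a sum by the
  number of summands times the largest norm, which suffices throughout: it costs absolute constants and
  is sharp where a step is divided into equal parts.
\<close>

definition Lp_mass :: "real \<Rightarrow> (real \<times> real \<Rightarrow> real) \<Rightarrow> ennreal" where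
  "Lp_mass p F = unit_integral (\<lambda>z. ennreal (\<bar>F z\<bar> powr p))"

lemma Lp_norm_eq:
  assumes [measurable]: "F \<in> borel_measurable borel"
  shows "Lp_norm p F = epowr (Lp_mass p F) (1 / p)"
proof -
  have [measurable]: "F \<in> borel_measurable (borel \<Otimes>\<^sub>M borel)" by (simp add: borel_prod)
  have "(\<integral>\<^sup>+z\<in>{0..1} \<times> {0..1}. ennreal (\<bar>F z\<bar> powr p) \<partial>lebesgue)
      = (\<integral>\<^sup>+z. ennreal (\<bar>F z\<bar> powr p) * indicator ({0..1} \<times> {0..1}) z \<partial>(lborel \<Otimes>\<^sub>M lborel))"
    by (simp add: nn_integral_completion lborel_prod)
  also have "\<dots> = (\<integral>\<^sup>+y. (\<integral>\<^sup>+x. ennreal (\<bar>F (x, y)\<bar> powr p) * indicator ({0..1} \<times> {0..1}) (x, y) \<partial>lborel) \<partial>lborel)"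
    by (intro lborel_pair.nn_integral_snd[symmetric]) measurable
  also have "\<dots> = Lp_mass p F"
    unfolding Lp_mass_def unit_integral_def
    by (intro nn_integral_cong) (simp add: indicator_times mult.assoc[symmetric] nn_integral_multc)
  finally show ?thesis unfolding Lp_norm_def by simp
qed

lemma Lp_norm_le_iff:
  assumes "F \<in> borel_measurable borel" "c \<ge> 0" "p > 0"
  shows "Lp_norm p F \<le> ennreal c \<longleftrightarrow> Lp_mass p F \<le> ennreal (c powr p)"
  using assms by (simp add: Lp_norm_eq epowr_le_iff)

lemma unit_integral_mono:
  assumes "\<And>z. \<Phi> z \<le> \<Psi> z"
  shows "unit_integral \<Phi> \<le> unit_integral \<Psi>"
  unfolding unit_integral_def by (intro nn_integral_mono mult_right_mono assms) auto

lemma unit_integral_cmult: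
  assumes [measurable]: "\<Phi> \<in> borel_measurable borel"
  shows "unit_integral (\<lambda>z. c * \<Phi> z) = c * unit_integral \<Phi>"
proof -
  have [measurable]: "\<Phi> \<in> borel_measurable (borel \<Otimes>\<^sub>M borel)" by (simp add: borel_prod)
  show ?thesis unfolding unit_integral_def by (simp add: nn_integral_cmult mult.assoc)
qed

lemma unit_integral_sum:
  assumes [measurable]: "\<And>i. i \<in> I \<Longrightarrow> \<Phi> i \<in> borel_measurable borel"
  shows "unit_integral (\<lambda>z. \<Sum>i\<in>I. \<Phi> i z) = (\<Sum>i\<in>I. unit_integral (\<Phi> i))"
proof -
  have [measurable]: "\<And>i. i \<in> I \<Longrightarrow> \<Phi> i \<in> borel_measurable (borel \<Otimes>\<^sub>M borel)" by (simp add: borel_prod)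
  show ?thesis unfolding unit_integral_def by (simp add: nn_integral_sum sum_distrib_right)
qed

lemma unit_integral_swap:
  assumes [measurable]: "\<Phi> \<in> borel_measurable borel"
  shows "unit_integral (\<lambda>z. \<Phi> (prod.swap z)) = unit_integral \<Phi>"
proof -
  have [measurable]: "\<Phi> \<in> borel_measurable (borel \<Otimes>\<^sub>M borel)" by (simp add: borel_prod)
  have "unit_integral (\<lambda>z. \<Phi> (prod.swap z))
     = (\<integral>\<^sup>+y. (\<integral>\<^sup>+x. \<Phi> (y, x) * indicator {0..1} x * indicator {0..1} y \<partial>lborel) \<partial>lborel)"
    unfolding unit_integral_def by (simp add: nn_integral_multc)
  also have "\<dots> = (\<integral>\<^sup>+x. (\<integral>\<^sup>+y. \<Phi> (y, x) * indicator {0..1} x * indicator {0..1} y \<partial>lborel) \<partial>lborel)"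
    by (intro lborel_pair.Fubini') measurable
  also have "\<dots> = (\<integral>\<^sup>+x. (\<integral>\<^sup>+y. (\<Phi> (y, x) * indicator {0..1} y) * indicator {0..1} x \<partial>lborel) \<partial>lborel)"
    by (simp add: mult_ac)
  also have "\<dots> = unit_integral \<Phi>"
    unfolding unit_integral_def by (intro nn_integral_cong nn_integral_multc) measurable
  finally show ?thesis .
qed

lemma unit_integral_translate:
  assumes [measurable]: "\<Phi> \<in> borel_measurable borel"
    and per: "\<And>x y. \<Phi> (x + 1, y) = \<Phi> (x, y)" "\<And>x y. \<Phi> (x, y + 1) = \<Phi> (x, y)"
  shows "unit_integral (\<lambda>z. \<Phi> (z + h)) = unit_integral \<Phi>"
proof -
  have [measurable]: "\<Phi> \<in> borel_measurable (borel \<Otimes>\<^sub>M borel)" by (simp add: borel_prod)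
  obtain s t where h: "h = (s, t)" by (cases h)
  have translate: "(\<integral>\<^sup>+x\<in>{0..1}. \<phi> (x + c) \<partial>lborel) = (\<integral>\<^sup>+x\<in>{0..1}. \<phi> x \<partial>lborel)"
    if [measurable]: "\<phi> \<in> borel_measurable borel" and "\<And>x. \<phi> (x + 1) = \<phi> x" for \<phi> :: "real \<Rightarrow> ennreal" and c
    using nn_integral_Icc_shift[where \<phi>=\<phi> and a=0 and b=1 and c=c] nn_integral_period[of \<phi> c] that
    by (simp add: add.commute)
  have "unit_integral (\<lambda>z. \<Phi> (z + h)) = (\<integral>\<^sup>+y\<in>{0..1}. (\<integral>\<^sup>+x\<in>{0..1}. \<Phi> (x, y + t) \<partial>lborel) \<partial>lborel)"
    unfolding unit_integral_def h using translate[of "\<lambda>x. \<Phi> (x, _)" s] per by simp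
  also have "\<dots> = unit_integral \<Phi>"
    unfolding unit_integral_def using per
    by (subst translate[of "\<lambda>y. \<integral>\<^sup>+x\<in>{0..1}. \<Phi> (x, y) \<partial>lborel" t]) auto
  finally show ?thesis .
qed

lemma Lp_mass_translate:
  assumes [measurable]: "F \<in> borel_measurable borel" and "periodic2 F"
  shows "Lp_mass p (\<lambda>z. F (z + h)) = Lp_mass p F"
  unfolding Lp_mass_def using assms(2)
  by (intro unit_integral_translate[where \<Phi>="\<lambda>z. ennreal (\<bar>F z\<bar> powr p)"]) (auto simp: periodic2_def periodic1_def)

lemma Lp_mass_mono:
  assumes "\<And>z. \<bar>F z\<bar> \<le> \<bar>G z\<bar>" "p \<ge> 0"
  shows "Lp_mass p F \<le> Lp_mass p G"
  unfolding Lp_mass_def using assms by (intro unit_integral_mono ennreal_leI powr_mono2) auto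

lemma Lp_mass_cmult:
  assumes [measurable]: "F \<in> borel_measurable borel"
  shows "Lp_mass p (\<lambda>z. c * F z) = ennreal (\<bar>c\<bar> powr p) * Lp_mass p F"
  unfolding Lp_mass_def
  by (simp add: abs_mult powr_mult ennreal_mult' unit_integral_cmult)

lemma Lp_mass_sum_le:
  fixes F :: "'i \<Rightarrow> real \<times> real \<Rightarrow> real"
  assumes p: "p \<ge> 1" and I: "finite I" and c: "c \<ge> 0"
    and [measurable]: "\<And>i. i \<in> I \<Longrightarrow> F i \<in> borel_measurable borel"
    and le: "\<And>i. i \<in> I \<Longrightarrow> Lp_mass p (F i) \<le> ennreal (c powr p)"
  shows "Lp_mass p (\<lambda>z. \<Sum>i\<in>I. F i z) \<le> ennreal ((real (card I) * c) powr p)"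
proof -
  let ?n = "real (card I)"
  have "Lp_mass p (\<lambda>z. \<Sum>i\<in>I. F i z) \<le> unit_integral (\<lambda>z. ennreal (?n powr (p - 1)) * (\<Sum>i\<in>I. ennreal (\<bar>F i z\<bar> powr p)))"
    unfolding Lp_mass_def
  proof (rule unit_integral_mono)
    fix z
    have "ennreal (\<bar>\<Sum>i\<in>I. F i z\<bar> powr p) \<le> ennreal (?n powr (p - 1) * (\<Sum>i\<in>I. \<bar>F i z\<bar> powr p))"
      by (intro ennreal_leI powr_sum_le p I)
    then show "ennreal (\<bar>\<Sum>i\<in>I. F i z\<bar> powr p) \<le> ennreal (?n powr (p - 1)) * (\<Sum>i\<in>I. ennreal (\<bar>F i z\<bar> powr p))"
      by (simp add: ennreal_mult' sum_ennreal)
  qed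
  also have "\<dots> = ennreal (?n powr (p - 1)) * (\<Sum>i\<in>I. Lp_mass p (F i))"
    unfolding Lp_mass_def by (simp add: unit_integral_cmult unit_integral_sum del: sum_ennreal)
  also have "\<dots> \<le> ennreal (?n powr (p - 1)) * (\<Sum>i\<in>I. ennreal (c powr p))"
    by (intro mult_left_mono sum_mono le) auto
  also have "\<dots> = ennreal (?n powr (p - 1) * (?n * c powr p))"
    by (simp add: ennreal_mult' ennreal_of_nat_eq_real_of_nat)
  also have "?n powr (p - 1) * (?n * c powr p) = (?n * c) powr p"
    using c powr_mult_base[of ?n "p - 1"] by (simp add: powr_mult mult_ac)
  finally show ?thesis .
qed

lemma Lp_mass_add_le:
  assumes p: "p \<ge> 1" and c: "c \<ge> 0"
    and [measurable]: "F \<in> borel_measurable borel" "G \<in> borel_measurable borel"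
    and "Lp_mass p F \<le> ennreal (c powr p)" "Lp_mass p G \<le> ennreal (c powr p)"
  shows "Lp_mass p (\<lambda>z. F z + G z) \<le> ennreal ((2 * c) powr p)"
  using Lp_mass_sum_le[of p "{0, 1::nat}" c "\<lambda>i. if i = 0 then F else G"] assms by simp

lemma Lp_mass_uminus: "Lp_mass p (\<lambda>z. - F z) = Lp_mass p F"
  by (simp add: Lp_mass_def)

lemma Lp_mass_diff_le:
  assumes "p \<ge> 1" "c \<ge> 0" "F \<in> borel_measurable borel" "G \<in> borel_measurable borel"
    and "Lp_mass p F \<le> ennreal (c powr p)" "Lp_mass p G \<le> ennreal (c powr p)"
  shows "Lp_mass p (\<lambda>z. F z - G z) \<le> ennreal ((2 * c) powr p)"
  using Lp_mass_add_le[of p c F "\<lambda>z. - G z"] assms by (simp add: Lp_mass_uminus)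

lemma diff1_measurable [measurable]:
  assumes [measurable]: "f \<in> borel_measurable borel"
  shows "diff1 h f \<in> borel_measurable borel"
  unfolding diff1_def[abs_def] by measurable

lemma diff2_eq: "diff2 s t f z = diff1 (s, 0) f (z + (0, t)) - diff1 (s, 0) f z"
  by (cases z) (simp add: diff2_def diff1_def)

lemma diff2_measurable [measurable]:
  assumes [measurable]: "f \<in> borel_measurable borel"
  shows "diff2 s t f \<in> borel_measurable borel"
proof -
  have "diff2 s t f = (\<lambda>z. diff1 (s, 0) f (z + (0, t)) - diff1 (s, 0) f z)"
    by (simp add: fun_eq_iff diff2_eq del: split_paired_All)
  then show ?thesis by simp
qed

lemma periodic2_iff: "periodic2 f \<longleftrightarrow> (\<forall>z. f (z + (1, 0)) = f z \<and> f (z + (0, 1)) = f z)"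
  by (auto simp: periodic2_def periodic1_def)

lemma periodic2_diff1: "periodic2 f \<Longrightarrow> periodic2 (diff1 h f)"
proof -
  assume "periodic2 f"
  then have "f (z + (1, 0) + h) = f (z + h)" "f (z + (0, 1) + h) = f (z + h)" for z
    unfolding periodic2_iff by (metis add.commute add.left_commute)+
  then show ?thesis using \<open>periodic2 f\<close> unfolding periodic2_iff diff1_def by simp
qed

lemma periodic2_diff2: "periodic2 f \<Longrightarrow> periodic2 (diff2 s t f)"
proof -
  assume "periodic2 f"
  then have "periodic2 (diff1 (s, 0) f)" by (rule periodic2_diff1)
  then have "periodic2 (diff1 (0, t) (diff1 (s, 0) f))" by (rule periodic2_diff1)
  moreover have "diff2 s t f = diff1 (0, t) (diff1 (s, 0) f)"
    by (simp add: fun_eq_iff diff2_eq diff1_def del: split_paired_All)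
  ultimately show ?thesis by simp
qed

lemma Lp_mass_diff1_le:
  assumes p: "p \<ge> 1" and c: "c \<ge> 0" and f: "f \<in> borel_measurable borel" "periodic2 f"
    and "Lp_mass p f \<le> ennreal (c powr p)"
  shows "Lp_mass p (diff1 h f) \<le> ennreal ((2 * c) powr p)"
  using Lp_mass_diff_le[OF p c _ f(1), of "\<lambda>z. f (z + h)"] Lp_mass_translate[OF f, of p h] assms
  by (simp add: diff1_def[abs_def])

lemma Lp_mass_diff2_le_diff1:
  assumes p: "p \<ge> 1" and c: "c \<ge> 0" and f: "f \<in> borel_measurable borel" "periodic2 f"
    and "Lp_mass p (diff1 (s, 0) f) \<le> ennreal (c powr p)"
  shows "Lp_mass p (diff2 s t f) \<le> ennreal ((2 * c) powr p)"
  using Lp_mass_diff_le[OF p c _ diff1_measurable[OF f(1)], of "\<lambda>z. diff1 (s, 0) f (z + (0, t))" "(s, 0)"]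
    Lp_mass_translate[OF diff1_measurable[OF f(1)] periodic2_diff1[OF f(2)], of p "(s, 0)" "(0, t)"] assms
  by (simp add: diff2_eq[abs_def])

lemma diff1_telescope: "(\<Sum>i<n. diff1 h f (z + real i *\<^sub>R h)) = f (z + real n *\<^sub>R h) - f z"
  by (induction n) (simp_all add: diff1_def algebra_simps)

lemma Lp_mass_diff1_multiple_le:
  assumes p: "p \<ge> 1" and c: "c \<ge> 0" and f: "f \<in> borel_measurable borel" "periodic2 f"
    and le: "Lp_mass p (diff1 h f) \<le> ennreal (c powr p)"
  shows "Lp_mass p (diff1 (real n *\<^sub>R h) f) \<le> ennreal ((real n * c) powr p)"
proof -
  have "Lp_mass p (\<lambda>z. \<Sum>i<n. diff1 h f (z + real i *\<^sub>R h)) \<le> ennreal ((real (card {..<n}) * c) powr p)"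
    using Lp_mass_translate[OF diff1_measurable[OF f(1)] periodic2_diff1[OF f(2)], of p] le f
    by (intro Lp_mass_sum_le p c) auto
  then show ?thesis unfolding diff1_telescope by (simp add: diff1_def[abs_def])
qed

text \<open>
  The number of steps of length at most \<open>s\<close> that are needed to cover \<open>t\<close>, which gives the doubling
  property of the moduli with the factor \<open>2 * t / s\<close>.
\<close>

lemma exists_multiple:
  fixes s t :: real assumes "0 < s" "s \<le> t"
  obtains n :: nat where "n > 0" "t / real n \<le> s" "real n \<le> 2 * t / s"
proof -
  define k where "k = nat \<lceil>t / s\<rceil>"
  have q: "1 \<le> t / s" using assms by simp
  have k: "t / s \<le> real k" "real k < t / s + 1" unfolding k_def using q by linarith+
  have "k > 0" using k(1) q by (cases k) auto
  moreover have "t / real k \<le> s"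
    using k(1) assms(1) \<open>k > 0\<close> by (simp add: divide_le_eq mult.commute)
  moreover have "real k \<le> 2 * t / s" using k q by simp
  ultimately show ?thesis using that by blast
qed

definition modulus_real :: "real \<Rightarrow> (real \<times> real \<Rightarrow> real) \<Rightarrow> real \<Rightarrow> real" where
  "modulus_real p f t = enn2real (modulus p f t)"

definition mixed_real :: "real \<Rightarrow> (real \<times> real \<Rightarrow> real) \<Rightarrow> real \<Rightarrow> real \<Rightarrow> real" where
  "mixed_real p f u v = enn2real (mixed_modulus p f u v)"

text \<open>
  A Borel representative makes all sections measurable, so that Tonelli's theorem applies.
\<close>

locale Lp_borel =
  fixes p :: real and f :: "real \<times> real \<Rightarrow> real" and n :: real
  assumes p: "p > 1" and f [measurable]: "f \<in> borel_measurable borel" and per: "periodic2 f"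
    and n: "n \<ge> 0" and mass: "Lp_mass p f \<le> ennreal (n powr p)"
begin

lemma p1: "p \<ge> 1" and p0: "p > 0" using p by auto

lemma modulus_eq: "modulus p f t = ennreal (modulus_real p f t)"
proof -
  have "modulus p f t \<le> ennreal (2 * n)"
    unfolding modulus_def using n p0 Lp_mass_diff1_le[OF p1 n f per mass]
    by (intro SUP_least) (simp add: Lp_norm_le_iff)
  then show ?thesis unfolding modulus_real_def
    by (metis ennreal_enn2real ennreal_less_top le_less_trans)
qed

lemma mixed_eq: "mixed_modulus p f u v = ennreal (mixed_real p f u v)"
proof -
  have "mixed_modulus p f u v \<le> ennreal (4 * n)"
    unfolding mixed_modulus_def
    using n p0 Lp_mass_diff2_le_diff1[OF p1 _ f per Lp_mass_diff1_le[OF p1 n f per mass]]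
    by (intro SUP_least) (auto simp add: Lp_norm_le_iff)
  then show ?thesis unfolding mixed_real_def
    by (metis ennreal_enn2real ennreal_less_top le_less_trans)
qed

lemma modulus_real_nonneg: "modulus_real p f t \<ge> 0" and mixed_real_nonneg: "mixed_real p f u v \<ge> 0"
  by (simp_all add: modulus_real_def mixed_real_def)

lemma Lp_mass_diff1_modulus: "norm h \<le> t \<Longrightarrow> Lp_mass p (diff1 h f) \<le> ennreal (modulus_real p f t powr p)"
proof -
  assume "norm h \<le> t"
  then have "Lp_norm p (diff1 h f) \<le> modulus p f t" unfolding modulus_def by (intro SUP_upper) simp
  then show ?thesis by (simp add: modulus_eq Lp_norm_le_iff modulus_real_nonneg p0)
qed

lemma Lp_mass_diff2_mixed:
  "0 \<le> s \<Longrightarrow> s \<le> u \<Longrightarrow> 0 \<le> t \<Longrightarrow> t \<le> v \<Longrightarrow> Lp_mass p (diff2 s t f) \<le> ennreal (mixed_real p f u v powr p)"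
proof -
  assume "0 \<le> s" "s \<le> u" "0 \<le> t" "t \<le> v"
  then have "Lp_norm p (diff2 s t f) \<le> mixed_modulus p f u v"
    unfolding mixed_modulus_def by (intro SUP_upper2[of "(s, t)"]) auto
  then show ?thesis by (simp add: mixed_eq Lp_norm_le_iff mixed_real_nonneg p0)
qed

lemma modulus_real_le:
  assumes "c \<ge> 0" "\<And>h. norm h \<le> t \<Longrightarrow> Lp_mass p (diff1 h f) \<le> ennreal (c powr p)"
  shows "modulus_real p f t \<le> c"
proof -
  have "modulus p f t \<le> ennreal c"
    unfolding modulus_def using assms p0 by (intro SUP_least) (auto simp: Lp_norm_le_iff)
  then show ?thesis using assms by (simp add: modulus_eq)
qed

lemma mixed_real_le:
  assumes "c \<ge> 0" "\<And>s t. 0 \<le> s \<Longrightarrow> s \<le> u \<Longrightarrow> 0 \<le> t \<Longrightarrow> t \<le> v \<Longrightarrow> Lp_mass p (diff2 s t f) \<le> ennreal (c powr p)"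
  shows "mixed_real p f u v \<le> c"
proof -
  have "mixed_modulus p f u v \<le> ennreal c"
    unfolding mixed_modulus_def using assms p0 by (intro SUP_least) (auto simp: Lp_norm_le_iff)
  then show ?thesis using assms by (simp add: mixed_eq)
qed

lemma modulus_real_mono: "s \<le> t \<Longrightarrow> modulus_real p f s \<le> modulus_real p f t"
  by (intro modulus_real_le modulus_real_nonneg Lp_mass_diff1_modulus) auto

lemma mixed_real_mono: "s \<le> u \<Longrightarrow> t \<le> v \<Longrightarrow> mixed_real p f s t \<le> mixed_real p f u v"
  by (intro mixed_real_le mixed_real_nonneg Lp_mass_diff2_mixed) auto

lemma modulus_real_doubling:
  assumes "0 < s" "s \<le> t"
  shows "modulus_real p f t \<le> 2 * t / s * modulus_real p f s"
proof -
  obtain k where k: "k > 0" "t / real k \<le> s" "real k \<le> 2 * t / s" using exists_multiple[OF assms] .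
  have "modulus_real p f t \<le> real k * modulus_real p f s"
  proof (rule modulus_real_le)
    fix h assume "norm (h :: real \<times> real) \<le> t"
    then have "norm ((1 / real k) *\<^sub>R h) \<le> s"
      using k(2) divide_right_mono[of "norm h" t "real k"] by simp
    from Lp_mass_diff1_multiple_le[OF p1 modulus_real_nonneg f per Lp_mass_diff1_modulus[OF this], of k]
    show "Lp_mass p (diff1 h f) \<le> ennreal ((real k * modulus_real p f s) powr p)" using k by simp
  qed (simp add: modulus_real_nonneg)
  also have "\<dots> \<le> 2 * t / s * modulus_real p f s" by (intro mult_right_mono k modulus_real_nonneg)
  finally show ?thesis .
qed

lemma mixed_real_doubling1:
  assumes "0 < s" "s \<le> u"
  shows "mixed_real p f u v \<le> 2 * u / s * mixed_real p f s v"
proof -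
  obtain k where k: "k > 0" "u / real k \<le> s" "real k \<le> 2 * u / s" using exists_multiple[OF assms] .
  have "mixed_real p f u v \<le> real k * mixed_real p f s v"
  proof (rule mixed_real_le)
    fix s' t assume st: "0 \<le> s'" "s' \<le> u" "0 \<le> t" "t \<le> v"
    have eq: "diff2 \<sigma> t f = diff1 (\<sigma>, 0) (diff1 (0, t) f)" for \<sigma>
      by (simp add: fun_eq_iff diff2_def diff1_def)
    have "s' / real k \<le> s" using st k(1,2) by (meson divide_right_mono of_nat_0_le_iff order_trans)
    then have "Lp_mass p (diff2 (s' / real k) t f) \<le> ennreal (mixed_real p f s v powr p)"
      using st by (intro Lp_mass_diff2_mixed) auto
    from Lp_mass_diff1_multiple_le[OF p1 mixed_real_nonneg diff1_measurable[OF f] periodic2_diff1[OF per]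
        this[unfolded eq], of k]
    show "Lp_mass p (diff2 s' t f) \<le> ennreal ((real k * mixed_real p f s v) powr p)" using k by (simp add: eq)
  qed (simp add: mixed_real_nonneg)
  also have "\<dots> \<le> 2 * u / s * mixed_real p f s v" by (intro mult_right_mono k mixed_real_nonneg)
  finally show ?thesis .
qed

lemma mixed_real_doubling2:
  assumes "0 < s" "s \<le> u"
  shows "mixed_real p f v u \<le> 2 * u / s * mixed_real p f v s"
proof -
  obtain k where k: "k > 0" "u / real k \<le> s" "real k \<le> 2 * u / s" using exists_multiple[OF assms] .
  have "mixed_real p f v u \<le> real k * mixed_real p f v s"
  proof (rule mixed_real_le)
    fix t s' assume st: "0 \<le> s'" "s' \<le> u" "0 \<le> t" "t \<le> v"
    have eq: "diff2 t \<sigma> f = diff1 (0, \<sigma>) (diff1 (t, 0) f)" for \<sigma>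
      by (simp add: fun_eq_iff diff2_def diff1_def)
    have "s' / real k \<le> s" using st k(1,2) by (meson divide_right_mono of_nat_0_le_iff order_trans)
    then have "Lp_mass p (diff2 t (s' / real k) f) \<le> ennreal (mixed_real p f v s powr p)"
      using st by (intro Lp_mass_diff2_mixed) auto
    from Lp_mass_diff1_multiple_le[OF p1 mixed_real_nonneg diff1_measurable[OF f] periodic2_diff1[OF per]
        this[unfolded eq], of k]
    show "Lp_mass p (diff2 t s' f) \<le> ennreal ((real k * mixed_real p f v s) powr p)" using k by (simp add: eq)
  qed (simp add: mixed_real_nonneg)
  also have "\<dots> \<le> 2 * u / s * mixed_real p f v s" by (intro mult_right_mono k mixed_real_nonneg)
  finally show ?thesis .
qed

lemma quasi_modulus_mixed_real: "quasi_modulus (mixed_real p f)"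
  unfolding quasi_modulus_def
  using mixed_real_nonneg mixed_real_mono mixed_real_doubling1 mixed_real_doubling2 by auto

end

section \<open>Point values and rows by means of cut-offs\<close>

definition cutoff :: "(real \<Rightarrow> real) \<Rightarrow> bool" where
  "cutoff c \<longleftrightarrow> continuous_on UNIV c \<and> periodic1 c \<and> (\<forall>x. \<bar>c x\<bar> \<le> 1) \<and> (\<forall>x y. \<bar>c x - c y\<bar> \<le> 8 * \<bar>x - y\<bar>)"

definition localize :: "(real \<times> real \<Rightarrow> real) \<Rightarrow> (real \<Rightarrow> real) \<Rightarrow> (real \<Rightarrow> real) \<Rightarrow> real \<times> real \<Rightarrow> real" where
  "localize d c1 c2 z = d z * c1 (fst z) * c2 (snd z)"

lemma cutoff_one: "cutoff (\<lambda>_. 1)"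
  by (auto simp: cutoff_def periodic1_def)

text \<open>
  The Lipschitz constant is \<open>2 * pi\<close>, which is at most \<open>8\<close>.
\<close>

lemma cutoff_cos: "cutoff (\<lambda>x. cos (2 * pi * (x - a)))"
  unfolding cutoff_def
proof (intro conjI allI)
  show "continuous_on UNIV (\<lambda>x. cos (2 * pi * (x - a)))" by (intro continuous_intros)
  have "2 * pi * (x + 1 - a) = 2 * pi * (x - a) + 2 * pi" for x by (simp add: algebra_simps)
  then show "periodic1 (\<lambda>x. cos (2 * pi * (x - a)))"
    unfolding periodic1_def by (simp only: cos_periodic)  simp
  fix x y
  have "\<bar>cos u - cos v\<bar> \<le> \<bar>u - v\<bar>" for u v :: real
  proof -
    have "\<bar>cos u - cos v\<bar> = 2 * (\<bar>sin ((u + v) / 2)\<bar> * \<bar>sin ((v - u) / 2)\<bar>)"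
      by (simp add: cos_diff_cos abs_mult)
    also have "\<dots> \<le> 2 * (1 * \<bar>(v - u) / 2\<bar>)"
      by (intro mult_left_mono mult_mono abs_sin_x_le_abs_x) auto
    finally show ?thesis by simp
  qed
  from this[of "2 * pi * (x - a)" "2 * pi * (y - a)"]
  have "\<bar>cos (2 * pi * (x - a)) - cos (2 * pi * (y - a))\<bar> \<le> \<bar>2 * pi * (x - y)\<bar>"
    by (simp add: algebra_simps)
  also have "\<dots> = (2 * pi) * \<bar>x - y\<bar>" by (simp add: abs_mult)
  also have "\<dots> \<le> 8 * \<bar>x - y\<bar>" using pi_less_4 by (intro mult_right_mono) auto
  finally show "\<bar>cos (2 * pi * (x - a)) - cos (2 * pi * (y - a))\<bar> \<le> 8 * \<bar>x - y\<bar>" .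
qed (simp add: abs_cos_le_one)

lemma localize_continuous:
  assumes "continuous_on UNIV d" "cutoff c1" "cutoff c2"
  shows "continuous_on UNIV (localize d c1 c2)"
proof -
  have c: "continuous_on UNIV c1" "continuous_on UNIV c2" using assms by (auto simp: cutoff_def)
  have "continuous_on UNIV (\<lambda>z::real \<times> real. c1 (fst z))" "continuous_on UNIV (\<lambda>z::real \<times> real. c2 (snd z))"
    using continuous_on_compose2[OF c(1) continuous_on_fst[OF continuous_on_id]]
      continuous_on_compose2[OF c(2) continuous_on_snd[OF continuous_on_id]] by simp_all
  then show ?thesis unfolding localize_def[abs_def] by (intro continuous_intros assms)
qed

lemma localize_periodic:
  assumes "periodic2 d" "cutoff c1" "cutoff c2"
  shows "periodic2 (localize d c1 c2)"
  using assms by (auto simp: periodic2_iff localize_def cutoff_def periodic1_def)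

lemma abs_localize_le:
  assumes "cutoff c1" "cutoff c2"
  shows "\<bar>localize d c1 c2 z\<bar> \<le> \<bar>d z\<bar>"
proof -
  have "\<bar>c1 (fst z)\<bar> * \<bar>c2 (snd z)\<bar> \<le> 1 * 1" using assms unfolding cutoff_def by (intro mult_mono) auto
  then show ?thesis unfolding localize_def by (simp add: abs_mult mult.assoc mult_left_le)
qed

lemma Lp_mass_le_scaled:
  assumes "p > 0" "k \<ge> 0" "c \<ge> 0" and [measurable]: "G \<in> borel_measurable borel"
    and "\<And>z. \<bar>F z\<bar> \<le> k * \<bar>G z\<bar>" "Lp_mass p G \<le> ennreal (c powr p)" "k * c \<le> S"
  shows "Lp_mass p F \<le> ennreal (S powr p)"
proof -
  have "Lp_mass p F \<le> Lp_mass p (\<lambda>z. k * G z)" using assms by (intro Lp_mass_mono) (auto simp: abs_mult)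
  also have "\<dots> \<le> ennreal (k powr p) * ennreal (c powr p)"
    using assms by (simp add: Lp_mass_cmult mult_left_mono)
  also have "\<dots> = ennreal ((k * c) powr p)" using assms by (simp add: powr_mult ennreal_mult')
  also have "\<dots> \<le> ennreal (S powr p)" using assms by (intro ennreal_leI powr_mono2) auto
  finally show ?thesis .
qed

text \<open>
  The product rule for mixed differences: the four terms take zero, one or two differences of the
  cut-offs, each of which contributes a factor \<open>8 * s\<close> or \<open>8 * t\<close>.
\<close>

lemma Lp_mass_diff2_localize_le:
  assumes p: "p > 1" and cont: "continuous_on UNIV d" and c: "cutoff c1" "cutoff c2"
    and nn: "a \<ge> 0" "b1 \<ge> 0" "b2 \<ge> 0" "n \<ge> 0" "s \<ge> 0" "t \<ge> 0"
    and le: "Lp_mass p (diff2 s t d) \<le> ennreal (a powr p)" "Lp_mass p (diff1 (s, 0) d) \<le> ennreal (b1 powr p)"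
      "Lp_mass p (diff1 (0, t) d) \<le> ennreal (b2 powr p)" "Lp_mass p d \<le> ennreal (n powr p)"
  shows "Lp_mass p (diff2 s t (localize d c1 c2)) \<le> ennreal ((4 * (a + 8 * t * b1 + 8 * s * b2 + 64 * s * t * n)) powr p)"
proof -
  have [measurable]: "d \<in> borel_measurable borel" using cont by (rule borel_measurable_continuous_onI)
  have [measurable]: "c1 \<in> borel_measurable borel" "c2 \<in> borel_measurable borel"
    using c by (auto simp: cutoff_def intro: borel_measurable_continuous_onI)
  define S where "S = a + 8 * t * b1 + 8 * s * b2 + 64 * s * t * n"
  have S: "1 * a \<le> S" "(8 * t) * b1 \<le> S" "(8 * s) * b2 \<le> S" "(64 * s * t) * n \<le> S" "S \<ge> 0"
    unfolding S_def using nn by (auto intro!: add_nonneg_nonneg mult_nonneg_nonneg simp: algebra_simps)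
  define F where "F = (\<lambda>i z. if i = (0::nat) then c1 (fst z + s) * c2 (snd z + t) * diff2 s t d z
     else if i = 1 then c1 (fst z + s) * (c2 (snd z + t) - c2 (snd z)) * diff1 (s, 0) d z
     else if i = 2 then (c1 (fst z + s) - c1 (fst z)) * c2 (snd z + t) * diff1 (0, t) d z
     else (c1 (fst z + s) - c1 (fst z)) * (c2 (snd z + t) - c2 (snd z)) * d z)"
  have [measurable]: "(fst :: real \<times> real \<Rightarrow> real) \<in> borel_measurable borel" "(snd :: real \<times> real \<Rightarrow> real) \<in> borel_measurable borel"
    by (auto intro!: borel_measurable_continuous_onI continuous_intros)
  have eq: "diff2 s t (localize d c1 c2) = (\<lambda>z. \<Sum>i\<in>{0, 1, 2, 3::nat}. F i z)"
    by (auto simp: fun_eq_iff F_def diff2_def diff1_def localize_def algebra_simps)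
  have c1: "\<bar>c1 u\<bar> \<le> 1" "\<bar>c2 u\<bar> \<le> 1" for u using c by (auto simp: cutoff_def)
  have c2: "\<bar>c1 (u + s) - c1 u\<bar> \<le> 8 * s" "\<bar>c2 (u + t) - c2 u\<bar> \<le> 8 * t" for u
    using c nn unfolding cutoff_def by (metis abs_of_nonneg add_diff_cancel_left')+
  have p0: "p > 0" using p by simp
  have k0: "0 \<le> (1::real)" "0 \<le> 8 * t" "0 \<le> 8 * s" "0 \<le> 64 * s * t" using nn by auto
  have meas: "diff2 s t d \<in> borel_measurable borel" "diff1 (s, 0) d \<in> borel_measurable borel"
    "diff1 (0, t) d \<in> borel_measurable borel" "d \<in> borel_measurable borel" by simp_all
  have "Lp_mass p (\<lambda>z. \<Sum>i\<in>{0, 1, 2, 3::nat}. F i z) \<le> ennreal ((real (card {0, 1, 2, 3::nat}) * S) powr p)"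
  proof (rule Lp_mass_sum_le)
    fix i :: nat assume "i \<in> {0, 1, 2, 3}"
    then consider "i = 0" | "i = 1" | "i = 2" | "i = 3" by auto
    then show "Lp_mass p (F i) \<le> ennreal (S powr p)"
    proof cases
      case 1
      have "\<bar>c1 (fst z + s)\<bar> * \<bar>c2 (snd z + t)\<bar> \<le> 1 * 1" for z :: "real \<times> real" by (intro mult_mono c1) auto
      from mult_right_mono[OF this abs_ge_zero]
      have "\<bar>F i z\<bar> \<le> (1) * \<bar>(diff2 s t d) z\<bar>" for z
        using 1 by (simp add: F_def abs_mult)
      from Lp_mass_le_scaled[OF p0 k0(1) nn(1) meas(1) this le(1) S(1)] show ?thesis .
    next
      case 2
      have "\<bar>c1 (fst z + s)\<bar> * \<bar>c2 (snd z + t) - c2 (snd z)\<bar> \<le> 1 * (8 * t)" for z :: "real \<times> real"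
        by (intro mult_mono c1 c2) auto
      from mult_right_mono[OF this abs_ge_zero]
      have "\<bar>F i z\<bar> \<le> (8 * t) * \<bar>(diff1 (s, 0) d) z\<bar>" for z
        using 2 by (simp add: F_def abs_mult)
      from Lp_mass_le_scaled[OF p0 k0(2) nn(2) meas(2) this le(2) S(2)] show ?thesis .
    next
      case 3
      have "\<bar>c1 (fst z + s) - c1 (fst z)\<bar> * \<bar>c2 (snd z + t)\<bar> \<le> (8 * s) * 1" for z :: "real \<times> real"
        using nn by (intro mult_mono c1 c2) auto
      from mult_right_mono[OF this abs_ge_zero]
      have "\<bar>F i z\<bar> \<le> (8 * s) * \<bar>(diff1 (0, t) d) z\<bar>" for z
        using 3 by (simp add: F_def abs_mult)
      from Lp_mass_le_scaled[OF p0 k0(3) nn(3) meas(3) this le(3) S(3)] show ?thesis .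
    next
      case 4
      have "\<bar>c1 (fst z + s) - c1 (fst z)\<bar> * \<bar>c2 (snd z + t) - c2 (snd z)\<bar> \<le> (8 * s) * (8 * t)" for z :: "real \<times> real"
        using nn by (intro mult_mono c2) auto
      from mult_right_mono[OF this abs_ge_zero]
      have "\<bar>F i z\<bar> \<le> (64 * s * t) * \<bar>(d) z\<bar>" for z
        using 4 by (simp add: F_def abs_mult mult.assoc)
      from Lp_mass_le_scaled[OF p0 k0(4) nn(4) meas(4) this le(4) S(4)] show ?thesis .
    qed
  next
    fix i show "F i \<in> borel_measurable borel" unfolding F_def by simp
  qed (use p S in auto)
  then show ?thesis unfolding eq S_def[symmetric] by simp
qed

lemma scaled_sum_add: "scaled_sum p (\<lambda>s t. v s t + w s t) N = scaled_sum p v N + scaled_sum p w N"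
  by (simp add: scaled_sum_def sum.distrib distrib_left)

lemma scaled_sum_diff: "scaled_sum p (\<lambda>s t. v s t - w s t) N = scaled_sum p v N - scaled_sum p w N"
  by (simp add: scaled_sum_def sum_subtractf right_diff_distrib)

lemma scaled_sum_cmult: "scaled_sum p (\<lambda>s t. c * w s t) N = c * scaled_sum p w N"
  by (simp add: scaled_sum_def sum_distrib_left mult_ac)

lemma scaled_sum_mult: "scaled_sum p (\<lambda>s t. a s * b t) N
   = (\<Sum>m<N. block_scale p m powr (- 1 / p) * a (block_scale p m)) * (\<Sum>m<N. block_scale p m powr (- 1 / p) * b (block_scale p m))"
  by (simp add: scaled_sum_def sum_product mult_ac)

lemma scaled_sum_swap: "scaled_sum p (\<lambda>s t. w t s) N = scaled_sum p w N"
  unfolding scaled_sum_def by (subst sum.swap) (simp add: mult_ac)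

lemma scaled_sum_mono:
  assumes "\<And>s t. s \<in> {0<..1} \<Longrightarrow> t \<in> {0<..1} \<Longrightarrow> v s t \<le> w s t" "p > 1"
  shows "scaled_sum p v N \<le> scaled_sum p w N"
  unfolding scaled_sum_def
  using assms block_scale_pos block_scale_le_1 by (intro sum_mono mult_left_mono assms) auto

lemma scaled_sum_mono_N:
  assumes "\<And>s t. s \<in> {0<..1} \<Longrightarrow> t \<in> {0<..1} \<Longrightarrow> 0 \<le> w s t" "p > 1" "M \<le> N"
  shows "scaled_sum p w M \<le> scaled_sum p w N"
proof -
  have nn: "0 \<le> scaled_term p w m n" for m n
    using assms block_scale_pos[of p] block_scale_le_1[of p] by simp
  have "scaled_sum p w M \<le> (\<Sum>m<M. \<Sum>n<N. scaled_term p w m n)"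
    unfolding scaled_sum_def using nn assms(3) by (intro sum_mono sum_mono2) auto
  also have "\<dots> \<le> scaled_sum p w N"
    unfolding scaled_sum_def using nn assms(3) by (intro sum_mono2 sum_nonneg) auto
  finally show ?thesis .
qed

text \<open>
  \<open>h powr (1 - 1 / p)\<close> at least halves from each scale to the next.
\<close>

lemma sum_scaled_id_le:
  assumes p: "p > 1"
  shows "(\<Sum>m<N. block_scale p m powr (- 1 / p) * block_scale p m) \<le> 2"
proof -
  have "block_scale p m powr (- 1 / p) * block_scale p m \<le> (1 / 2) ^ m" for m
  proof -
    have r: "1 \<le> scale_rate p * ((p - 1) / p)" using p by (simp add: scale_rate_def)
    have "block_scale p m powr (- 1 / p) * block_scale p m = block_scale p m powr ((p - 1) / p)"
      using p powr_add[of "block_scale p m" "- 1 / p" 1] block_scale_pos[of p m] by (simp add: diff_divide_distrib)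
    also have "\<dots> = 1 / 2 powr (scale_rate p * ((p - 1) / p) * real m)"
      unfolding block_scale_def by (simp add: powr_divide powr_powr mult_ac)
    also have "\<dots> \<le> 1 / 2 powr (1 * real m)"
      using mult_right_mono[OF r, of "real m"] by (intro divide_left_mono powr_mono) auto
    also have "\<dots> = (1 / 2) ^ m" by (simp add: powr_realpow power_one_over)
    finally show ?thesis .
  qed
  then have "(\<Sum>m<N. block_scale p m powr (- 1 / p) * block_scale p m) \<le> (\<Sum>m<N. (1 / 2) ^ m)"
    by (rule sum_mono)
  also have "\<dots> = 2 - 2 * (1 / 2 :: real) ^ N" by (induction N) simp_all
  also have "\<dots> \<le> 2" by simp
  finally show ?thesis .
qed

text \<open>
  Dominated convergence for the double sum: the tail is small uniformly in \<open>\<eta>\<close> because it is dominated by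
  that of \<open>w\<close>, and the finitely many remaining terms are at most a multiple of \<open>\<eta>\<close>.
\<close>

lemma scaled_sum_min_small:
  assumes p: "p > 1" and w: "\<And>s t. s \<in> {0<..1} \<Longrightarrow> t \<in> {0<..1} \<Longrightarrow> 0 \<le> w s t"
    and bdd: "\<And>N. scaled_sum p w N \<le> B" and e: "e > 0"
  obtains \<eta> where "\<eta> > 0" "\<And>N. scaled_sum p (\<lambda>s t. min (w s t) (4 * \<eta>)) N \<le> e"
proof -
  define L where "L = (SUP N. scaled_sum p w N)"
  have bd: "bdd_above (range (scaled_sum p w))" using bdd by (auto intro!: bdd_aboveI[of _ B])
  have "L - e / 2 < L" using e by simp
  then obtain M where M: "L - e / 2 < scaled_sum p w M"
    unfolding L_def using bd by (subst (asm) less_cSUP_iff) auto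
  define K where "K = scaled_sum p (\<lambda>_ _. 1) M"
  have K: "K \<ge> 0" unfolding K_def scaled_sum_def by (intro sum_nonneg) auto
  define \<eta> where "\<eta> = e / (8 * (K + 1))"
  have \<eta>: "\<eta> > 0" using e K by (simp add: \<eta>_def)
  let ?v = "\<lambda>s t. min (w s t) (4 * \<eta>)"
  have small: "scaled_sum p ?v M \<le> e / 2"
  proof -
    have "scaled_sum p ?v M \<le> scaled_sum p (\<lambda>s t. (4 * \<eta>) * 1) M" by (intro scaled_sum_mono p) auto
    also have "\<dots> = 4 * \<eta> * K" unfolding K_def by (rule scaled_sum_cmult)
    also have "\<dots> \<le> e / 2" using e K by (simp add: \<eta>_def field_simps)
    finally show ?thesis .
  qed
  have "scaled_sum p ?v N \<le> e" for N
  proof -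
    let ?N = "max M N"
    have "scaled_sum p ?v N \<le> scaled_sum p ?v ?N"
      using w \<eta> by (intro scaled_sum_mono_N p) (auto simp: less_imp_le)
    moreover have "scaled_sum p (\<lambda>s t. w s t - ?v s t) M \<le> scaled_sum p (\<lambda>s t. w s t - ?v s t) ?N"
      by (intro scaled_sum_mono_N p) auto
    moreover have "scaled_sum p w ?N \<le> L" unfolding L_def using bd by (rule cSUP_upper2) auto
    ultimately show ?thesis using small M unfolding scaled_sum_diff by linarith
  qed
  then show ?thesis using \<eta> that by blast
qed

lemma quasi_modulus_min:
  assumes w: "quasi_modulus w" and c: "c \<ge> 0"
  shows "quasi_modulus (\<lambda>s t. min (w s t) c)"
proof -
  have aux: "min x c \<le> k * min y c" if "x \<le> k * y" "1 \<le> k" for x y k :: real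
  proof (cases "y \<le> c")
    case False
    have "c \<le> k * c" using that c by (simp add: mult_right_mono[of 1 k c, simplified])
    then show ?thesis using False by simp
  qed (use that in auto)
  show ?thesis
    unfolding quasi_modulus_def
  proof (intro conjI ballI)
    fix s t s' :: real assume "s \<in> {0<..1}" "t \<in> {0..1}" "s' \<in> {s..1}"
    then show "min (w s' t) c \<le> 2 * s' / s * min (w s t) c"
      using w by (intro aux) (auto simp: quasi_modulus_def)
  next
    fix s t t' :: real assume "s \<in> {0..1}" "t \<in> {0<..1}" "t' \<in> {t..1}"
    then show "min (w s t') c \<le> 2 * t' / t * min (w s t) c"
      using w by (intro aux) (auto simp: quasi_modulus_def)
  qed (use w c in \<open>auto simp: quasi_modulus_def min_le_iff_disj\<close>)
qed

lemma quasi_modulus_swap: "quasi_modulus w \<Longrightarrow> quasi_modulus (\<lambda>s t. w t s)"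
  unfolding quasi_modulus_def by auto

text \<open>
  The cosine centred at \<open>a\<close> equals \<open>1\<close> at \<open>a\<close> and \<open>0\<close> at \<open>a + 1 / 4\<close>.  Hence a mixed increment over a cell
  with side \<open>[a, a + 1 / 4]\<close> only sees the values at \<open>a\<close>.
\<close>

lemma period_partition_quarter: "period_partition 2 (\<lambda>k. if k = 0 then a else if k = 1 then a + 1 / 4 else a + 1)"
  by (auto simp: period_partition_def less_Suc_eq numeral_2_eq_2)

lemma p_var_row_le:
  assumes p: "p > 1" and B: "B \<ge> 0"
    and nv: "net_variation_le p (localize d (\<lambda>x. cos (2 * pi * (x - a))) (\<lambda>_. 1)) B"
  shows "p_var p (\<lambda>y. d (a, y)) \<le> ennreal B"
  unfolding p_var_def
proof (rule SUP_least, clarify)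
  fix n y assume y: "period_partition n y"
  let ?D = "localize d (\<lambda>x. cos (2 * pi * (x - a))) (\<lambda>_. 1)"
  let ?x = "\<lambda>k::nat. if k = 0 then a else if k = 1 then a + 1 / 4 else a + 1"
  have c0: "cos (2 * pi * (a + 1 / 4 - a)) = 0" by (simp add: cos_pi_half)
  have "(\<Sum>k<(2::nat). \<Sum>j<n. \<bar>cell_diff ?D (?x k) (?x (Suc k)) (y j) (y (Suc j))\<bar> powr p) \<le> B powr p"
    using nv[unfolded net_variation_le_def, rule_format, of 2 ?x "\<lambda>_. n" "\<lambda>_. y"] period_partition_quarter[of a] y by simp
  moreover have "(\<Sum>j<n. \<bar>d (a, y (Suc j)) - d (a, y j)\<bar> powr p)
      \<le> (\<Sum>k<(2::nat). \<Sum>j<n. \<bar>cell_diff ?D (?x k) (?x (Suc k)) (y j) (y (Suc j))\<bar> powr p)"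
  proof -
    have "(\<Sum>j<n. \<bar>d (a, y (Suc j)) - d (a, y j)\<bar> powr p)
       = (\<Sum>j<n. \<bar>cell_diff ?D (?x 0) (?x (Suc 0)) (y j) (y (Suc j))\<bar> powr p)"
      using c0 by (intro sum.cong refl) (simp add: cell_diff_def localize_def abs_minus_commute)
    also have "\<dots> \<le> (\<Sum>k<(2::nat). \<Sum>j<n. \<bar>cell_diff ?D (?x k) (?x (Suc k)) (y j) (y (Suc j))\<bar> powr p)"
      by (rule member_le_sum[of 0 "{..<2::nat}"]) (auto intro!: sum_nonneg)
    finally show ?thesis .
  qed
  ultimately have "(\<Sum>j<n. \<bar>d (a, y (Suc j)) - d (a, y j)\<bar> powr p) \<le> B powr p" by linarith
  then have "(\<Sum>j<n. \<bar>d (a, y (Suc j)) - d (a, y j)\<bar> powr p) powr (1 / p) \<le> (B powr p) powr (1 / p)"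
    using p by (intro powr_mono2 sum_nonneg) auto
  then show "ennreal ((\<Sum>k<n. \<bar>d (a, y (Suc k)) - d (a, y k)\<bar> powr p) powr (1 / p)) \<le> ennreal B"
    using p B by (simp add: powr_powr ennreal_leI)
qed

lemma p_var_column_le:
  assumes p: "p > 1" and B: "B \<ge> 0"
    and nv: "net_variation_le p (localize d (\<lambda>_. 1) (\<lambda>y. cos (2 * pi * (y - b)))) B"
  shows "p_var p (\<lambda>x. d (x, b)) \<le> ennreal B"
  unfolding p_var_def
proof (rule SUP_least, clarify)
  fix n x assume x: "period_partition n x"
  let ?D = "localize d (\<lambda>_. 1) (\<lambda>y. cos (2 * pi * (y - b)))"
  let ?y = "\<lambda>k::nat. if k = 0 then b else if k = 1 then b + 1 / 4 else b + 1"
  have c0: "cos (2 * pi * (b + 1 / 4 - b)) = 0" by (simp add: cos_pi_half)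
  have "(\<Sum>k<n. \<Sum>j<(2::nat). \<bar>cell_diff ?D (x k) (x (Suc k)) (?y j) (?y (Suc j))\<bar> powr p) \<le> B powr p"
    using nv[unfolded net_variation_le_def, rule_format, of n x "\<lambda>_. 2" "\<lambda>_. ?y"] period_partition_quarter[of b] x by simp
  moreover have "(\<Sum>k<n. \<bar>d (x (Suc k), b) - d (x k, b)\<bar> powr p)
      \<le> (\<Sum>k<n. \<Sum>j<(2::nat). \<bar>cell_diff ?D (x k) (x (Suc k)) (?y j) (?y (Suc j))\<bar> powr p)"
  proof (rule sum_mono)
    fix k
    have "\<bar>d (x (Suc k), b) - d (x k, b)\<bar> powr p = \<bar>cell_diff ?D (x k) (x (Suc k)) (?y 0) (?y (Suc 0))\<bar> powr p"
      using c0 by (simp add: cell_diff_def localize_def abs_minus_commute)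
    also have "\<dots> \<le> (\<Sum>j<(2::nat). \<bar>cell_diff ?D (x k) (x (Suc k)) (?y j) (?y (Suc j))\<bar> powr p)"
      by (rule member_le_sum[of 0 "{..<2::nat}"]) auto
    finally show "\<bar>d (x (Suc k), b) - d (x k, b)\<bar> powr p \<le> (\<Sum>j<(2::nat). \<bar>cell_diff ?D (x k) (x (Suc k)) (?y j) (?y (Suc j))\<bar> powr p)" .
  qed
  ultimately have "(\<Sum>k<n. \<bar>d (x (Suc k), b) - d (x k, b)\<bar> powr p) \<le> B powr p" by linarith
  then have "(\<Sum>k<n. \<bar>d (x (Suc k), b) - d (x k, b)\<bar> powr p) powr (1 / p) \<le> (B powr p) powr (1 / p)"
    using p by (intro powr_mono2 sum_nonneg) auto
  then show "ennreal ((\<Sum>k<n. \<bar>d (x (Suc k), b) - d (x k, b)\<bar> powr p) powr (1 / p)) \<le> ennreal B"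
    using p B by (simp add: powr_powr ennreal_leI)
qed

lemma abs_value_le:
  assumes p: "p > 1" and B: "B \<ge> 0"
    and nv: "net_variation_le p (localize d (\<lambda>x. cos (2 * pi * (x - a))) (\<lambda>y. cos (2 * pi * (y - b)))) B"
  shows "\<bar>d (a, b)\<bar> \<le> B"
proof -
  let ?D = "localize d (\<lambda>x. cos (2 * pi * (x - a))) (\<lambda>y. cos (2 * pi * (y - b)))"
  let ?q = "\<lambda>a (k::nat). if k = 0 then a else if k = 1 then a + 1 / 4 else a + 1"
  have c0: "cos (2 * pi * (u + 1 / 4 - u)) = 0" for u by (simp add: cos_pi_half)
  have "(\<Sum>k<(2::nat). \<Sum>j<(2::nat). \<bar>cell_diff ?D (?q a k) (?q a (Suc k)) (?q b j) (?q b (Suc j))\<bar> powr p) \<le> B powr p"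
    using nv[unfolded net_variation_le_def, rule_format, of 2 "?q a" "\<lambda>_. 2" "\<lambda>_. ?q b"] period_partition_quarter by simp
  moreover have "\<bar>d (a, b)\<bar> powr p \<le> (\<Sum>k<(2::nat). \<Sum>j<(2::nat). \<bar>cell_diff ?D (?q a k) (?q a (Suc k)) (?q b j) (?q b (Suc j))\<bar> powr p)"
  proof -
    have "\<bar>d (a, b)\<bar> powr p = \<bar>cell_diff ?D (?q a 0) (?q a (Suc 0)) (?q b 0) (?q b (Suc 0))\<bar> powr p"
      using c0[of a] c0[of b] by (simp add: cell_diff_def localize_def)
    also have "\<dots> \<le> (\<Sum>j<(2::nat). \<bar>cell_diff ?D (?q a 0) (?q a (Suc 0)) (?q b j) (?q b (Suc j))\<bar> powr p)"
      by (rule member_le_sum[of 0 "{..<2::nat}"]) auto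
    also have "\<dots> \<le> (\<Sum>k<(2::nat). \<Sum>j<(2::nat). \<bar>cell_diff ?D (?q a k) (?q a (Suc k)) (?q b j) (?q b (Suc j))\<bar> powr p)"
      by (rule member_le_sum[of 0 "{..<2::nat}"]) (auto intro!: sum_nonneg)
    finally show ?thesis .
  qed
  ultimately have "\<bar>d (a, b)\<bar> powr p \<le> B powr p" by linarith
  then show ?thesis using powr_less_mono2[of p B "\<bar>d (a, b)\<bar>"] p B by linarith
qed

section \<open>Smoothing by averages over squares\<close>

definition unit_square :: "(real \<times> real) measure" where
  "unit_square = restrict_space lborel (cbox (0, 0) (1, 1))"

lemma emeasure_unit_square: "emeasure unit_square (space unit_square) = 1"
proof -
  have "emeasure lborel (cbox (0, 0) (1, 1 :: real) :: (real \<times> real) set) = 1"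
    by (subst emeasure_lborel_cbox) (auto simp: Basis_prod_def)
  then show ?thesis
    by (simp add: unit_square_def space_restrict_space emeasure_restrict_space)
qed

lemma finite_measure_unit_square: "finite_measure unit_square"
  by (rule finite_measureI) (simp add: emeasure_unit_square)

lemma measurable_unit_square: "f \<in> borel_measurable borel \<Longrightarrow> f \<in> borel_measurable unit_square"
  unfolding unit_square_def by (simp add: measurable_restrict_space1)

lemma nn_integral_unit_square:
  assumes [measurable]: "\<Phi> \<in> borel_measurable borel"
  shows "(\<integral>\<^sup>+z. \<Phi> z \<partial>unit_square) = unit_integral \<Phi>"
proof -
  have [measurable]: "\<Phi> \<in> borel_measurable (borel \<Otimes>\<^sub>M borel)" by (simp add: borel_prod)
  have "(\<integral>\<^sup>+z. \<Phi> z \<partial>unit_square) = (\<integral>\<^sup>+z. \<Phi> z * indicator ({0..1} \<times> {0..1}) z \<partial>(lborel \<Otimes>\<^sub>M lborel))"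
    unfolding unit_square_def
    by (subst nn_integral_restrict_space) (auto simp: lborel_prod cbox_Pair_eq intro!: borel_closed closed_Times)
  also have "\<dots> = (\<integral>\<^sup>+y. (\<integral>\<^sup>+x. \<Phi> (x, y) * indicator ({0..1} \<times> {0..1}) (x, y) \<partial>lborel) \<partial>lborel)"
    by (intro lborel_pair.nn_integral_snd[symmetric]) measurable
  also have "\<dots> = unit_integral \<Phi>"
    unfolding unit_integral_def
    by (intro nn_integral_cong) (simp add: indicator_times mult.assoc[symmetric] nn_integral_multc)
  finally show ?thesis .
qed

definition smooth :: "real \<Rightarrow> (real \<times> real \<Rightarrow> real) \<Rightarrow> real \<times> real \<Rightarrow> real" where
  "smooth e F z = (\<integral>w. F (z + e *\<^sub>R w) \<partial>unit_square)"

lemma smooth_powr_le: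
  assumes p: "p \<ge> 1" and [measurable]: "F \<in> borel_measurable borel"
  shows "ennreal (\<bar>smooth e F z\<bar> powr p) \<le> unit_integral (\<lambda>w. ennreal (\<bar>F (z + e *\<^sub>R w)\<bar> powr p))"
proof -
  have [measurable]: "(\<lambda>w. F (z + e *\<^sub>R w)) \<in> borel_measurable borel" by measurable
  have "ennreal (\<bar>smooth e F z\<bar> powr p) \<le> (\<integral>\<^sup>+w. ennreal (\<bar>F (z + e *\<^sub>R w)\<bar> powr p) \<partial>unit_square)"
    unfolding smooth_def by (intro jensen_powr p emeasure_unit_square measurable_unit_square) simp
  then show ?thesis by (simp add: nn_integral_unit_square)
qed

text \<open>
  Jensen's inequality and the translation invariance of the norm on periodic functions.
\<close>

lemma Lp_mass_smooth_le:
  assumes p: "p \<ge> 1" and F [measurable]: "F \<in> borel_measurable borel" and per: "periodic2 F"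
    and le: "Lp_mass p F \<le> C" and sm: "smooth e F \<in> borel_measurable borel"
  shows "Lp_mass p (smooth e F) \<le> C"
proof -
  interpret U: finite_measure unit_square by (rule finite_measure_unit_square)
  interpret UU: pair_sigma_finite unit_square unit_square ..
  have sets: "sets unit_square = sets (restrict_space borel (cbox (0, 0) (1, 1)))"
    unfolding unit_square_def by (simp cong: sets_restrict_space_cong)
  have [measurable]: "(\<lambda>z. z) \<in> measurable unit_square borel"
    by (rule measurable_unit_square) simp
  have [measurable]: "(\<lambda>(z, w). ennreal (\<bar>F (z + e *\<^sub>R w)\<bar> powr p)) \<in> borel_measurable (unit_square \<Otimes>\<^sub>M unit_square)"
    by measurable
  have "Lp_mass p (smooth e F) = (\<integral>\<^sup>+z. ennreal (\<bar>smooth e F z\<bar> powr p) \<partial>unit_square)"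
    unfolding Lp_mass_def using sm by (subst nn_integral_unit_square) auto
  also have "\<dots> \<le> (\<integral>\<^sup>+z. (\<integral>\<^sup>+w. ennreal (\<bar>F (z + e *\<^sub>R w)\<bar> powr p) \<partial>unit_square) \<partial>unit_square)"
    using smooth_powr_le[OF p F] by (intro nn_integral_mono) (simp add: nn_integral_unit_square)
  also have "\<dots> = (\<integral>\<^sup>+w. (\<integral>\<^sup>+z. ennreal (\<bar>F (z + e *\<^sub>R w)\<bar> powr p) \<partial>unit_square) \<partial>unit_square)"
    by (intro UU.Fubini') measurable
  also have "\<dots> = (\<integral>\<^sup>+w. Lp_mass p F \<partial>unit_square)"
  proof (intro nn_integral_cong)
    fix w
    have "(\<integral>\<^sup>+z. ennreal (\<bar>F (z + e *\<^sub>R w)\<bar> powr p) \<partial>unit_square) = Lp_mass p (\<lambda>z. F (z + e *\<^sub>R w))"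
      unfolding Lp_mass_def by (rule nn_integral_unit_square) measurable
    then show "(\<integral>\<^sup>+z. ennreal (\<bar>F (z + e *\<^sub>R w)\<bar> powr p) \<partial>unit_square) = Lp_mass p F"
      by (simp add: Lp_mass_translate[OF F per])
  qed
  also have "\<dots> = Lp_mass p F" by (simp add: emeasure_unit_square)
  finally show ?thesis using le by simp
qed

lemma unit_integral_scale_le:
  assumes [measurable]: "\<Phi> \<in> borel_measurable borel"
    and per: "\<And>x y. \<Phi> (x + 1, y) = \<Phi> (x, y)" "\<And>x y. \<Phi> (x, y + 1) = \<Phi> (x, y)"
    and e: "0 < e" "e \<le> 1"
  shows "unit_integral (\<lambda>w. \<Phi> (z + e *\<^sub>R w)) \<le> ennreal (1 / e) * (ennreal (1 / e) * unit_integral \<Phi>)"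
proof -
  have [measurable]: "\<Phi> \<in> borel_measurable (borel \<Otimes>\<^sub>M borel)" by (simp add: borel_prod)
  have one: "(\<integral>\<^sup>+x\<in>{0..1}. \<phi> (a + e * x) \<partial>lborel) \<le> ennreal (1 / e) * (\<integral>\<^sup>+x\<in>{0..1}. \<phi> x \<partial>lborel)"
    if [measurable]: "\<phi> \<in> borel_measurable borel" and "\<And>x. \<phi> (x + 1) = \<phi> x" for \<phi> :: "real \<Rightarrow> ennreal" and a
  proof -
    have "ennreal e * (\<integral>\<^sup>+x\<in>{0..1}. \<phi> (a + e * x) \<partial>lborel)
        \<le> ennreal e * (\<integral>\<^sup>+x. \<phi> (a + e * x) * indicator {a..a + 1} (a + e * x) \<partial>lborel)"
      using e by (intro mult_left_mono nn_integral_mono) (auto simp: indicator_def mult_le_one)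
    also have "\<dots> = (\<integral>\<^sup>+x\<in>{a..a + 1}. \<phi> x \<partial>lborel)"
      using e by (subst nn_integral_real_affine[of "\<lambda>x. \<phi> x * indicator {a..a + 1} x" e a]) auto
    also have "\<dots> = (\<integral>\<^sup>+x\<in>{0..1}. \<phi> x \<partial>lborel)"
      using that by (intro nn_integral_period) auto
    finally have "ennreal e * (\<integral>\<^sup>+x\<in>{0..1}. \<phi> (a + e * x) \<partial>lborel) \<le> (\<integral>\<^sup>+x\<in>{0..1}. \<phi> x \<partial>lborel)" .
    then have "ennreal (1 / e) * (ennreal e * (\<integral>\<^sup>+x\<in>{0..1}. \<phi> (a + e * x) \<partial>lborel)) \<le> ennreal (1 / e) * (\<integral>\<^sup>+x\<in>{0..1}. \<phi> x \<partial>lborel)"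
      by (rule mult_left_mono) simp
    moreover have "ennreal (1 / e) * ennreal e = 1" using e by (simp flip: ennreal_mult')
    ultimately show ?thesis by (simp add: mult.assoc[symmetric])
  qed
  obtain a b where z: "z = (a, b)" by (cases z)
  have "unit_integral (\<lambda>w. \<Phi> (z + e *\<^sub>R w)) = (\<integral>\<^sup>+y\<in>{0..1}. (\<integral>\<^sup>+x\<in>{0..1}. \<Phi> (a + e * x, b + e * y) \<partial>lborel) \<partial>lborel)"
    unfolding unit_integral_def z by simp
  also have "\<dots> \<le> (\<integral>\<^sup>+y\<in>{0..1}. (ennreal (1 / e) * (\<integral>\<^sup>+x\<in>{0..1}. \<Phi> (x, b + e * y) \<partial>lborel)) \<partial>lborel)"
    using per by (intro nn_integral_mono mult_right_mono one) auto
  also have "\<dots> = ennreal (1 / e) * (\<integral>\<^sup>+y\<in>{0..1}. (\<integral>\<^sup>+x\<in>{0..1}. \<Phi> (x, b + e * y) \<partial>lborel) \<partial>lborel)"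
    by (simp add: nn_integral_cmult mult.assoc)
  also have "\<dots> \<le> ennreal (1 / e) * (ennreal (1 / e) * unit_integral \<Phi>)"
    unfolding unit_integral_def
    using per one[of "\<lambda>y. \<integral>\<^sup>+x\<in>{0..1}. \<Phi> (x, y) \<partial>lborel" b] by (intro mult_left_mono) auto
  finally show ?thesis .
qed

context Lp_borel
begin

lemma smooth_powr_le_mass:
  assumes [measurable]: "F \<in> borel_measurable borel" and perF: "periodic2 F" and e: "0 < e" "e \<le> 1"
  shows "ennreal (\<bar>smooth e F z\<bar> powr p) \<le> ennreal (1 / e) * (ennreal (1 / e) * Lp_mass p F)"
    and "unit_integral (\<lambda>w. ennreal (\<bar>F (z + e *\<^sub>R w)\<bar> powr p)) \<le> ennreal (1 / e) * (ennreal (1 / e) * Lp_mass p F)"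
proof -
  show *: "unit_integral (\<lambda>w. ennreal (\<bar>F (z + e *\<^sub>R w)\<bar> powr p)) \<le> ennreal (1 / e) * (ennreal (1 / e) * Lp_mass p F)"
    unfolding Lp_mass_def using perF
    by (intro unit_integral_scale_le[where \<Phi>="\<lambda>z. ennreal (\<bar>F z\<bar> powr p)"] e) (auto simp: periodic2_def periodic1_def)
  show "ennreal (\<bar>smooth e F z\<bar> powr p) \<le> ennreal (1 / e) * (ennreal (1 / e) * Lp_mass p F)"
    using smooth_powr_le[OF p1, of F e z] * by (auto intro: order_trans)
qed

lemma integrable_translate:
  assumes e: "0 < e" "e \<le> 1"
  shows "integrable unit_square (\<lambda>w. f (z + e *\<^sub>R w))"
proof -
  interpret U: finite_measure unit_square by (rule finite_measure_unit_square)
  have [measurable]: "(\<lambda>w. f (z + e *\<^sub>R w)) \<in> borel_measurable borel" by measurable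
  have fin: "unit_integral (\<lambda>w. ennreal (\<bar>f (z + e *\<^sub>R w)\<bar> powr p)) < \<infinity>"
  proof -
    have "Lp_mass p f < top" using mass by (rule order.strict_trans1) simp
    then have "ennreal (1 / e) * (ennreal (1 / e) * Lp_mass p f) < \<infinity>"
      by (simp add: ennreal_mult_less_top)
    then show ?thesis using smooth_powr_le_mass(2)[OF f per e, of z] by (rule order.strict_trans1[rotated])
  qed
  have "(\<integral>\<^sup>+w. ennreal (norm (f (z + e *\<^sub>R w))) \<partial>unit_square) \<le> (\<integral>\<^sup>+w. 1 + ennreal (\<bar>f (z + e *\<^sub>R w)\<bar> powr p) \<partial>unit_square)"
  proof (rule nn_integral_mono)
    fix w
    let ?a = "\<bar>f (z + e *\<^sub>R w)\<bar>"
    have "?a \<le> 1 + ?a powr p"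
    proof (cases "?a \<le> 1")
      case False
      then have "?a powr 1 \<le> ?a powr p" using p1 by (intro powr_mono) auto
      then show ?thesis using False by simp
    qed (simp add: add_increasing2)
    then show "ennreal (norm (f (z + e *\<^sub>R w))) \<le> 1 + ennreal (?a powr p)"
      by (metis ennreal_1 ennreal_leI ennreal_plus powr_ge_zero real_norm_def zero_le_one)
  qed
  also have "\<dots> = 1 + unit_integral (\<lambda>w. ennreal (\<bar>f (z + e *\<^sub>R w)\<bar> powr p))"
    by (subst nn_integral_add) (auto simp: emeasure_unit_square nn_integral_unit_square intro!: measurable_unit_square)
  also have "\<dots> < \<infinity>" using fin by (simp add: ennreal_add_less_top)
  finally show ?thesis by (intro integrableI_bounded measurable_unit_square) auto
qed

lemma smooth_diff1:
  assumes e: "0 < e" "e \<le> 1"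
  shows "diff1 h (smooth e f) = smooth e (diff1 h f)"
proof
  fix z
  have eq: "z + e *\<^sub>R w + h = z + h + e *\<^sub>R w" for w by (simp add: algebra_simps)
  show "diff1 h (smooth e f) z = smooth e (diff1 h f) z"
    unfolding diff1_def smooth_def eq
    by (rule Bochner_Integration.integral_diff[OF integrable_translate[OF e] integrable_translate[OF e], symmetric])
qed

lemma smooth_periodic:
  shows "periodic2 (smooth e f)"
  unfolding periodic2_iff
proof (intro allI conjI)
  fix z :: "real \<times> real"
  have period: "f (u + (1, 0)) = f u" "f (u + (0, 1)) = f u" for u
    using per unfolding periodic2_iff by blast+
  have eq: "z + (1, 0) + e *\<^sub>R w = (z + e *\<^sub>R w) + (1, 0)" "z + (0, 1) + e *\<^sub>R w = (z + e *\<^sub>R w) + (0, 1)" for w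
    by (simp_all add: algebra_simps)
  show "smooth e f (z + (1, 0)) = smooth e f z" "smooth e f (z + (0, 1)) = smooth e f z"
    unfolding smooth_def eq period by (rule refl)+
qed

lemma Lp_borel_diff1: "Lp_borel p (diff1 h f) (2 * n)"
  using p per n Lp_mass_diff1_le[OF p1 n f per mass] by unfold_locales (auto intro: periodic2_diff1)

end

text \<open>
  Bounds for the sums over scales of \<open>\<omega>(f; \<cdot>)\<^sub>p\<close> and of \<open>\<omega>(f; \<cdot>, \<cdot>)\<^sub>p\<close>, which follow from the finiteness
  of \<open>J\<^sub>p(f)\<close> and \<open>I\<^sub>p(f)\<close>.
\<close>

locale Lp_embedding = Lp_borel +
  fixes B1 B2 :: real
  assumes B1: "\<And>N. (\<Sum>m<N. block_scale p m powr (- 1 / p) * modulus_real p f (block_scale p m)) \<le> B1"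
    and B2: "\<And>N. scaled_sum p (mixed_real p f) N \<le> B2"
begin

lemma modulus_real_tendsto: "(\<lambda>m. modulus_real p f (block_scale p m)) \<longlonglongrightarrow> 0"
proof (rule tendsto_sandwich[of "\<lambda>_. 0" _ _ "\<lambda>m. B1 * block_scale p m powr (1 / p)"])
  let ?h = "block_scale p"
  have "modulus_real p f (?h m) \<le> B1 * ?h m powr (1 / p)" for m
  proof -
    have "?h m powr (- 1 / p) * modulus_real p f (?h m) \<le> (\<Sum>m<Suc m. ?h m powr (- 1 / p) * modulus_real p f (?h m))"
      by (rule member_le_sum[of m "{..<Suc m}"]) (auto simp: modulus_real_nonneg)
    also have "\<dots> \<le> B1" by (rule B1)
    finally have "?h m powr (1 / p) * (?h m powr (- 1 / p) * modulus_real p f (?h m)) \<le> ?h m powr (1 / p) * B1"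
      by (rule mult_left_mono) simp
    moreover have "?h m powr (1 / p) * ?h m powr (- 1 / p) = 1"
      using block_scale_pos[of p m] by (simp flip: powr_add)
    ultimately show ?thesis by (simp only: mult.assoc[symmetric] mult_1 mult.commute[of B1])
  qed
  then show "\<forall>\<^sub>F m in sequentially. modulus_real p f (?h m) \<le> B1 * ?h m powr (1 / p)"
    by (intro always_eventually) auto
  have "(\<lambda>m. ?h m powr (1 / p)) \<longlonglongrightarrow> 0 powr (1 / p)"
    using block_scale_tendsto_0[OF p] p0
    by (intro tendsto_powr') (auto intro!: always_eventually simp: block_scale_pos less_imp_le)
  then show "(\<lambda>m. B1 * ?h m powr (1 / p)) \<longlonglongrightarrow> 0"
    using tendsto_mult_left[of _ 0 sequentially B1] by simp
qed (auto simp: modulus_real_nonneg)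

lemma modulus_real_small:
  assumes "c > 0"
  obtains \<delta> where "\<delta> > 0" "\<And>t. t \<le> \<delta> \<Longrightarrow> modulus_real p f t < c"
proof -
  obtain m where m: "modulus_real p f (block_scale p m) < c"
    using order_tendstoD(2)[OF modulus_real_tendsto assms] by (auto simp: eventually_sequentially)
  show ?thesis
    using that[of "block_scale p m"] block_scale_pos m modulus_real_mono le_less_trans by blast
qed

text \<open>
  By Jensen's inequality the increment of the average along \<open>h\<close> is bounded by a multiple, depending on
  \<open>e\<close>, of \<open>\<omega>(f; \<bar>h\<bar>)\<^sub>p\<close>, which tends to \<open>0\<close>.
\<close>

lemma smooth_continuous:
  assumes e: "0 < e" "e \<le> 1"
  shows "continuous_on UNIV (smooth e f)"
  unfolding continuous_on_iff
proof (intro ballI allI impI)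
  fix z :: "real \<times> real" and c :: real assume c: "c > 0"
  \<comment> \<open>Jensen over a square of side \<open>e\<close> costs \<open>1 / e\<^sup>2\<close>, which is at most its \<open>p\<close>-th power.\<close>
  obtain \<delta> where \<delta>: "\<delta> > 0" "\<And>t. t \<le> \<delta> \<Longrightarrow> modulus_real p f t < e * (e * c)"
    using modulus_real_small[of "e * (e * c)"] e c by auto
  show "\<exists>d>0. \<forall>x'\<in>UNIV. dist x' z < d \<longrightarrow> dist (smooth e f x') (smooth e f z) < c"
  proof (intro exI[of _ \<delta>] conjI ballI impI \<delta>(1))
    fix z' assume z': "dist z' z < \<delta>"
    define h where "h = z' - z"
    have h: "norm h \<le> \<delta>" using z' by (simp add: h_def dist_norm)
    let ?M = "modulus_real p f (norm h)"
    have "ennreal (\<bar>smooth e (diff1 h f) z\<bar> powr p) \<le> ennreal (1 / e) * (ennreal (1 / e) * Lp_mass p (diff1 h f))"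
      by (rule smooth_powr_le_mass[OF diff1_measurable[OF f] periodic2_diff1[OF per] e])
    also have "\<dots> \<le> ennreal (1 / e) * (ennreal (1 / e) * ennreal (?M powr p))"
      by (intro mult_left_mono Lp_mass_diff1_modulus) auto
    also have "\<dots> = ennreal (1 / e * (1 / e * ?M powr p))"
    proof -
      have "0 \<le> 1 / e" using e by simp
      then show ?thesis by (simp only: ennreal_mult')
    qed
    finally have "\<bar>smooth e (diff1 h f) z\<bar> powr p \<le> 1 / e * (1 / e * ?M powr p)"
      using e by (subst (asm) ennreal_le_iff) auto
    also have "\<dots> \<le> (1 / e) powr p * ((1 / e) powr p * ?M powr p)"
      using e p1 powr_mono[of 1 p "1 / e"] by (intro mult_mono) auto
    also have "\<dots> = (1 / e * (1 / e * ?M)) powr p" by (simp only: powr_mult)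
    finally have "\<bar>smooth e (diff1 h f) z\<bar> \<le> 1 / e * (1 / e * ?M)"
      using powr_less_mono2[of p "1 / e * (1 / e * ?M)" "\<bar>smooth e (diff1 h f) z\<bar>"] p0 e modulus_real_nonneg
      by (metis linorder_not_less mult_nonneg_nonneg less_imp_le zero_less_divide_1_iff)
    also have "\<dots> < c" using \<delta>(2)[OF h] e by (simp add: field_simps)
    finally have "\<bar>diff1 h (smooth e f) z\<bar> < c" unfolding smooth_diff1[OF e] .
    then show "dist (smooth e f z') (smooth e f z) < c"
      by (simp add: diff1_def h_def dist_real_def)
  qed
qed

lemma smooth_measurable: "0 < e \<Longrightarrow> e \<le> 1 \<Longrightarrow> smooth e f \<in> borel_measurable borel"
  by (rule borel_measurable_continuous_onI[OF smooth_continuous])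

lemma smooth_mass:
  assumes e: "0 < e" "e \<le> 1"
  shows "Lp_mass p (smooth e f) \<le> ennreal (n powr p)"
    and "Lp_mass p (diff1 h (smooth e f)) \<le> ennreal (modulus_real p f (norm h) powr p)"
    and "0 \<le> s \<Longrightarrow> 0 \<le> t \<Longrightarrow> Lp_mass p (diff2 s t (smooth e f)) \<le> ennreal (mixed_real p f s t powr p)"
proof -
  note m = smooth_measurable[OF e]
  show "Lp_mass p (smooth e f) \<le> ennreal (n powr p)"
    by (rule Lp_mass_smooth_le[OF p1 f per mass m])
  have m1: "smooth e (diff1 h f) \<in> borel_measurable borel" for h
    using diff1_measurable[OF m, of h] by (simp add: smooth_diff1[OF e])
  show "Lp_mass p (diff1 h (smooth e f)) \<le> ennreal (modulus_real p f (norm h) powr p)"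
    unfolding smooth_diff1[OF e]
    by (rule Lp_mass_smooth_le[OF p1 diff1_measurable[OF f] periodic2_diff1[OF per] _ m1]) (rule Lp_mass_diff1_modulus, simp)
  assume st: "0 \<le> s" "0 \<le> t"
  have eq: "diff2 s t F = diff1 (0, t) (diff1 (s, 0) F)" for F
    by (simp add: fun_eq_iff diff2_eq diff1_def del: split_paired_All)
  interpret D: Lp_borel p "diff1 (s, 0) f" "2 * n" by (rule Lp_borel_diff1)
  have eq2: "diff2 s t (smooth e f) = smooth e (diff2 s t f)"
    unfolding eq smooth_diff1[OF e] D.smooth_diff1[OF e] ..
  show "Lp_mass p (diff2 s t (smooth e f)) \<le> ennreal (mixed_real p f s t powr p)"
    unfolding eq2
    by (rule Lp_mass_smooth_le[OF p1 diff2_measurable[OF f] periodic2_diff2[OF per]])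
      (use Lp_mass_diff2_mixed[OF st(1) order_refl st(2) order_refl] diff2_measurable[OF m, of s t] in \<open>simp_all add: eq2\<close>)
qed

lemma smooth_minus_self:
  assumes e: "0 < e" "e \<le> 1"
  shows "Lp_mass p (\<lambda>z. smooth e f z - f z) \<le> ennreal (modulus_real p f (2 * e) powr p)"
proof -
  interpret U: finite_measure unit_square by (rule finite_measure_unit_square)
  interpret UU: pair_sigma_finite unit_square unit_square ..
  have m1: "measure unit_square (space unit_square) = 1" using emeasure_unit_square by (simp add: measure_def)
  have [measurable]: "(\<lambda>z. z) \<in> measurable unit_square borel"
    by (rule measurable_unit_square) simp
  have [measurable]: "smooth e f \<in> borel_measurable borel" by (rule smooth_measurable[OF e])
  have "Lp_mass p (\<lambda>z. smooth e f z - f z) = (\<integral>\<^sup>+z. ennreal (\<bar>smooth e f z - f z\<bar> powr p) \<partial>unit_square)"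
    unfolding Lp_mass_def by (subst nn_integral_unit_square) auto
  also have "\<dots> \<le> (\<integral>\<^sup>+z. (\<integral>\<^sup>+w. ennreal (\<bar>f (z + e *\<^sub>R w) - f z\<bar> powr p) \<partial>unit_square) \<partial>unit_square)"
  proof (rule nn_integral_mono)
    fix z
    have "smooth e f z - f z = (\<integral>w. f (z + e *\<^sub>R w) - f z \<partial>unit_square)"
      unfolding smooth_def using integrable_translate[OF e, of z] m1
      by (subst Bochner_Integration.integral_diff) auto
    then show "ennreal (\<bar>smooth e f z - f z\<bar> powr p) \<le> (\<integral>\<^sup>+w. ennreal (\<bar>f (z + e *\<^sub>R w) - f z\<bar> powr p) \<partial>unit_square)"
      using jensen_powr[OF p1 emeasure_unit_square, of "\<lambda>w. f (z + e *\<^sub>R w) - f z"] by simp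
  qed
  also have "\<dots> = (\<integral>\<^sup>+w. (\<integral>\<^sup>+z. ennreal (\<bar>f (z + e *\<^sub>R w) - f z\<bar> powr p) \<partial>unit_square) \<partial>unit_square)"
    by (intro UU.Fubini') measurable
  also have "\<dots> \<le> (\<integral>\<^sup>+w. ennreal (modulus_real p f (2 * e) powr p) \<partial>unit_square)"
  proof (intro nn_integral_mono)
    fix w assume "w \<in> space unit_square"
    then have w: "0 \<le> fst w" "fst w \<le> 1" "0 \<le> snd w" "snd w \<le> 1"
      by (auto simp: unit_square_def space_restrict_space cbox_Pair_eq)
    have "norm w \<le> norm (fst w) + norm (snd w)"
      by (metis norm_Pair_le prod.collapse)
    then have "norm w \<le> 2" using w by simp
    then have nw: "norm (e *\<^sub>R w) \<le> 2 * e" using e by simp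
    have "(\<integral>\<^sup>+z. ennreal (\<bar>f (z + e *\<^sub>R w) - f z\<bar> powr p) \<partial>unit_square) = Lp_mass p (diff1 (e *\<^sub>R w) f)"
      unfolding Lp_mass_def diff1_def by (rule nn_integral_unit_square) measurable
    then show "(\<integral>\<^sup>+z. ennreal (\<bar>f (z + e *\<^sub>R w) - f z\<bar> powr p) \<partial>unit_square) \<le> ennreal (modulus_real p f (2 * e) powr p)"
      using Lp_mass_diff1_modulus[OF nw] by simp
  qed
  also have "\<dots> = ennreal (modulus_real p f (2 * e) powr p)" by (simp add: emeasure_unit_square)
  finally show ?thesis .
qed

end

section \<open>Variation of the row variations\<close>

lemma p_var_le_iff:
  assumes p: "p > 0" and B: "B \<ge> 0"
  shows "p_var p h \<le> ennreal B \<longleftrightarrow>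
    (\<forall>n x. period_partition n x \<longrightarrow> (\<Sum>k<n. \<bar>h (x (Suc k)) - h (x k)\<bar> powr p) \<le> B powr p)"
proof -
  have "(a powr (1 / p) \<le> B) \<longleftrightarrow> a \<le> B powr p" if "a \<ge> 0" for a
  proof
    assume "a powr (1 / p) \<le> B"
    then have "(a powr (1 / p)) powr p \<le> B powr p" using p by (intro powr_mono2) auto
    then show "a \<le> B powr p" using that p by (simp add: powr_powr)
  next
    assume "a \<le> B powr p"
    then have "a powr (1 / p) \<le> (B powr p) powr (1 / p)" using p that by (intro powr_mono2) auto
    then show "a powr (1 / p) \<le> B" using B p by (simp add: powr_powr)
  qed
  then show ?thesis
    unfolding p_var_def using B by (simp add: SUP_le_iff sum_nonneg)
qed

lemma p_var_limit:
  assumes p: "p > 0" and B: "B \<ge> 0" and lim: "\<And>x. (\<lambda>i. h i x) \<longlonglongrightarrow> g x"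
    and le: "\<And>i. p_var p (h i) \<le> ennreal B"
  shows "p_var p g \<le> ennreal B"
  unfolding p_var_le_iff[OF p B]
proof (intro allI impI)
  fix n x assume x: "period_partition n x"
  have "(\<lambda>i. \<Sum>k<n. \<bar>h i (x (Suc k)) - h i (x k)\<bar> powr p) \<longlonglongrightarrow> (\<Sum>k<n. \<bar>g (x (Suc k)) - g (x k)\<bar> powr p)"
    using p by (intro tendsto_sum tendsto_powr' tendsto_intros lim) auto
  then show "(\<Sum>k<n. \<bar>g (x (Suc k)) - g (x k)\<bar> powr p) \<le> B powr p"
    by (rule LIMSEQ_le_const2) (use le x in \<open>auto simp: p_var_le_iff[OF p B]\<close>)
qed

lemma net_variation_le_limit:
  assumes p: "p > 0" and lim: "\<And>z. (\<lambda>i. h i z) \<longlonglongrightarrow> g z" and le: "\<And>i. net_variation_le p (h i) B"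
  shows "net_variation_le p g B"
  unfolding net_variation_le_def
proof (intro allI impI)
  fix n x l y assume *: "period_partition n x" "\<forall>k<n. period_partition (l k) (y k)"
  have "(\<lambda>i. \<Sum>k<n. \<Sum>j<l k. \<bar>cell_diff (h i) (x k) (x (Suc k)) (y k j) (y k (Suc j))\<bar> powr p)
      \<longlonglongrightarrow> (\<Sum>k<n. \<Sum>j<l k. \<bar>cell_diff g (x k) (x (Suc k)) (y k j) (y k (Suc j))\<bar> powr p)"
    unfolding cell_diff_def using p by (intro tendsto_sum tendsto_powr' tendsto_intros lim) auto
  then show "(\<Sum>k<n. \<Sum>j<l k. \<bar>cell_diff g (x k) (x (Suc k)) (y k j) (y k (Suc j))\<bar> powr p) \<le> B powr p"
    by (rule LIMSEQ_le_const2) (use le * in \<open>auto simp: net_variation_le_def\<close>)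
qed

lemma p_var_uminus: "p_var p (\<lambda>x. - h x) = p_var p h"
proof -
  have "\<bar>h a - h b\<bar> = \<bar>h b - h a\<bar>" for a b by (rule abs_minus_commute)
  then show ?thesis unfolding p_var_def by simp
qed

lemma p_var_triangle:
  assumes p: "p > 1" and fin: "p_var p u < \<infinity>" "p_var p v < \<infinity>"
  shows "enn2real (p_var p u) \<le> enn2real (p_var p v) + enn2real (p_var p (\<lambda>x. u x - v x))"
    and "p_var p (\<lambda>x. u x - v x) < \<infinity>"
proof -
  have p0: "p > 0" using p by simp
  have tri: "p_var p (\<lambda>x. a x + b x) \<le> ennreal (A + B)"
    if "p_var p a \<le> ennreal A" "p_var p b \<le> ennreal B" and nn: "A \<ge> 0" "B \<ge> 0" for a b A B
  proof -
    note * = that(1)[unfolded p_var_le_iff[OF p0 nn(1)]] that(2)[unfolded p_var_le_iff[OF p0 nn(2)]]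
    have AB: "A + B \<ge> 0" using nn by simp
    show ?thesis unfolding p_var_le_iff[OF p0 AB]
    proof (intro allI impI)
      fix n x assume x: "period_partition n x"
      let ?F = "\<lambda>k j. if j = (0::nat) then a (x (Suc k)) - a (x k) else b (x (Suc k)) - b (x k)"
      have "(\<Sum>k<n. \<bar>\<Sum>j\<in>{0, 1}. ?F k j\<bar> powr p) \<le> (\<Sum>j\<in>{0, 1::nat}. if j = 0 then A else B) powr p"
        using p nn * x by (intro minkowski_dominated) auto
      then show "(\<Sum>k<n. \<bar>a (x (Suc k)) + b (x (Suc k)) - (a (x k) + b (x k))\<bar> powr p) \<le> (A + B) powr p"
        by (simp add: algebra_simps)
    qed
  qed
  have e: "p_var p u = ennreal (enn2real (p_var p u))" "p_var p v = ennreal (enn2real (p_var p v))"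
    using fin by simp_all
  have "p_var p (\<lambda>x. u x + - v x) \<le> ennreal (enn2real (p_var p u) + enn2real (p_var p v))"
    using e by (intro tri) (auto simp: p_var_uminus)
  then show fin2: "p_var p (\<lambda>x. u x - v x) < \<infinity>"
    by (simp add: order.strict_trans1)
  then have "p_var p (\<lambda>x. v x + (u x - v x)) \<le> ennreal (enn2real (p_var p v) + enn2real (p_var p (\<lambda>x. u x - v x)))"
    using e by (intro tri) auto
  then show "enn2real (p_var p u) \<le> enn2real (p_var p v) + enn2real (p_var p (\<lambda>x. u x - v x))"
    by (intro enn2real_leI) simp_all
qed

lemma p_var_attained_approx:
  assumes p: "p > 0" and fin: "p_var p h < \<infinity>" and \<delta>: "\<delta> > 0"
  shows "\<exists>n x. period_partition n x \<and> enn2real (p_var p h) powr p \<le> (\<Sum>k<n. \<bar>h (x (Suc k)) - h (x k)\<bar> powr p) + \<delta>"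
proof (rule ccontr)
  let ?V = "enn2real (p_var p h)"
  assume "\<not> ?thesis"
  then have no: "(\<Sum>k<n. \<bar>h (x (Suc k)) - h (x k)\<bar> powr p) < ?V powr p - \<delta>" if "period_partition n x" for n x
    using that by force
  have "period_partition 1 (\<lambda>k. real k)" by (simp add: period_partition_def)
  from no[OF this] have "0 < ?V powr p - \<delta>"
    by (rule order.strict_trans1[rotated]) (intro sum_nonneg, simp)
  then have c: "((?V powr p - \<delta>) powr (1 / p)) powr p = ?V powr p - \<delta>" using p by (simp add: powr_powr)
  have "p_var p h \<le> ennreal ((?V powr p - \<delta>) powr (1 / p))"
    using no p by (subst p_var_le_iff) (auto simp: c less_imp_le)
  then have "?V \<le> (?V powr p - \<delta>) powr (1 / p)"
    by (intro enn2real_leI) simp_all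
  then have "?V powr p \<le> ((?V powr p - \<delta>) powr (1 / p)) powr p" using p by (intro powr_mono2) auto
  then show False using c \<delta> by simp
qed

text \<open>
  The increment of \<open>phi_var\<close> across the strip \<open>k\<close> is at most the variation of the difference \<open>D k\<close> of the
  bounding rows.  Choosing for each strip a partition that attains this up to \<open>\<delta>\<close> gives a net.
\<close>

lemma p_var_phi_le:
  assumes p: "p > 1" and B: "B \<ge> 0" and nv: "net_variation_le p g B"
    and fin: "\<And>x. phi_var p g x < \<infinity>"
  shows "p_var p (\<lambda>x. enn2real (phi_var p g x)) \<le> ennreal B"
proof -
  have p0: "p > 0" using p by simp
  show ?thesis
    unfolding p_var_le_iff[OF p0 B]
  proof (intro allI impI)
    fix n x assume x: "period_partition n x"
    define D where "D = (\<lambda>k y. g (x (Suc k), y) - g (x k, y))"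
    have finD: "p_var p (D k) < \<infinity>" for k
      using p_var_triangle(2)[OF p fin[unfolded phi_var_def] fin[unfolded phi_var_def]] by (simp add: D_def)
    have one: "\<bar>enn2real (phi_var p g (x (Suc k))) - enn2real (phi_var p g (x k))\<bar> \<le> enn2real (p_var p (D k))" for k
    proof -
      have "p_var p (\<lambda>y. g (x k, y) - g (x (Suc k), y)) = p_var p (D k)"
        using p_var_uminus[of p "D k"] by (simp add: D_def)
      then show ?thesis
        using p_var_triangle(1)[OF p fin[unfolded phi_var_def, of "x (Suc k)"] fin[unfolded phi_var_def, of "x k"]]
          p_var_triangle(1)[OF p fin[unfolded phi_var_def, of "x k"] fin[unfolded phi_var_def, of "x (Suc k)"]]
        by (simp add: phi_var_def D_def abs_le_iff)
    qed
    have "(\<Sum>k<n. \<bar>enn2real (phi_var p g (x (Suc k))) - enn2real (phi_var p g (x k))\<bar> powr p) \<le> B powr p + \<epsilon>"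
      if \<epsilon>: "\<epsilon> > 0" for \<epsilon>
    proof -
      \<comment> \<open>The error \<open>\<delta>\<close> is made once in each of the \<open>n\<close> strips.\<close>
      define \<delta> where "\<delta> = \<epsilon> / (real n + 1)"
      have \<delta>: "\<delta> > 0" "real n * \<delta> \<le> \<epsilon>" using \<epsilon> by (auto simp: \<delta>_def field_simps)
      have "\<exists>l y. period_partition l y \<and> enn2real (p_var p (D k)) powr p \<le> (\<Sum>j<l. \<bar>D k (y (Suc j)) - D k (y j)\<bar> powr p) + \<delta>" for k
        by (rule p_var_attained_approx[OF p0 finD \<delta>(1)])
      then obtain l y where y: "\<And>k. period_partition (l k) (y k)"
        "\<And>k. enn2real (p_var p (D k)) powr p \<le> (\<Sum>j<l k. \<bar>D k (y k (Suc j)) - D k (y k j)\<bar> powr p) + \<delta>"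
        by metis
      have "(\<Sum>k<n. \<bar>enn2real (phi_var p g (x (Suc k))) - enn2real (phi_var p g (x k))\<bar> powr p)
         \<le> (\<Sum>k<n. enn2real (p_var p (D k)) powr p)"
        using one p0 by (intro sum_mono powr_mono2) auto
      also have "\<dots> \<le> (\<Sum>k<n. (\<Sum>j<l k. \<bar>D k (y k (Suc j)) - D k (y k j)\<bar> powr p) + \<delta>)"
        by (intro sum_mono y)
      also have "\<dots> = (\<Sum>k<n. \<Sum>j<l k. \<bar>cell_diff g (x k) (x (Suc k)) (y k j) (y k (Suc j))\<bar> powr p) + real n * \<delta>"
        by (simp add: sum.distrib D_def cell_diff_def algebra_simps)
      also have "\<dots> \<le> B powr p + \<epsilon>"
        using nv x y(1) \<delta>(2) unfolding net_variation_le_def by (intro add_mono) auto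
      finally show ?thesis .
    qed
    then show "(\<Sum>k<n. \<bar>enn2real (phi_var p g (x (Suc k))) - enn2real (phi_var p g (x k))\<bar> powr p) \<le> B powr p"
      by (rule field_le_epsilon)
  qed
qed

section \<open>The continuous representative\<close>

context Lp_embedding
begin

lemma B1_nonneg: "B1 \<ge> 0" using B1[of 0] by simp
lemma B2_nonneg: "B2 \<ge> 0" using B2[of 0] by (simp add: scaled_sum_def)

text \<open>
  The bound of \<open>Lp_mass_diff2_localize_le\<close> for functions whose moduli are at most twice those of \<open>f\<close>.  The
  factor two accommodates differences of two smoothings.
\<close>

definition cutoff_modulus :: "real \<Rightarrow> real \<Rightarrow> real" where
  "cutoff_modulus s t = 8 * (mixed_real p f s t + 8 * t * modulus_real p f s + 8 * s * modulus_real p f t + 64 * s * t * n)"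

lemma quasi_modulus_cutoff_modulus: "quasi_modulus cutoff_modulus"
  unfolding quasi_modulus_def
proof (intro conjI ballI)
  fix s t :: real assume "s \<in> {0..1}" "t \<in> {0..1}"
  then show "0 \<le> cutoff_modulus s t"
    unfolding cutoff_modulus_def using mixed_real_nonneg modulus_real_nonneg n by simp
next
  fix s t s' t' :: real assume "s \<in> {0..1}" "t \<in> {0..1}" "s' \<in> {s..1}" "t' \<in> {t..1}"
  then show "cutoff_modulus s t \<le> cutoff_modulus s' t'"
    unfolding cutoff_modulus_def using modulus_real_nonneg n
    by (intro mult_left_mono add_mono mixed_real_mono mult_mono modulus_real_mono) auto
next
  fix s t s' :: real assume st: "s \<in> {0<..1}" "t \<in> {0..1}" "s' \<in> {s..1}"
  have k: "2 * s' / s \<ge> 1" "2 * s' / s * s = 2 * s'" using st by (auto simp: field_simps)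
  have b: "8 * t * modulus_real p f s' \<le> 8 * t * (2 * s' / s * modulus_real p f s)"
    using st by (intro mult_left_mono modulus_real_doubling) auto
  have c: "8 * s' * modulus_real p f t \<le> 8 * (2 * s' / s * s) * modulus_real p f t"
    unfolding k(2) using st modulus_real_nonneg by (intro mult_right_mono) auto
  have d: "64 * s' * t * n \<le> 64 * (2 * s' / s * s) * t * n"
    unfolding k(2) using st n by (intro mult_right_mono) auto
  have a: "mixed_real p f s' t \<le> 2 * s' / s * mixed_real p f s t"
    using st by (intro mixed_real_doubling1) auto
  have "cutoff_modulus s' t \<le> 8 * (2 * s' / s * mixed_real p f s t + 8 * t * (2 * s' / s * modulus_real p f s)
      + 8 * (2 * s' / s * s) * modulus_real p f t + 64 * (2 * s' / s * s) * t * n)"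
    unfolding cutoff_modulus_def by (intro mult_left_mono add_mono a b c d) simp
  also have "\<dots> = 2 * s' / s * cutoff_modulus s t" unfolding cutoff_modulus_def by (simp only: distrib_left mult_ac)
  finally show "cutoff_modulus s' t \<le> 2 * s' / s * cutoff_modulus s t" .
next
  fix s t t' :: real assume st: "s \<in> {0..1}" "t \<in> {0<..1}" "t' \<in> {t..1}"
  have k: "2 * t' / t \<ge> 1" "2 * t' / t * t = 2 * t'" using st by (auto simp: field_simps)
  have c: "8 * s * modulus_real p f t' \<le> 8 * s * (2 * t' / t * modulus_real p f t)"
    using st by (intro mult_left_mono modulus_real_doubling) auto
  have b: "8 * t' * modulus_real p f s \<le> 8 * (2 * t' / t * t) * modulus_real p f s"
    unfolding k(2) using st modulus_real_nonneg by (intro mult_right_mono) auto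
  have d: "64 * s * t' * n \<le> 64 * s * (2 * t' / t * t) * n"
    unfolding k(2) using st n by (intro mult_right_mono mult_left_mono) auto
  have a: "mixed_real p f s t' \<le> 2 * t' / t * mixed_real p f s t"
    using st by (intro mixed_real_doubling2) auto
  have "cutoff_modulus s t' \<le> 8 * (2 * t' / t * mixed_real p f s t + 8 * (2 * t' / t * t) * modulus_real p f s
      + 8 * s * (2 * t' / t * modulus_real p f t) + 64 * s * (2 * t' / t * t) * n)"
    unfolding cutoff_modulus_def by (intro mult_left_mono add_mono a b c d) simp
  also have "\<dots> = 2 * t' / t * cutoff_modulus s t" unfolding cutoff_modulus_def by (simp only: distrib_left mult_ac)
  finally show "cutoff_modulus s t' \<le> 2 * t' / t * cutoff_modulus s t" .
qed

definition row_bound :: real where "row_bound = 8 * (B2 + 32 * B1 + 256 * n)"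

lemma scaled_sum_cutoff_modulus: "scaled_sum p cutoff_modulus N \<le> row_bound"
proof -
  let ?c = "\<lambda>a. \<Sum>m<N. block_scale p m powr (- 1 / p) * a (block_scale p m)"
  have id: "0 \<le> ?c (\<lambda>t. t)" "?c (\<lambda>t. t) \<le> 2"
    using sum_scaled_id_le[OF p, of N] by (auto intro!: sum_nonneg simp: block_scale_pos less_imp_le)
  have md: "0 \<le> ?c (modulus_real p f)" "?c (modulus_real p f) \<le> B1"
    using B1[of N] by (auto intro!: sum_nonneg simp: modulus_real_nonneg)
  have eq: "cutoff_modulus = (\<lambda>s t. 8 * (((mixed_real p f s t + 8 * (modulus_real p f s * t)) + 8 * (s * modulus_real p f t)) + (64 * n) * (s * t)))"
    by (simp add: cutoff_modulus_def fun_eq_iff algebra_simps)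
  have "scaled_sum p cutoff_modulus N = 8 * (((scaled_sum p (mixed_real p f) N + 8 * (?c (modulus_real p f) * ?c (\<lambda>t. t)))
     + 8 * (?c (\<lambda>t. t) * ?c (modulus_real p f))) + (64 * n) * (?c (\<lambda>t. t) * ?c (\<lambda>t. t)))"
    unfolding eq scaled_sum_cmult scaled_sum_add scaled_sum_mult[of p "modulus_real p f" "\<lambda>t. t"]
      scaled_sum_mult[of p "\<lambda>t. t" "modulus_real p f"] scaled_sum_mult[of p "\<lambda>t. t" "\<lambda>t. t"] ..
  also have "\<dots> \<le> 8 * (((B2 + 8 * (B1 * 2)) + 8 * (2 * B1)) + (64 * n) * (2 * 2))"
    using id md B2[of N] B1_nonneg n by (intro mult_left_mono add_mono mult_mono) auto
  also have "\<dots> = row_bound" by (simp add: row_bound_def)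
  finally show ?thesis .
qed

definition controlled :: "(real \<times> real \<Rightarrow> real) \<Rightarrow> bool" where
  "controlled d \<longleftrightarrow> continuous_on UNIV d \<and> periodic2 d \<and> Lp_mass p d \<le> ennreal ((2 * n) powr p) \<and>
     (\<forall>h. Lp_mass p (diff1 h d) \<le> ennreal ((2 * modulus_real p f (norm h)) powr p)) \<and>
     (\<forall>s\<ge>0. \<forall>t\<ge>0. Lp_mass p (diff2 s t d) \<le> ennreal ((2 * mixed_real p f s t) powr p))"

text \<open>
  The minimum combines two bounds for the mixed differences of the product: the one through the moduli,
  which makes the sum over scales converge, and the trivial one through the norm of \<open>d\<close>, which makes it
  small when \<open>d\<close> is small.
\<close>

lemma net_variation_localize:
  assumes d: "controlled d" and c: "cutoff c1" "cutoff c2" and \<eta>: "\<eta> \<ge> 0" "Lp_mass p d \<le> ennreal (\<eta> powr p)"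
    and B: "\<And>N. scaled_sum p (\<lambda>s t. min (cutoff_modulus s t) (4 * \<eta>)) N \<le> B"
  shows "net_variation_le p (localize d c1 c2) (16384 * B)"
proof (rule net_variation_le_scaled_sum[OF p _ _ _ _ B])
  have cont: "continuous_on UNIV d" and pd: "periodic2 d" using d by (auto simp: controlled_def)
  show lc: "continuous_on UNIV (localize d c1 c2)" by (rule localize_continuous[OF cont c])
  show lp: "periodic2 (localize d c1 c2)" by (rule localize_periodic[OF pd c])
  have lm: "localize d c1 c2 \<in> borel_measurable borel" using lc by (rule borel_measurable_continuous_onI)
  show "quasi_modulus (\<lambda>s t. min (cutoff_modulus s t) (4 * \<eta>))"
    using \<eta> by (intro quasi_modulus_min quasi_modulus_cutoff_modulus) auto
  fix s t :: real assume st: "s \<in> {0..1}" "t \<in> {0..1}"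
  have nn: "0 \<le> 2 * mixed_real p f s t" "0 \<le> 2 * modulus_real p f s" "0 \<le> 2 * modulus_real p f t" "0 \<le> 2 * n" "0 \<le> s" "0 \<le> t"
    using st n by (auto simp: mixed_real_nonneg modulus_real_nonneg)
  have le: "Lp_mass p (diff2 s t d) \<le> ennreal ((2 * mixed_real p f s t) powr p)"
    "Lp_mass p (diff1 (s, 0) d) \<le> ennreal ((2 * modulus_real p f s) powr p)"
    "Lp_mass p (diff1 (0, t) d) \<le> ennreal ((2 * modulus_real p f t) powr p)"
    "Lp_mass p d \<le> ennreal ((2 * n) powr p)"
  proof -
    have "norm (s, 0::real) = s" "norm (0::real, t) = t" using st by (auto simp: norm_Pair)
    then show "Lp_mass p (diff1 (s, 0) d) \<le> ennreal ((2 * modulus_real p f s) powr p)"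
      "Lp_mass p (diff1 (0, t) d) \<le> ennreal ((2 * modulus_real p f t) powr p)"
      using d unfolding controlled_def by metis+
  qed (use d st in \<open>auto simp: controlled_def\<close>)
  have "4 * (2 * mixed_real p f s t + 8 * t * (2 * modulus_real p f s) + 8 * s * (2 * modulus_real p f t) + 64 * s * t * (2 * n)) = cutoff_modulus s t"
    by (simp add: cutoff_modulus_def algebra_simps)
  then have 1: "Lp_mass p (diff2 s t (localize d c1 c2)) \<le> ennreal (cutoff_modulus s t powr p)"
    using Lp_mass_diff2_localize_le[OF p cont c nn le] by simp
  have "Lp_mass p (localize d c1 c2) \<le> ennreal (\<eta> powr p)"
    using Lp_mass_mono[of "localize d c1 c2" d p] abs_localize_le[OF c] \<eta> p0 by (meson order_trans less_imp_le)
  from Lp_mass_diff2_le_diff1[OF p1 _ lm lp Lp_mass_diff1_le[OF p1 \<eta>(1) lm lp this], of s t]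
  have 2: "Lp_mass p (diff2 s t (localize d c1 c2)) \<le> ennreal ((4 * \<eta>) powr p)" using \<eta> by simp
  show "unit_integral (\<lambda>z. ennreal (\<bar>diff2 s t (localize d c1 c2) z\<bar> powr p)) \<le> ennreal (min (cutoff_modulus s t) (4 * \<eta>) powr p)"
    using 1 2 unfolding Lp_mass_def by (simp add: min_def)
qed

lemma controlled_rows:
  assumes d: "controlled d"
  shows "p_var p (\<lambda>y. d (a, y)) \<le> ennreal (16384 * row_bound)" "p_var p (\<lambda>x. d (x, b)) \<le> ennreal (16384 * row_bound)"
proof -
  have row_bound: "16384 * row_bound \<ge> 0" using B1_nonneg B2_nonneg n by (simp add: row_bound_def)
  \<comment> \<open>Any \<open>\<eta>\<close> that bounds the norm will do here; \<open>2 * n\<close> does for every controlled function.\<close>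
  have B: "scaled_sum p (\<lambda>s t. min (cutoff_modulus s t) (4 * (2 * n))) N \<le> row_bound" for N
    using scaled_sum_mono[of "\<lambda>s t. min (cutoff_modulus s t) (4 * (2 * n))" cutoff_modulus p N] scaled_sum_cutoff_modulus[of N] p by simp
  have nv: "net_variation_le p (localize d c1 c2) (16384 * row_bound)" if "cutoff c1" "cutoff c2" for c1 c2
    using d n by (intro net_variation_localize[OF d that _ _ B]) (auto simp: controlled_def)
  show "p_var p (\<lambda>y. d (a, y)) \<le> ennreal (16384 * row_bound)"
    by (intro p_var_row_le p row_bound nv cutoff_one cutoff_cos)
  show "p_var p (\<lambda>x. d (x, b)) \<le> ennreal (16384 * row_bound)"
    by (intro p_var_column_le p row_bound nv cutoff_one cutoff_cos)
qed

text \<open>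
  Smallness in \<open>L\<^sup>p\<close> implies uniform smallness within this class; applied to the differences of the
  smoothings this gives uniform convergence.
\<close>

lemma controlled_small:
  assumes e: "e > 0"
  obtains \<eta> where "\<eta> > 0" "\<And>d z. controlled d \<Longrightarrow> Lp_mass p d \<le> ennreal (\<eta> powr p) \<Longrightarrow> \<bar>d z\<bar> \<le> e"
proof -
  have r0: "0 \<le> cutoff_modulus s t" if "s \<in> {0<..1}" "t \<in> {0<..1}" for s t
    using quasi_modulus_cutoff_modulus that unfolding quasi_modulus_def by auto
  obtain \<eta> where \<eta>: "\<eta> > 0" "\<And>N. scaled_sum p (\<lambda>s t. min (cutoff_modulus s t) (4 * \<eta>)) N \<le> e / 16384"
    using scaled_sum_min_small[OF p r0 scaled_sum_cutoff_modulus, of "e / 16384"] e by auto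
  have "\<bar>d z\<bar> \<le> e" if d: "controlled d" and small: "Lp_mass p d \<le> ennreal (\<eta> powr p)" for d z
  proof -
    obtain a b where z: "z = (a, b)" by (cases z)
    have "net_variation_le p (localize d (\<lambda>x. cos (2 * pi * (x - a))) (\<lambda>y. cos (2 * pi * (y - b)))) (16384 * (e / 16384))"
      using \<eta>(1) by (intro net_variation_localize[OF d cutoff_cos cutoff_cos _ small \<eta>(2)]) auto
    then show ?thesis unfolding z using e abs_value_le[OF p, of e d a b] by simp
  qed
  then show ?thesis using that \<eta>(1) by blast
qed

text \<open>
  Half a scale, because \<open>smooth_minus_self\<close> bounds the error through the modulus at twice the side
  length.
\<close>

definition approx :: "nat \<Rightarrow> real \<times> real \<Rightarrow> real" where
  "approx i = smooth (block_scale p i / 2) f"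

lemma approx_e: "0 < block_scale p i / 2" "block_scale p i / 2 \<le> 1"
  using block_scale_pos[of p i] block_scale_le_1[OF p, of i] by auto

lemma approx_continuous: "continuous_on UNIV (approx i)"
  unfolding approx_def by (rule smooth_continuous[OF approx_e])

lemma approx_measurable: "approx i \<in> borel_measurable borel"
  by (rule borel_measurable_continuous_onI[OF approx_continuous])

lemma approx_periodic: "periodic2 (approx i)"
  unfolding approx_def by (rule smooth_periodic)

lemma approx_minus_self: "Lp_mass p (\<lambda>z. approx i z - f z) \<le> ennreal (modulus_real p f (block_scale p i) powr p)"
  using smooth_minus_self[OF approx_e] by (simp add: approx_def)

lemma diff1_minus: "diff1 h (\<lambda>z. F z - G z) = (\<lambda>z. diff1 h F z - diff1 h G z)"
  by (simp add: diff1_def fun_eq_iff del: split_paired_All)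

lemma diff2_minus: "diff2 s t (\<lambda>z. F z - G z) = (\<lambda>z. diff2 s t F z - diff2 s t G z)"
  by (simp add: diff2_def fun_eq_iff)

lemma approx_diff_controlled: "controlled (\<lambda>z. approx i z - approx j z)"
  unfolding controlled_def diff1_minus diff2_minus
  using approx_measurable n
  by (intro conjI allI impI Lp_mass_diff_le p1 modulus_real_nonneg mixed_real_nonneg diff1_measurable diff2_measurable
      continuous_on_diff approx_continuous)
    (use approx_periodic[unfolded periodic2_iff] in \<open>auto simp: approx_def periodic2_iff intro!: smooth_mass approx_e\<close>)

lemma approx_controlled: "controlled (approx i)"
proof -
  have mono: "ennreal (c powr p) \<le> ennreal ((2 * c) powr p)" if "c \<ge> 0" for c
    using that p0 by (intro ennreal_leI powr_mono2) auto
  show ?thesis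
    unfolding controlled_def
    using approx_continuous approx_periodic
      order_trans[OF smooth_mass(1)[OF approx_e] mono[OF n]]
      order_trans[OF smooth_mass(2)[OF approx_e] mono[OF modulus_real_nonneg]]
      order_trans[OF smooth_mass(3)[OF approx_e] mono[OF mixed_real_nonneg]]
    by (auto simp: approx_def)
qed

lemma approx_diff_small:
  assumes "modulus_real p f (block_scale p i) \<le> c" "modulus_real p f (block_scale p j) \<le> c"
  shows "Lp_mass p (\<lambda>z. approx i z - approx j z) \<le> ennreal ((2 * c) powr p)"
proof -
  have c: "c \<ge> 0" using assms modulus_real_nonneg order_trans by blast
  have le: "Lp_mass p (\<lambda>z. approx i z - f z) \<le> ennreal (c powr p)" if "modulus_real p f (block_scale p i) \<le> c" for i
  proof -
    have "modulus_real p f (block_scale p i) powr p \<le> c powr p"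
      using that modulus_real_nonneg p0 by (intro powr_mono2) auto
    then show ?thesis using approx_minus_self[of i] ennreal_leI order_trans by blast
  qed
  have "Lp_mass p (\<lambda>z. (approx i z - f z) - (approx j z - f z)) \<le> ennreal ((2 * c) powr p)"
    using approx_measurable assms by (intro Lp_mass_diff_le p1 c le) auto
  then show ?thesis by simp
qed

lemma approx_uniform_limit:
  obtains g where "uniform_limit UNIV approx g sequentially"
proof -
  have "uniformly_Cauchy_on UNIV approx"
    unfolding uniformly_Cauchy_on_def
  proof (intro allI impI)
    fix e :: real assume "e > 0"
    then obtain \<eta> where \<eta>: "\<eta> > 0" "\<And>d z. controlled d \<Longrightarrow> Lp_mass p d \<le> ennreal (\<eta> powr p) \<Longrightarrow> \<bar>d z\<bar> \<le> e / 2"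
      using controlled_small[of "e / 2"] by auto
    obtain M where M: "\<And>i. i \<ge> M \<Longrightarrow> modulus_real p f (block_scale p i) < \<eta> / 2"
      using order_tendstoD(2)[OF modulus_real_tendsto, of "\<eta> / 2"] \<eta>(1) by (auto simp: eventually_sequentially)
    have "dist (approx i z) (approx j z) < e" if "i \<ge> M" "j \<ge> M" for i j z
    proof -
      have "Lp_mass p (\<lambda>z. approx i z - approx j z) \<le> ennreal ((2 * (\<eta> / 2)) powr p)"
        using M[OF that(1)] M[OF that(2)] by (intro approx_diff_small) auto
      then have "\<bar>approx i z - approx j z\<bar> \<le> e / 2"
        using \<eta>(2)[OF approx_diff_controlled, of i j z] by simp
      then show ?thesis using \<open>e > 0\<close> by (simp add: dist_real_def)
    qed
    then show "\<exists>M. \<forall>x\<in>UNIV. \<forall>m\<ge>M. \<forall>n\<ge>M. dist (approx m x) (approx n x) < e" by blast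
  qed
  then have "uniformly_convergent_on UNIV approx" by (rule Cauchy_uniformly_convergent)
  then show ?thesis using that by (auto simp: uniformly_convergent_on_def)
qed

lemma approx_net_variation: "net_variation_le p (approx i) (16384 * B2)"
proof (rule net_variation_le_scaled_sum[OF p approx_continuous approx_periodic quasi_modulus_mixed_real _ B2])
  fix s t :: real assume "s \<in> {0..1}" "t \<in> {0..1}"
  then show "unit_integral (\<lambda>z. ennreal (\<bar>diff2 s t (approx i) z\<bar> powr p)) \<le> ennreal (mixed_real p f s t powr p)"
    using smooth_mass(3)[OF approx_e] unfolding approx_def Lp_mass_def by auto
qed

text \<open>
  The rows and columns of \<open>f\<close> need different nets; exchanging the variables reduces the second kind to the
  first.
\<close>

lemma approx_swap_net_variation: "net_variation_le p (\<lambda>z. approx i (prod.swap z)) (16384 * B2)"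
proof (rule net_variation_le_scaled_sum[OF p _ _ quasi_modulus_swap[OF quasi_modulus_mixed_real]])
  show "continuous_on UNIV (\<lambda>z. approx i (prod.swap z))"
    by (rule continuous_on_compose2[OF approx_continuous continuous_on_swap]) auto
  show "periodic2 (\<lambda>z. approx i (prod.swap z))"
    using approx_periodic by (auto simp: periodic2_def)
  show "scaled_sum p (\<lambda>s t. mixed_real p f t s) N \<le> B2" for N
    using B2[of N] scaled_sum_swap[of p "mixed_real p f" N] by linarith
  fix s t :: real assume st: "s \<in> {0..1}" "t \<in> {0..1}"
  have "diff2 s t (\<lambda>z. approx i (prod.swap z)) z = diff2 t s (approx i) (prod.swap z)" for z
    by (cases z) (simp add: diff2_def)
  then have "unit_integral (\<lambda>z. ennreal (\<bar>diff2 s t (\<lambda>z. approx i (prod.swap z)) z\<bar> powr p)) = Lp_mass p (diff2 t s (approx i))"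
    using unit_integral_swap[of "\<lambda>z. ennreal (\<bar>diff2 t s (approx i) z\<bar> powr p)"] diff2_measurable[OF approx_measurable]
    by (simp add: Lp_mass_def)
  also have "\<dots> \<le> ennreal (mixed_real p f t s powr p)"
    using smooth_mass(3)[OF approx_e] st unfolding approx_def by auto
  finally show "unit_integral (\<lambda>z. ennreal (\<bar>diff2 s t (\<lambda>z. approx i (prod.swap z)) z\<bar> powr p)) \<le> ennreal (mixed_real p f t s powr p)" .
qed

theorem continuous_representative:
  obtains g where "continuous_on UNIV g" "periodic2 g" "Lp_mass p (\<lambda>z. g z - f z) = 0"
    "\<And>x. phi_var p g x \<le> ennreal (16384 * row_bound)" "\<And>y. psi_var p g y \<le> ennreal (16384 * row_bound)"
    "net_variation_le p g (16384 * B2)" "net_variation_le p (\<lambda>z. g (prod.swap z)) (16384 * B2)"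
proof -
  obtain g where g: "uniform_limit UNIV approx g sequentially" by (rule approx_uniform_limit)
  have lim: "(\<lambda>i. approx i z) \<longlonglongrightarrow> g z" for z using g by (rule tendsto_uniform_limitI) simp
  have cont: "continuous_on UNIV g"
    by (rule uniform_limit_theorem[OF _ g]) (auto simp: approx_continuous)
  have [measurable]: "g \<in> borel_measurable borel" using cont by (rule borel_measurable_continuous_onI)
  note [measurable] = approx_measurable
  have row_bound: "16384 * row_bound \<ge> 0" using B1_nonneg B2_nonneg n by (simp add: row_bound_def)
  have "periodic2 g"
    unfolding periodic2_iff
  proof (intro allI conjI)
    fix z :: "real \<times> real"
    have a: "approx i (z + (1, 0)) = approx i z" "approx i (z + (0, 1)) = approx i z" for i
      using approx_periodic[of i] unfolding periodic2_iff by blast+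
    show "g (z + (1, 0)) = g z"
      by (rule LIMSEQ_unique[OF lim[of "z + (1, 0)", unfolded a(1)] lim])
    show "g (z + (0, 1)) = g z"
      by (rule LIMSEQ_unique[OF lim[of "z + (0, 1)", unfolded a(2)] lim])
  qed
  moreover have "Lp_mass p (\<lambda>z. g z - f z) = 0"
  proof (rule ccontr)
    assume "Lp_mass p (\<lambda>z. g z - f z) \<noteq> 0"
    then have "0 < Lp_mass p (\<lambda>z. g z - f z)" by (simp add: zero_less_iff_neq_zero)
    then obtain q where q: "0 < q" "q < Lp_mass p (\<lambda>z. g z - f z)" using dense by blast
    define c where "c = enn2real q"
    have "q < top" using q(2) top_greatest by (rule order.strict_trans2)
    then have c: "c > 0" "ennreal c < Lp_mass p (\<lambda>z. g z - f z)"
      using q by (simp_all add: c_def enn2real_positive_iff)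
    \<comment> \<open>The choice makes \<open>(2 * e) powr p = c\<close>.\<close>
    define e where "e = c powr (1 / p) / 2"
    have e: "e > 0" using c by (simp add: e_def)
    have "eventually (\<lambda>i. (\<forall>z\<in>UNIV. dist (approx i z) (g z) < e) \<and> modulus_real p f (block_scale p i) < e) sequentially"
      using uniform_limitD[OF g e] order_tendstoD(2)[OF modulus_real_tendsto e] by (rule eventually_conj)
    then obtain i where i: "\<And>z. dist (approx i z) (g z) < e" "modulus_real p f (block_scale p i) < e"
      by (auto simp: eventually_sequentially)
    have "Lp_mass p (\<lambda>z. g z - approx i z) \<le> Lp_mass p (\<lambda>z. e * 1)"
      using i(1) e p0 by (intro Lp_mass_mono) (auto simp: dist_real_def abs_minus_commute less_imp_le)
    also have "\<dots> = ennreal (e powr p)"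
      unfolding Lp_mass_def unit_integral_def using e by (simp add: nn_integral_cmult_indicator)
    finally have 1: "Lp_mass p (\<lambda>z. g z - approx i z) \<le> ennreal (e powr p)" .
    have "Lp_mass p (\<lambda>z. approx i z - f z) \<le> ennreal (modulus_real p f (block_scale p i) powr p)" by (rule approx_minus_self)
    also have "\<dots> \<le> ennreal (e powr p)"
      using i(2) p0 modulus_real_nonneg by (intro ennreal_leI powr_mono2) auto
    finally have 2: "Lp_mass p (\<lambda>z. approx i z - f z) \<le> ennreal (e powr p)" .
    have "Lp_mass p (\<lambda>z. (g z - approx i z) + (approx i z - f z)) \<le> ennreal ((2 * e) powr p)"
      using e by (intro Lp_mass_add_le p1 1 2) auto
    also have "(2 * e) powr p = c" using c p0 by (simp add: e_def powr_powr)
    finally show False using c by simp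
  qed
  moreover have "phi_var p g x \<le> ennreal (16384 * row_bound)" for x
    unfolding phi_var_def by (rule p_var_limit[OF p0 row_bound lim controlled_rows(1)[OF approx_controlled]])
  moreover have "psi_var p g y \<le> ennreal (16384 * row_bound)" for y
    unfolding psi_var_def by (rule p_var_limit[OF p0 row_bound lim controlled_rows(2)[OF approx_controlled]])
  moreover have "net_variation_le p g (16384 * B2)"
    by (rule net_variation_le_limit[OF p0 lim approx_net_variation])
  moreover have "net_variation_le p (\<lambda>z. g (prod.swap z)) (16384 * B2)"
    by (rule net_variation_le_limit[OF p0 lim approx_swap_net_variation])
  ultimately show ?thesis using that cont by blast
qed

end

section \<open>The embedding theorem\<close>

lemma AE_lborel_translate:
  fixes P :: "real \<times> real \<Rightarrow> bool"
  assumes "AE z in lborel. P z"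
  shows "AE z in lborel. P (z + h)"
proof -
  obtain N where N: "N \<in> null_sets lborel" "{z. \<not> P z} \<subseteq> N"
    using assms by (auto simp: eventually_ae_filter)
  have "{z. z - (- h) \<in> N} \<in> null_sets lborel"
    using null_sets_translation[OF N(1), of "- h"] .
  then show ?thesis
    using N(2) by (intro AE_I'[of "{z. z - (- h) \<in> N}"]) auto
qed

lemma AE_lborel_periodic:
  fixes P :: "real \<times> real \<Rightarrow> bool"
  assumes ae: "AE z in lborel. z \<in> {0..<1} \<times> {0..<1} \<longrightarrow> P z"
    and per: "\<And>x y. P (x + 1, y) = P (x, y)" "\<And>x y. P (x, y + 1) = P (x, y)"
  shows "AE z in lborel. P z"
proof -
  have "AE z in lborel. \<forall>k l. z + (of_int k, of_int l) \<in> {0..<1} \<times> {0..<1} \<longrightarrow> P (z + (of_int k, of_int l))"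
    unfolding AE_all_countable by (intro allI AE_lborel_translate ae)
  then show ?thesis
  proof (rule AE_mp, intro AE_I2 impI)
    fix z :: "real \<times> real"
    assume *: "\<forall>k l. z + (of_int k, of_int l) \<in> {0..<1} \<times> {0..<1} \<longrightarrow> P (z + (of_int k, of_int l))"
    obtain x y where z: "z = (x, y)" by (cases z)
    have fr: "x + of_int (- \<lfloor>x\<rfloor>) \<in> {0..<1}" "y + of_int (- \<lfloor>y\<rfloor>) \<in> {0..<1}"
      by (simp_all, linarith+)
    then have "P (x + of_int (- \<lfloor>x\<rfloor>), y + of_int (- \<lfloor>y\<rfloor>))" using *[rule_format, of "- \<lfloor>x\<rfloor>" "- \<lfloor>y\<rfloor>"] fr unfolding z by simp
    then show "P z"
      unfolding z periodic_add_of_int[of "\<lambda>x. P (x, _)", OF per(1)] periodic_add_of_int[of "\<lambda>y. P (_, y)", OF per(2)] .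
  qed
qed

lemma Lp_mass_zero_AE:
  assumes [measurable]: "F \<in> borel_measurable borel" and per: "periodic2 F" and zero: "Lp_mass p F = 0"
  shows "AE z in lborel. F z = 0"
proof (rule AE_lborel_periodic)
  have "(\<integral>\<^sup>+z. ennreal (\<bar>F z\<bar> powr p) \<partial>unit_square) = 0"
    using zero by (simp add: nn_integral_unit_square Lp_mass_def)
  then have "(\<integral>\<^sup>+z. ennreal (\<bar>F z\<bar> powr p) * indicator (cbox (0, 0) (1, 1)) z \<partial>lborel) = 0"
    unfolding unit_square_def by (subst (asm) nn_integral_restrict_space) auto
  then have "AE z in lborel. ennreal (\<bar>F z\<bar> powr p) * indicator (cbox (0, 0) (1, 1)) z = 0"
    by (subst (asm) nn_integral_0_iff_AE) auto
  then show "AE z in lborel. z \<in> {0..<1} \<times> {0..<1} \<longrightarrow> F z = 0"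
    by (rule AE_mp) (auto intro!: AE_I2 simp: indicator_def cbox_Pair_eq)
qed (use per in \<open>auto simp: periodic2_def periodic1_def\<close>)

text \<open>
  A Borel function equal to \<open>f\<close> almost everywhere need not be periodic, so it is restricted to the unit
  square and continued periodically.
\<close>

lemma borel_periodic_representative:
  assumes f: "f \<in> borel_measurable lebesgue" and per: "periodic2 f"
  obtains f0 where "f0 \<in> borel_measurable borel" "periodic2 f0" "AE z in lborel. f z = f0 z"
proof -
  obtain f' where f' [measurable]: "f' \<in> borel_measurable lborel" and ae: "AE z in lborel. f z = f' z"
    using completion_ex_borel_measurable_real[OF f] by auto
  define f0 where "f0 = (\<lambda>z. f' (frac (fst z), frac (snd z)))"
  have fr: "frac (x + 1) = frac x" for x :: real by (simp add: frac_def)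
  have [measurable]: "(frac :: real \<Rightarrow> real) \<in> borel_measurable borel"
    unfolding frac_def[abs_def] by measurable
  have "f0 \<in> borel_measurable (borel \<Otimes>\<^sub>M borel)"
  proof -
    have [measurable]: "f' \<in> borel_measurable (borel \<Otimes>\<^sub>M borel)" using f' by (simp add: borel_prod)
    show ?thesis unfolding f0_def by measurable
  qed
  moreover have p0: "periodic2 f0" by (simp add: f0_def periodic2_def periodic1_def fr)
  moreover have "AE z in lborel. f z = f0 z"
  proof (rule AE_lborel_periodic)
    show "AE z in lborel. z \<in> {0..<1} \<times> {0..<1} \<longrightarrow> f z = f0 z"
      using ae by (rule AE_mp) (auto intro!: AE_I2 simp: f0_def frac_eq)
  qed (use per p0 in \<open>auto simp: periodic2_def periodic1_def\<close>)
  ultimately show ?thesis using that by (simp add: borel_prod)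
qed

lemma Lp_norm_cong_AE:
  assumes "AE z in lborel. F z = G z"
  shows "Lp_norm p F = Lp_norm p G"
proof -
  have "AE z in lebesgue. F z = G z" using assms by (rule AE_completion)
  then have "(\<integral>\<^sup>+z\<in>{0..1} \<times> {0..1}. ennreal (\<bar>F z\<bar> powr p) \<partial>lebesgue) = (\<integral>\<^sup>+z\<in>{0..1} \<times> {0..1}. ennreal (\<bar>G z\<bar> powr p) \<partial>lebesgue)"
    by (intro nn_integral_cong_AE) auto
  then show ?thesis by (simp add: Lp_norm_def)
qed

lemma moduli_cong_AE:
  assumes ae: "AE z in lborel. f z = g z"
  shows "modulus p f t = modulus p g t" "mixed_modulus p f u v = mixed_modulus p g u v"
proof -
  have sh: "AE z in lborel. f (z + h) = g (z + h)" for h by (rule AE_lborel_translate[OF ae])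
  have "Lp_norm p (diff1 h f) = Lp_norm p (diff1 h g)" for h
    by (rule Lp_norm_cong_AE) (use ae sh[of h] in \<open>eventually_elim, simp add: diff1_def\<close>)
  then show "modulus p f t = modulus p g t" by (simp add: modulus_def)
  have "Lp_norm p (diff2 s t f) = Lp_norm p (diff2 s t g)" for s t
    by (rule Lp_norm_cong_AE)
      (use ae sh[of "(s, t)"] sh[of "(s, 0)"] sh[of "(0, t)"] in \<open>eventually_elim, auto simp: diff2_def split_beta'\<close>)
  then show "mixed_modulus p f u v = mixed_modulus p g u v" by (simp add: mixed_modulus_def)
qed

context Lp_borel
begin

lemma mixed_real_le_modulus:
  assumes "u \<ge> 0" "v \<ge> 0"
  shows "mixed_real p f u v \<le> 2 * modulus_real p f u" "mixed_real p f u v \<le> 2 * modulus_real p f v"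
proof -
  have nn: "0 \<le> modulus_real p f t" for t by (rule modulus_real_nonneg)
  show "mixed_real p f u v \<le> 2 * modulus_real p f u"
  proof (rule mixed_real_le)
    fix s t assume st: "0 \<le> s" "s \<le> u" "0 \<le> t" "t \<le> v"
    then have "norm (s, 0::real) \<le> u" by (simp add: norm_Pair)
    then show "Lp_mass p (diff2 s t f) \<le> ennreal ((2 * modulus_real p f u) powr p)"
      by (intro Lp_mass_diff2_le_diff1 p1 nn f per Lp_mass_diff1_modulus)
  qed (simp add: nn)
  show "mixed_real p f u v \<le> 2 * modulus_real p f v"
  proof (rule mixed_real_le)
    fix s t assume st: "0 \<le> s" "s \<le> u" "0 \<le> t" "t \<le> v"
    then have "norm (0::real, t) \<le> v" by (simp add: norm_Pair)
    have eq: "diff2 s t f = diff1 (s, 0) (diff1 (0, t) f)"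
      by (simp add: fun_eq_iff diff2_def diff1_def)
    show "Lp_mass p (diff2 s t f) \<le> ennreal ((2 * modulus_real p f v) powr p)"
      unfolding eq using \<open>norm (0, t) \<le> v\<close>
      by (intro Lp_mass_diff1_le p1 nn diff1_measurable f periodic2_diff1 per Lp_mass_diff1_modulus)
  qed (simp add: nn)
qed

text \<open>
  In particular \<open>K\<^sub>p(f)\<close> is finite.
\<close>

lemma K_int_le_J_int: "K_int p f \<le> 4 * J_int p f"
proof -
  have [measurable]: "modulus_real p f \<in> borel_measurable borel"
    by (rule borel_measurable_mono) (simp add: mono_def modulus_real_mono)
  have "K_int p f \<le> (\<integral>\<^sup>+t\<in>{0<..1}. 4 * (ennreal (t powr (- 1 / p) / t) * ennreal (modulus_real p f t)) \<partial>lborel)"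
    unfolding K_int_def
  proof (intro nn_integral_mono)
    fix t :: real
    have "mixed_modulus p f t 1 + mixed_modulus p f 1 t \<le> 4 * ennreal (modulus_real p f t)" if "t \<in> {0<..1}"
    proof -
      have "mixed_real p f t 1 + mixed_real p f 1 t \<le> 4 * modulus_real p f t"
        using mixed_real_le_modulus(1)[of t 1] mixed_real_le_modulus(2)[of 1 t] that by simp
      then have "ennreal (mixed_real p f t 1 + mixed_real p f 1 t) \<le> ennreal (4 * modulus_real p f t)" by (rule ennreal_leI)
      then show ?thesis by (simp add: mixed_eq mixed_real_nonneg ennreal_mult' modulus_real_nonneg)
    qed
    from mult_left_mono[OF this, of "ennreal (t powr (- 1 / p) / t)"]
    show "ennreal (t powr (- 1 / p) / t) * (mixed_modulus p f t 1 + mixed_modulus p f 1 t) * indicator {0<..1} t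
      \<le> 4 * (ennreal (t powr (- 1 / p) / t) * ennreal (modulus_real p f t)) * indicator {0<..1} t"
      by (auto simp: indicator_def mult.left_commute)
  qed
  also have "\<dots> = 4 * J_int p f"
    unfolding J_int_def modulus_eq by (subst nn_integral_cmult[symmetric]) (auto simp: mult.assoc)
  finally show ?thesis .
qed

text \<open>
  The constant is \<open>2 * 16384 * 64\<close>: two halves of \<open>W_var\<close>, the constant of the net variation estimate, and
  the square of the constant \<open>8\<close> in \<open>sum_scaled_le_integral\<close>.
\<close>

theorem representative_with_small_variation:
  assumes I: "I_int p f < \<infinity>" and J: "J_int p f < \<infinity>"
  obtains g where "continuous_on UNIV g" "g \<in> VV_class p" "AE z in lborel. f z = g z"
    "W_var p g \<le> ennreal 2097152 * (mixed_modulus p f 1 1 + ennreal ((p - 1) / p\<^sup>2) * K_int p f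
        + ennreal (((p - 1) / p\<^sup>2)\<^sup>2) * I_int p f)"
proof -
  define g where "g = ennreal (8 * ((p - 1) / p\<^sup>2))"
  let ?h = "block_scale p"
  have h: "0 < ?h m" "?h m \<le> 1" for m using block_scale_pos block_scale_le_1[OF p] by auto
  have K: "K_int p f < \<infinity>" using K_int_le_J_int J by (auto simp: ennreal_mult_less_top order.strict_trans1)
  define X where "X = mixed_modulus p f 1 1 + g * K_int p f + g\<^sup>2 * I_int p f"
  have gfin: "g < top" by (simp add: g_def)
  have "X < top" unfolding X_def using I K gfin
    by (simp add: ennreal_mult_less_top mixed_eq power2_eq_square)
  define Y where "Y = modulus p f 1 + g * J_int p f"
  have "Y < top" unfolding Y_def using J gfin by (simp add: ennreal_mult_less_top modulus_eq)
  have emb: "Lp_embedding p f n (enn2real Y) (enn2real X)"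
  proof (unfold_locales)
    fix N
    have a: "(\<Sum>m<N. ?h m powr (- 1 / p) * modulus_real p f (?h m)) \<le> (\<Sum>m<Suc N. ?h m powr (- 1 / p) * modulus_real p f (?h m))"
      using modulus_real_nonneg by simp
    have "ennreal (\<Sum>m<Suc N. ?h m powr (- 1 / p) * modulus_real p f (?h m)) = (\<Sum>m<Suc N. ennreal (?h m powr (- 1 / p)) * modulus p f (?h m))"
      unfolding modulus_eq by (subst sum_ennreal[symmetric]) (auto simp: modulus_real_nonneg ennreal_mult')
    also have "\<dots> = modulus p f 1 + (\<Sum>m<N. ennreal (?h (Suc m) powr (- 1 / p)) * modulus p f (?h (Suc m)))"
      by (simp only: sum.lessThan_Suc_shift) (simp add: block_scale_0)
    also have "\<dots> \<le> Y"
      unfolding Y_def J_int_def g_def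
    proof (intro add_left_mono sum_scaled_le_integral p)
      fix s t :: real assume st: "0 < s" "s \<le> t" "t \<le> 1"
      show "modulus p f s \<le> modulus p f t" unfolding modulus_eq using st by (intro ennreal_leI modulus_real_mono)
      show "modulus p f t \<le> ennreal (2 * t / s) * modulus p f s"
        unfolding modulus_eq ennreal_mult''[OF modulus_real_nonneg, symmetric]
        by (rule ennreal_leI[OF modulus_real_doubling[OF st(1,2)]])
    qed
    finally have b: "ennreal (\<Sum>m<Suc N. ?h m powr (- 1 / p) * modulus_real p f (?h m)) \<le> Y" .
    have "0 \<le> (\<Sum>m<Suc N. ?h m powr (- 1 / p) * modulus_real p f (?h m))"
      using modulus_real_nonneg by (intro sum_nonneg mult_nonneg_nonneg) auto
    then show "(\<Sum>m<N. ?h m powr (- 1 / p) * modulus_real p f (?h m)) \<le> enn2real Y"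
      using a enn2real_mono[OF b \<open>Y < top\<close>] by simp
  next
    fix N
    have a: "scaled_sum p (mixed_real p f) N \<le> scaled_sum p (mixed_real p f) (Suc N)"
      by (intro scaled_sum_mono_N p mixed_real_nonneg) simp
    have "ennreal (scaled_sum p (mixed_real p f) (Suc N)) = (\<Sum>m<Suc N. \<Sum>i<Suc N. ennreal (?h m powr (- 1 / p)) * ennreal (?h i powr (- 1 / p)) * mixed_modulus p f (?h m) (?h i))"
      unfolding mixed_eq scaled_sum_def
      by (simp only: sum_ennreal[symmetric] sum_nonneg mult_nonneg_nonneg powr_ge_zero mixed_real_nonneg ennreal_mult')
    also have "\<dots> \<le> X"
      unfolding X_def K_int_def I_int_def g_def
    proof (rule sum_scaled2_le_integrals[OF p])
      fix s t v :: real assume st: "0 < s" "s \<le> t" "t \<le> 1" "0 < v" "v \<le> 1"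
      show "mixed_modulus p f s v \<le> mixed_modulus p f t v" "mixed_modulus p f v s \<le> mixed_modulus p f v t"
        unfolding mixed_eq using st by (auto intro!: ennreal_leI mixed_real_mono)
      show "mixed_modulus p f t v \<le> ennreal (2 * t / s) * mixed_modulus p f s v"
        unfolding mixed_eq ennreal_mult''[OF mixed_real_nonneg, symmetric]
        by (rule ennreal_leI[OF mixed_real_doubling1[OF st(1,2)]])
      show "mixed_modulus p f v t \<le> ennreal (2 * t / s) * mixed_modulus p f v s"
        unfolding mixed_eq ennreal_mult''[OF mixed_real_nonneg, symmetric]
        by (rule ennreal_leI[OF mixed_real_doubling2[OF st(1,2)]])
    qed
    finally have b: "ennreal (scaled_sum p (mixed_real p f) (Suc N)) \<le> X" .
    have "0 \<le> scaled_sum p (mixed_real p f) (Suc N)"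
      unfolding scaled_sum_def using mixed_real_nonneg by (intro sum_nonneg mult_nonneg_nonneg) auto
    then show "scaled_sum p (mixed_real p f) N \<le> enn2real X"
      using a enn2real_mono[OF b \<open>X < top\<close>] by simp
  qed
  interpret E: Lp_embedding p f n "enn2real Y" "enn2real X" by (rule emb)
  obtain G where G: "continuous_on UNIV G" "periodic2 G" "Lp_mass p (\<lambda>z. G z - f z) = 0"
    "\<And>x. phi_var p G x \<le> ennreal (16384 * E.row_bound)" "\<And>y. psi_var p G y \<le> ennreal (16384 * E.row_bound)"
    "net_variation_le p G (16384 * enn2real X)" "net_variation_le p (\<lambda>z. G (prod.swap z)) (16384 * enn2real X)"
    using E.continuous_representative by blast
  have fin: "phi_var p G x < \<infinity>" "psi_var p G y < \<infinity>" for x y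
    using G(4)[of x] G(5)[of y] by (auto intro: order.strict_trans1)
  have psi: "psi_var p G = phi_var p (\<lambda>z. G (prod.swap z))"
    by (simp add: psi_var_def phi_var_def fun_eq_iff)
  have X0: "0 \<le> 16384 * enn2real X" by simp
  have W: "W_var p G \<le> ennreal (16384 * enn2real X) + ennreal (16384 * enn2real X)"
    unfolding W_var_def
  proof (rule add_mono)
    show "p_var p (\<lambda>x. enn2real (phi_var p G x)) \<le> ennreal (16384 * enn2real X)"
      by (rule p_var_phi_le[OF p X0 G(6) fin(1)])
    show "p_var p (\<lambda>y. enn2real (psi_var p G y)) \<le> ennreal (16384 * enn2real X)"
      unfolding psi by (rule p_var_phi_le[OF p X0 G(7) fin(2)[unfolded psi]])
  qed
  also have "\<dots> = ennreal (32768 * enn2real X)" by (simp flip: ennreal_plus)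
  also have "\<dots> = ennreal 32768 * ennreal (enn2real X)" by (rule ennreal_mult') simp
  also have "ennreal (enn2real X) = X" using \<open>X < top\<close> by simp
  finally have W': "W_var p G \<le> ennreal 32768 * X" .
  let ?k = "ennreal ((p - 1) / p\<^sup>2)"
  have k: "0 \<le> (p - 1) / p\<^sup>2" using p by simp
  have "X \<le> ennreal 64 * (mixed_modulus p f 1 1 + ?k * K_int p f + ennreal (((p - 1) / p\<^sup>2)\<^sup>2) * I_int p f)"
  proof -
    have "8 * ((p - 1) / p\<^sup>2) \<le> 64 * ((p - 1) / p\<^sup>2)" using k by linarith
    then have "g \<le> ennreal (64 * ((p - 1) / p\<^sup>2))" unfolding g_def by (rule ennreal_leI)
    also have "\<dots> = ennreal 64 * ?k" by (rule ennreal_mult') simp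
    finally have 1: "g * K_int p f \<le> ennreal 64 * (?k * K_int p f)"
      by (subst mult.assoc[symmetric]) (rule mult_right_mono, simp_all)
    have "g\<^sup>2 = ennreal (64 * ((p - 1) / p\<^sup>2)\<^sup>2)"
    proof -
      have "0 \<le> 8 * ((p - 1) / p\<^sup>2)" using k by linarith
      then have "g\<^sup>2 = ennreal ((8 * ((p - 1) / p\<^sup>2))\<^sup>2)" unfolding g_def by (rule ennreal_power)
      also have "(8 * ((p - 1) / p\<^sup>2))\<^sup>2 = 64 * ((p - 1) / p\<^sup>2)\<^sup>2" by (subst power_mult_distrib) simp
      finally show ?thesis .
    qed
    then have 2: "g\<^sup>2 * I_int p f = ennreal 64 * (ennreal (((p - 1) / p\<^sup>2)\<^sup>2) * I_int p f)"
      by (simp add: ennreal_mult' mult.assoc)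
    have "1 * mixed_modulus p f 1 1 \<le> ennreal 64 * mixed_modulus p f 1 1" by (intro mult_right_mono) simp_all
    then show ?thesis unfolding X_def distrib_left 2 using 1 by (intro add_mono) simp_all
  qed
  then have "ennreal 32768 * X \<le> ennreal 32768 * (ennreal 64 * (mixed_modulus p f 1 1 + ?k * K_int p f + ennreal (((p - 1) / p\<^sup>2)\<^sup>2) * I_int p f))"
    by (rule mult_left_mono) simp
  also have "\<dots> = ennreal 2097152 * (mixed_modulus p f 1 1 + ?k * K_int p f + ennreal (((p - 1) / p\<^sup>2)\<^sup>2) * I_int p f)"
    by (simp add: mult.assoc[symmetric] flip: ennreal_mult')
  finally have bound: "W_var p G \<le> \<dots>" using W' by (rule order_trans[rotated])
  have "W_var p G < \<infinity>" using W by (rule order.strict_trans1) simp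
  then have "G \<in> VV_class p" using G(2) fin by (simp add: VV_class_def)
  moreover have "AE z in lborel. f z = G z"
  proof -
    have m: "(\<lambda>z. G z - f z) \<in> borel_measurable borel"
      using borel_measurable_continuous_onI[OF G(1)] f by simp
    have "periodic2 (\<lambda>z. G z - f z)" using G(2) per by (simp add: periodic2_iff)
    from Lp_mass_zero_AE[OF m this G(3)] show ?thesis by eventually_elim simp
  qed
  ultimately show ?thesis using that G(1) bound by blast
qed

end

theorem theorem5p7:
  shows "\<exists>A::real. A > 0 \<and>
    (\<forall>(p::real) (p'::real) (f :: real \<times> real \<Rightarrow> real).
       1 < p \<and> p' = p / (p - 1) \<and> f \<in> Lp_space p \<and> I_int p f < \<infinity> \<and> J_int p f < \<infinity> \<longrightarrow>
       (\<exists>g. continuous_on UNIV g \<and> g \<in> VV_class p \<and> (AE z in lebesgue. f z = g z) \<and>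
            W_var p g \<le> ennreal A *
              (mixed_modulus p f 1 1 + ennreal (1 / (p * p')) * K_int p f
               + ennreal ((1 / (p * p'))\<^sup>2) * I_int p f)))"
proof (intro exI[of _ 2097152] conjI allI impI)
  fix p p' :: real and f :: "real \<times> real \<Rightarrow> real"
  assume "1 < p \<and> p' = p / (p - 1) \<and> f \<in> Lp_space p \<and> I_int p f < \<infinity> \<and> J_int p f < \<infinity>"
  then have p: "1 < p" and p': "p' = p / (p - 1)" and f: "f \<in> borel_measurable lebesgue" "periodic2 f" "Lp_norm p f < \<infinity>"
    and I: "I_int p f < \<infinity>" and J: "J_int p f < \<infinity>" by (auto simp: Lp_space_def)
  have k: "1 / (p * p') = (p - 1) / p\<^sup>2" using p by (simp add: p' power2_eq_square)
  obtain f0 where f0: "f0 \<in> borel_measurable borel" "periodic2 f0" and ae: "AE z in lborel. f z = f0 z"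
    using borel_periodic_representative[OF f(1,2)] .
  note mod = moduli_cong_AE[OF ae, of p]
  have ints: "I_int p f = I_int p f0" "J_int p f = J_int p f0" "K_int p f = K_int p f0"
    by (simp_all add: I_int_def J_int_def K_int_def mod)
  have fin: "Lp_norm p f0 < \<infinity>" using f(3) Lp_norm_cong_AE[OF ae, of p] by simp
  interpret Lp_borel p f0 "enn2real (Lp_norm p f0)"
  proof
    have "Lp_norm p f0 \<le> ennreal (enn2real (Lp_norm p f0))" using fin by simp
    then show "Lp_mass p f0 \<le> ennreal (enn2real (Lp_norm p f0) powr p)"
      using p f0(1) by (subst (asm) Lp_norm_le_iff) auto
  qed (use p f0 in auto)
  obtain g where g: "continuous_on UNIV g" "g \<in> VV_class p" "AE z in lborel. f0 z = g z"
    "W_var p g \<le> ennreal 2097152 * (mixed_modulus p f0 1 1 + ennreal ((p - 1) / p\<^sup>2) * K_int p f0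
        + ennreal (((p - 1) / p\<^sup>2)\<^sup>2) * I_int p f0)"
    using representative_with_small_variation I J unfolding ints by blast
  have "AE z in lborel. f z = g z" using ae g(3) by eventually_elim simp
  then have "AE z in lebesgue. f z = g z" by (rule AE_completion)
  then show "\<exists>g. continuous_on UNIV g \<and> g \<in> VV_class p \<and> (AE z in lebesgue. f z = g z) \<and>
            W_var p g \<le> ennreal 2097152 *
              (mixed_modulus p f 1 1 + ennreal (1 / (p * p')) * K_int p f
               + ennreal ((1 / (p * p'))\<^sup>2) * I_int p f)"
    using g unfolding k ints mod by blast
qed simp

end
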